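(* Let $R$ be a Noetherian commutative ring and let $F$ be a countably generated flat $R$-module. Then $F$ is quite flat.
   Context: For a commutative ring $R$, an $R$-module $C$ is called almost cotorsion if $\mathrm{Ext}^1_R(S^{-1}R, C) = 0$ for every (at most) countable multiplicative subset $S \subseteq R$. An $R$-module $F$ is called quite flat if $\mathrm{Ext}^1_R(F, C) = 0$ for every almost cotorsion $R$-module $C$. (Equivalently, the quite flat modules are the direct summands of transfinite extensions of modules of the form $S^{-1}R$ with $S$ a countable multiplicative subset of $R$.) *)

theory Defs
  imports "HOL-Algebra.Algebra" "HOL-Library.Countable_Set"
begin

definition lin_hom :: "('r, 'x) ring_scheme \<Rightarrow> ('r, 'm, 'e1) module_scheme
    \<Rightarrow> ('r, 'n, 'e2) module_scheme \<Rightarrow> ('m \<Rightarrow> 'n) set" where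
  "lin_hom R M N = {f. f \<in> carrier M \<rightarrow> carrier N
     \<and> (\<forall>x\<in>carrier M. \<forall>y\<in>carrier M. f (x \<oplus>\<^bsub>M\<^esub> y) = f x \<oplus>\<^bsub>N\<^esub> f y)
     \<and> (\<forall>a\<in>carrier R. \<forall>x\<in>carrier M. f (a \<odot>\<^bsub>M\<^esub> x) = a \<odot>\<^bsub>N\<^esub> f x)}"

definition coeffs :: "('r, 'x) ring_scheme \<Rightarrow> ('r, 'm, 'e) module_scheme \<Rightarrow> ('m \<Rightarrow> 'r) set" where
  "coeffs R M = {c. (\<forall>x. c x \<in> carrier R) \<and> finite {x. c x \<noteq> \<zero>\<^bsub>R\<^esub>}
                   \<and> {x. c x \<noteq> \<zero>\<^bsub>R\<^esub>} \<subseteq> carrier M}"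

definition lin_comb :: "('r, 'x) ring_scheme \<Rightarrow> ('r, 'm, 'e) module_scheme \<Rightarrow> ('m \<Rightarrow> 'r) \<Rightarrow> 'm" where
  "lin_comb R M c = (\<Oplus>\<^bsub>M\<^esub> x \<in> {x. c x \<noteq> \<zero>\<^bsub>R\<^esub>}. c x \<odot>\<^bsub>M\<^esub> x)"

definition free_mod :: "('r, 'x) ring_scheme \<Rightarrow> ('r, 'm, 'e) module_scheme \<Rightarrow> ('r, 'm \<Rightarrow> 'r) module" where
  "free_mod R M = \<lparr>carrier = coeffs R M, monoid.mult = (\<lambda>_ _. undefined), one = undefined,
     ring.zero = (\<lambda>_. \<zero>\<^bsub>R\<^esub>), ring.add = (\<lambda>c d x. c x \<oplus>\<^bsub>R\<^esub> d x),
     module.smult = (\<lambda>a c x. a \<otimes>\<^bsub>R\<^esub> c x)\<rparr>"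

definition pres_kernel :: "('r, 'x) ring_scheme \<Rightarrow> ('r, 'm, 'e) module_scheme \<Rightarrow> ('r, 'm \<Rightarrow> 'r) module" where
  "pres_kernel R M = (free_mod R M)
     \<lparr>carrier := {c \<in> coeffs R M. lin_comb R M c = \<zero>\<^bsub>M\<^esub>}\<rparr>"

text \<open>Ext^1_R(M,C) = 0, computed from the projective (free) presentation
  0 \<rightarrow> K \<rightarrow> P \<rightarrow> M \<rightarrow> 0: Ext^1_R(M,C) is the cokernel of the restriction map
  Hom_R(P,C) \<rightarrow> Hom_R(K,C), so it vanishes iff every homomorphism K \<rightarrow> C extends to P.\<close>
definition ext1_vanishes :: "('r, 'x) ring_scheme \<Rightarrow> ('r, 'm, 'e1) module_scheme
    \<Rightarrow> ('r, 'c, 'e2) module_scheme \<Rightarrow> bool" where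
  "ext1_vanishes R M C \<longleftrightarrow>
     (\<forall>\<phi> \<in> lin_hom R (pres_kernel R M) C. \<exists>\<psi> \<in> lin_hom R (free_mod R M) C.
        \<forall>c \<in> carrier (pres_kernel R M). \<psi> c = \<phi> c)"

definition mult_subset :: "('r, 'x) ring_scheme \<Rightarrow> 'r set \<Rightarrow> bool" where
  "mult_subset R S \<longleftrightarrow> S \<subseteq> carrier R \<and> \<one>\<^bsub>R\<^esub> \<in> S
     \<and> (\<forall>s\<in>S. \<forall>t\<in>S. s \<otimes>\<^bsub>R\<^esub> t \<in> S)"

definition loc_rel :: "('r, 'x) ring_scheme \<Rightarrow> 'r set \<Rightarrow> (('r \<times> 'r) \<times> ('r \<times> 'r)) set" where
  "loc_rel R S = {((r, s), (r', s')). r \<in> carrier R \<and> s \<in> S \<and> r' \<in> carrier R \<and> s' \<in> S \<and>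
     (\<exists>t\<in>S. t \<otimes>\<^bsub>R\<^esub> a_minus R (r \<otimes>\<^bsub>R\<^esub> s') (r' \<otimes>\<^bsub>R\<^esub> s) = \<zero>\<^bsub>R\<^esub>)}"

definition loc_class :: "('r, 'x) ring_scheme \<Rightarrow> 'r set \<Rightarrow> 'r \<times> 'r \<Rightarrow> ('r \<times> 'r) set" where
  "loc_class R S p = loc_rel R S `` {p}"

definition loc_rep :: "('r \<times> 'r) set \<Rightarrow> 'r \<times> 'r" where
  "loc_rep U = (SOME p. p \<in> U)"

definition loc :: "('r, 'x) ring_scheme \<Rightarrow> 'r set \<Rightarrow> ('r, ('r \<times> 'r) set) module" where
  "loc R S = \<lparr>carrier = (carrier R \<times> S) // loc_rel R S,
     monoid.mult = (\<lambda>_ _. undefined), one = undefined,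
     ring.zero = loc_class R S (\<zero>\<^bsub>R\<^esub>, \<one>\<^bsub>R\<^esub>),
     ring.add = (\<lambda>U V. loc_class R S
        (fst (loc_rep U) \<otimes>\<^bsub>R\<^esub> snd (loc_rep V) \<oplus>\<^bsub>R\<^esub> fst (loc_rep V) \<otimes>\<^bsub>R\<^esub> snd (loc_rep U),
         snd (loc_rep U) \<otimes>\<^bsub>R\<^esub> snd (loc_rep V))),
     module.smult = (\<lambda>a U. loc_class R S (a \<otimes>\<^bsub>R\<^esub> fst (loc_rep U), snd (loc_rep U)))\<rparr>"

definition almost_cotorsion :: "('r, 'x) ring_scheme \<Rightarrow> ('r, 'c, 'e) module_scheme \<Rightarrow> bool" where
  "almost_cotorsion R C \<longleftrightarrow>
     (\<forall>S. mult_subset R S \<and> countable S \<longrightarrow> ext1_vanishes R (loc R S) C)"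

definition countably_generated :: "('r, 'x) ring_scheme \<Rightarrow> ('r, 'm, 'e) module_scheme \<Rightarrow> bool" where
  "countably_generated R M \<longleftrightarrow> (\<exists>U \<subseteq> carrier M. countable U \<and>
     carrier M = {lin_comb R M c | c. c \<in> coeffs R M \<and> {x. c x \<noteq> \<zero>\<^bsub>R\<^esub>} \<subseteq> U})"

section \<open>Flatness (via ideals: I \<otimes>_R F \<rightarrow> F injective for every ideal I)\<close>

text \<open>I \<otimes>_R F is the free abelian group on I \<times> F modulo the bilinearity and
  balancing relations; formal sums are finitely supported integer-valued functions.\<close>
definition tformal :: "('r, 'x) ring_scheme \<Rightarrow> 'r set \<Rightarrow> ('r, 'm, 'e) module_scheme
    \<Rightarrow> ('r \<times> 'm \<Rightarrow> int) set" where
  "tformal R I F = {t. finite {p. t p \<noteq> 0} \<and> {p. t p \<noteq> 0} \<subseteq> I \<times> carrier F}"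

definition tdelta :: "'r \<times> 'm \<Rightarrow> 'r \<times> 'm \<Rightarrow> int" where
  "tdelta p = (\<lambda>q. if q = p then 1 else 0)"

definition tgens :: "('r, 'x) ring_scheme \<Rightarrow> 'r set \<Rightarrow> ('r, 'm, 'e) module_scheme
    \<Rightarrow> ('r \<times> 'm \<Rightarrow> int) set" where
  "tgens R I F =
     {(\<lambda>q. tdelta (a \<oplus>\<^bsub>R\<^esub> a', x) q - tdelta (a, x) q - tdelta (a', x) q) | a a' x.
        a \<in> I \<and> a' \<in> I \<and> x \<in> carrier F}
   \<union> {(\<lambda>q. tdelta (a, x \<oplus>\<^bsub>F\<^esub> x') q - tdelta (a, x) q - tdelta (a, x') q) | a x x'.
        a \<in> I \<and> x \<in> carrier F \<and> x' \<in> carrier F}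
   \<union> {(\<lambda>q. tdelta (r \<otimes>\<^bsub>R\<^esub> a, x) q - tdelta (a, r \<odot>\<^bsub>F\<^esub> x) q) | r a x.
        r \<in> carrier R \<and> a \<in> I \<and> x \<in> carrier F}"

text \<open>The subgroup generated by the relations (= kernel of the quotient map onto I \<otimes>_R F).\<close>
inductive_set tspan :: "('r, 'x) ring_scheme \<Rightarrow> 'r set \<Rightarrow> ('r, 'm, 'e) module_scheme
    \<Rightarrow> ('r \<times> 'm \<Rightarrow> int) set" for R I F where
  tspan_zero: "(\<lambda>_. 0) \<in> tspan R I F"
| tspan_add: "t \<in> tspan R I F \<Longrightarrow> g \<in> tgens R I F \<Longrightarrow> (\<lambda>q. t q + g q) \<in> tspan R I F"
| tspan_diff: "t \<in> tspan R I F \<Longrightarrow> g \<in> tgens R I F \<Longrightarrow> (\<lambda>q. t q - g q) \<in> tspan R I F"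

definition teval :: "('r, 'x) ring_scheme \<Rightarrow> ('r, 'm, 'e) module_scheme \<Rightarrow> ('r \<times> 'm \<Rightarrow> int) \<Rightarrow> 'm" where
  "teval R F t = (\<Oplus>\<^bsub>F\<^esub> p \<in> {p. t p \<noteq> 0}. add_pow F (t p) (fst p \<odot>\<^bsub>F\<^esub> snd p))"

definition flat :: "('r, 'x) ring_scheme \<Rightarrow> ('r, 'm, 'e) module_scheme \<Rightarrow> bool" where
  "flat R F \<longleftrightarrow> (\<forall>I. ideal I R \<longrightarrow>
     (\<forall>t \<in> tformal R I F. teval R F t = \<zero>\<^bsub>F\<^esub> \<longrightarrow> t \<in> tspan R I F))"

end

theory Submission
  imports Defs
begin

text \<open>
  The equational criterion kills a relation between finitely many elements of a flat module by
  expressing these elements through other ones. Over a Noetherian ring all relations of a finite family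
  can be killed at once, so that a countably generated flat module \<open>F\<close> is the colimit of a sequence of
  finite free modules \<open>L\<^sub>n\<close>, and \<open>Ext\<^sup>1(F, C)\<close> is \<open>lim\<^sup>1 Hom(L\<^sub>n, C)\<close>.

  For almost cotorsion \<open>C\<close>, the vanishing of \<open>lim\<^sup>1\<close> modulo a submodule \<open>N\<close> is proved by Noetherian
  induction on the annihilator of \<open>C/N\<close>; one may assume it for \<open>N + aC\<close> whenever \<open>a\<close> is not in the
  annihilator. If the annihilator is not prime, two such solutions combine. If it is a prime \<open>p\<close>, the
  system \<open>Hom(L\<^sub>n, C/N)\<close> becomes Mittag-Leffler after inverting countably many elements outside \<open>p\<close>.
  Solve successively modulo \<open>t\<^sub>0 C\<close>, \<open>t\<^sub>1 C\<close>, \<open>\<dots>\<close>, where \<open>t\<^sub>j\<close> runs through growing products of these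
  elements. As \<open>C\<close> is almost cotorsion, the corrections have a formal sum \<open>y\<^sub>j = x\<^sub>j + t\<^sub>j y\<^sub>j\<^sub>+\<^sub>1\<close>. The
  remainders form towers \<open>z\<^sub>j \<equiv> t\<^sub>j z\<^sub>j\<^sub>+\<^sub>1\<close>, which are divisible by all the inverted elements, so the
  Mittag-Leffler argument applies to them.
\<close>

section \<open>Modules and linear maps\<close>

context abelian_group
begin

lemma diff_eq_zero_iff: "\<lbrakk>a \<in> carrier G; b \<in> carrier G\<rbrakk> \<Longrightarrow> a \<ominus> b = \<zero> \<longleftrightarrow> a = b"
  by (simp add: add.inv_solve_right' minus_eq)

lemma diff_add_cancel: "\<lbrakk>a \<in> carrier G; b \<in> carrier G\<rbrakk> \<Longrightarrow> (a \<ominus> b) \<oplus> b = a"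
  by (simp add: minus_eq a_assoc l_neg)

lemma add_diff_cancel: "\<lbrakk>a \<in> carrier G; b \<in> carrier G\<rbrakk> \<Longrightarrow> (a \<oplus> b) \<ominus> b = a"
  by (simp add: minus_eq a_assoc r_neg)

lemma add_diff_add:
  "\<lbrakk>a \<in> carrier G; b \<in> carrier G; c \<in> carrier G; d \<in> carrier G\<rbrakk> \<Longrightarrow>
   (a \<oplus> b) \<ominus> (c \<oplus> d) = (a \<ominus> c) \<oplus> (b \<ominus> d)"
  by (simp add: minus_eq minus_add a_ac)

lemma diff_add_diff:
  "\<lbrakk>a \<in> carrier G; b \<in> carrier G; c \<in> carrier G\<rbrakk> \<Longrightarrow> (a \<ominus> b) \<oplus> (b \<ominus> c) = a \<ominus> c"
  by (simp add: minus_eq a_assoc r_neg1)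

lemma minus_diff: "\<lbrakk>a \<in> carrier G; b \<in> carrier G\<rbrakk> \<Longrightarrow> \<ominus> (a \<ominus> b) = b \<ominus> a"
  by (simp add: minus_eq minus_add a_comm)

lemma diff_zero: "a \<in> carrier G \<Longrightarrow> a \<ominus> \<zero> = a"
  by (simp add: minus_eq)

end

context module
begin

lemma smult_diff:
  "\<lbrakk>r \<in> carrier R; a \<in> carrier M; b \<in> carrier M\<rbrakk> \<Longrightarrow>
   r \<odot>\<^bsub>M\<^esub> (a \<ominus>\<^bsub>M\<^esub> b) = r \<odot>\<^bsub>M\<^esub> a \<ominus>\<^bsub>M\<^esub> r \<odot>\<^bsub>M\<^esub> b"
  by (simp add: M.minus_eq smult_r_distr smult_r_minus)

lemma smult_lcomm:
  "\<lbrakk>r \<in> carrier R; s \<in> carrier R; a \<in> carrier M\<rbrakk> \<Longrightarrow>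
   r \<odot>\<^bsub>M\<^esub> (s \<odot>\<^bsub>M\<^esub> a) = s \<odot>\<^bsub>M\<^esub> (r \<odot>\<^bsub>M\<^esub> a)"
  by (metis R.m_comm smult_assoc1)

lemma submodule_zero: "submodule N R M \<Longrightarrow> \<zero>\<^bsub>M\<^esub> \<in> N"
  using submodule.axioms(1)[of N R M] subgroup.one_closed by fastforce

lemma submodule_diff: "\<lbrakk>submodule N R M; x \<in> N; y \<in> N\<rbrakk> \<Longrightarrow> x \<ominus>\<^bsub>M\<^esub> y \<in> N"
  by (simp add: M.minus_eq submoduleE(3,5))

lemma finsum_mem_submodule:
  assumes N: "submodule N R M" and f: "\<And>i. i \<in> A \<Longrightarrow> f i \<in> N"
  shows "(\<Oplus>\<^bsub>M\<^esub> i \<in> A. f i) \<in> N"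
proof (cases "finite A")
  case True
  then show ?thesis using f
  proof (induction A rule: finite_induct)
    case empty
    show ?case by (simp add: submodule_zero[OF N])
  next
    case (insert i A)
    then have "f ` insert i A \<subseteq> carrier M" using submoduleE(1)[OF N] by blast
    then have "(\<Oplus>\<^bsub>M\<^esub> j \<in> insert i A. f j) = f i \<oplus>\<^bsub>M\<^esub> (\<Oplus>\<^bsub>M\<^esub> j \<in> A. f j)"
      using insert by (intro M.finsum_insert) auto
    then show ?case using insert by (simp add: submoduleE(5)[OF N])
  qed
qed (simp add: submodule_zero[OF N])

lemma submodule_Union_chain:
  assumes N: "\<And>n. submodule (N n) R M" and mono: "\<And>n::nat. N n \<subseteq> N (Suc n)"
  shows "submodule (\<Union>n. N n) R M"
proof (rule submoduleI)
  show "(\<Union>n. N n) \<subseteq> carrier M" using submoduleE(1)[OF N] by blast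
  show "\<zero>\<^bsub>M\<^esub> \<in> (\<Union>n. N n)" using submodule_zero[OF N] by blast
  show "\<ominus>\<^bsub>M\<^esub> x \<in> (\<Union>n. N n)" if "x \<in> (\<Union>n. N n)" for x
    using that submoduleE(3)[OF N] by blast
  show "a \<odot>\<^bsub>M\<^esub> x \<in> (\<Union>n. N n)" if "a \<in> carrier R" "x \<in> (\<Union>n. N n)" for a x
    using that submoduleE(4)[OF N] by blast
  show "x \<oplus>\<^bsub>M\<^esub> y \<in> (\<Union>n. N n)" if xy: "x \<in> (\<Union>n. N n)" "y \<in> (\<Union>n. N n)" for x y
  proof -
    obtain m n where "x \<in> N m" "y \<in> N n" using xy by blast
    then have "x \<in> N (max m n)" "y \<in> N (max m n)"
      using lift_Suc_mono_le[of N, OF mono] by (meson max.cobounded1 max.cobounded2 subsetD)+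
    then show ?thesis using submoduleE(5)[OF N] by blast
  qed
qed

end

lemma lin_homI:
  assumes "\<And>x. x \<in> carrier M \<Longrightarrow> f x \<in> carrier N"
    and "\<And>x y. \<lbrakk>x \<in> carrier M; y \<in> carrier M\<rbrakk> \<Longrightarrow> f (x \<oplus>\<^bsub>M\<^esub> y) = f x \<oplus>\<^bsub>N\<^esub> f y"
    and "\<And>a x. \<lbrakk>a \<in> carrier R; x \<in> carrier M\<rbrakk> \<Longrightarrow> f (a \<odot>\<^bsub>M\<^esub> x) = a \<odot>\<^bsub>N\<^esub> f x"
  shows "f \<in> lin_hom R M N"
  using assms by (auto simp: lin_hom_def)

lemma lin_hom_compose:
  "\<lbrakk>f \<in> lin_hom R M N; g \<in> lin_hom R N P\<rbrakk> \<Longrightarrow> (\<lambda>x. g (f x)) \<in> lin_hom R M P"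
  by (auto simp: lin_hom_def Pi_iff)

context module
begin

lemma lin_hom_add:
  "\<lbrakk>f \<in> lin_hom R L M; g \<in> lin_hom R L M\<rbrakk> \<Longrightarrow> (\<lambda>x. f x \<oplus>\<^bsub>M\<^esub> g x) \<in> lin_hom R L M"
  by (simp add: lin_hom_def Pi_iff smult_r_distr M.a_ac)

lemma lin_hom_smult: "\<lbrakk>a \<in> carrier R; f \<in> lin_hom R L M\<rbrakk> \<Longrightarrow> (\<lambda>x. a \<odot>\<^bsub>M\<^esub> f x) \<in> lin_hom R L M"
  by (simp add: lin_hom_def Pi_iff smult_r_distr smult_lcomm)

lemma lin_hom_diff:
  "\<lbrakk>f \<in> lin_hom R L M; g \<in> lin_hom R L M\<rbrakk> \<Longrightarrow> (\<lambda>x. f x \<ominus>\<^bsub>M\<^esub> g x) \<in> lin_hom R L M"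
  by (simp add: lin_hom_def Pi_iff smult_diff M.add_diff_add)

end

locale linear_map = M: module R M + N: module R N
  for R (structure) and M (structure) and N (structure) +
  fixes f
  assumes lin_hom: "f \<in> lin_hom R M N"
begin

lemma closed [simp, intro]: "x \<in> carrier M \<Longrightarrow> f x \<in> carrier N"
  and add [simp]: "\<lbrakk>x \<in> carrier M; y \<in> carrier M\<rbrakk> \<Longrightarrow> f (x \<oplus>\<^bsub>M\<^esub> y) = f x \<oplus>\<^bsub>N\<^esub> f y"
  and smult [simp]: "\<lbrakk>a \<in> carrier R; x \<in> carrier M\<rbrakk> \<Longrightarrow> f (a \<odot>\<^bsub>M\<^esub> x) = a \<odot>\<^bsub>N\<^esub> f x"
  using lin_hom by (auto simp: lin_hom_def)

lemma zero [simp]: "f \<zero>\<^bsub>M\<^esub> = \<zero>\<^bsub>N\<^esub>"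
  using smult[of "\<zero>" "\<zero>\<^bsub>M\<^esub>"] by simp

lemma minus [simp]: "x \<in> carrier M \<Longrightarrow> f (\<ominus>\<^bsub>M\<^esub> x) = \<ominus>\<^bsub>N\<^esub> f x"
  using smult[of "\<ominus> \<one>" x] by (simp add: M.smult_l_minus N.smult_l_minus)

lemma diff [simp]: "\<lbrakk>x \<in> carrier M; y \<in> carrier M\<rbrakk> \<Longrightarrow> f (x \<ominus>\<^bsub>M\<^esub> y) = f x \<ominus>\<^bsub>N\<^esub> f y"
  by (simp add: M.M.minus_eq N.M.minus_eq)

lemma submodule_vimage:
  assumes "submodule W R N"
  shows "submodule {x \<in> carrier M. f x \<in> W} R M"
  by (rule M.submoduleI) (auto simp: N.submodule_zero[OF assms] N.submoduleE[OF assms])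

lemma submodule_image:
  assumes V: "submodule V R M"
  shows "submodule (f ` V) R N"
proof (rule N.submoduleI)
  note sub = M.submoduleE[OF V]
  show "f ` V \<subseteq> carrier N" using sub(1) by auto
  show "\<zero>\<^bsub>N\<^esub> \<in> f ` V" using zero M.submodule_zero[OF V] by (metis image_eqI)
  show "\<ominus>\<^bsub>N\<^esub> y \<in> f ` V" if "y \<in> f ` V" for y
    using that sub(1,3) by (auto simp flip: minus)
  show "y \<oplus>\<^bsub>N\<^esub> z \<in> f ` V" if "y \<in> f ` V" "z \<in> f ` V" for y z
    using that sub(1,5) by (auto simp: subset_iff simp flip: add)
  show "a \<odot>\<^bsub>N\<^esub> y \<in> f ` V" if "a \<in> carrier R" "y \<in> f ` V" for a y
    using that sub(1,4) by (auto simp: subset_iff simp flip: smult)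
qed

lemma submodule_kernel: "submodule (a_kernel M N f) R M"
proof -
  have "submodule {\<zero>\<^bsub>N\<^esub>} R N" by (rule N.submoduleI) (simp_all add: N.M.add.inv_one)
  from submodule_vimage[OF this] show ?thesis unfolding a_kernel_def' singleton_iff .
qed

lemma restrict:
  assumes "submodule V R M"
  shows "linear_map R (M\<lparr>carrier := V\<rparr>) N f"
  by (intro linear_map.intro linear_map_axioms.intro N.module_axioms lin_homI
      submodule.submodule_is_module[OF assms M.module_axioms])
    (simp_all add: subsetD[OF M.submoduleE(1)[OF assms]])

end

lemma linear_mapI: "\<lbrakk>module R M; module R N; f \<in> lin_hom R M N\<rbrakk> \<Longrightarrow> linear_map R M N f"
  by (intro linear_map.intro linear_map_axioms.intro)

definition regular_module :: "('a, 'b) ring_scheme \<Rightarrow> ('a, 'a) module" where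
  "regular_module R = \<lparr>carrier = carrier R, monoid.mult = monoid.mult R, one = one R,
     ring.zero = ring.zero R, ring.add = ring.add R, module.smult = monoid.mult R\<rparr>"

lemma regular_module_simps [simp]:
  "carrier (regular_module R) = carrier R"
  "\<zero>\<^bsub>regular_module R\<^esub> = \<zero>\<^bsub>R\<^esub>"
  "(\<oplus>\<^bsub>regular_module R\<^esub>) = (\<oplus>\<^bsub>R\<^esub>)"
  "(\<odot>\<^bsub>regular_module R\<^esub>) = (\<otimes>\<^bsub>R\<^esub>)"
  "a_inv (regular_module R) = a_inv R"
  "a_minus (regular_module R) = a_minus R"
  by (auto simp: regular_module_def a_inv_def m_inv_def a_minus_def fun_eq_iff)

lemma finsum_regular_module [simp]: "finsum (regular_module R) = finsum R"
  by (simp add: regular_module_def finsum_def finprod_def fun_eq_iff)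

lemma (in cring) regular_module: "module R (regular_module R)"
proof (rule moduleI)
  show "abelian_group (regular_module R)"
  proof (rule abelian_groupI)
    show "\<exists>y\<in>carrier (regular_module R). y \<oplus>\<^bsub>regular_module R\<^esub> x = \<zero>\<^bsub>regular_module R\<^esub>"
      if "x \<in> carrier (regular_module R)" for x
      using that l_neg[of x] by (intro bexI[of _ "\<ominus> x"]) auto
  qed (simp_all add: a_ac)
qed (simp_all add: is_cring l_distr r_distr m_assoc)

section \<open>Free modules\<close>

definition free_module :: "('r, 'x) ring_scheme \<Rightarrow> 'i set \<Rightarrow> ('r, 'i \<Rightarrow> 'r) module" where
  "free_module R I =
     \<lparr>carrier = {c. (\<forall>i. c i \<in> carrier R) \<and> finite {i. c i \<noteq> \<zero>\<^bsub>R\<^esub>} \<and> {i. c i \<noteq> \<zero>\<^bsub>R\<^esub>} \<subseteq> I},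
      monoid.mult = (\<lambda>_ _. undefined), one = undefined, ring.zero = (\<lambda>_. \<zero>\<^bsub>R\<^esub>),
      ring.add = (\<lambda>c d i. c i \<oplus>\<^bsub>R\<^esub> d i), module.smult = (\<lambda>a c i. a \<otimes>\<^bsub>R\<^esub> c i)\<rparr>"

definition unit_vec :: "('r, 'x) ring_scheme \<Rightarrow> 'i \<Rightarrow> 'i \<Rightarrow> 'r" where
  "unit_vec R i = (\<lambda>j. if j = i then \<one>\<^bsub>R\<^esub> else \<zero>\<^bsub>R\<^esub>)"

definition lin_ext :: "('r, 'x) ring_scheme \<Rightarrow> ('r, 'm, 'e) module_scheme \<Rightarrow> ('i \<Rightarrow> 'm) \<Rightarrow>
    ('i \<Rightarrow> 'r) \<Rightarrow> 'm" where
  "lin_ext R M e c = (\<Oplus>\<^bsub>M\<^esub> i \<in> {i. c i \<noteq> \<zero>\<^bsub>R\<^esub>}. c i \<odot>\<^bsub>M\<^esub> e i)"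

lemma free_module_simps [simp]:
  "\<zero>\<^bsub>free_module R I\<^esub> = (\<lambda>i. \<zero>\<^bsub>R\<^esub>)"
  "c \<oplus>\<^bsub>free_module R I\<^esub> d = (\<lambda>i. c i \<oplus>\<^bsub>R\<^esub> d i)"
  "a \<odot>\<^bsub>free_module R I\<^esub> c = (\<lambda>i. a \<otimes>\<^bsub>R\<^esub> c i)"
  by (simp_all add: free_module_def)

lemma free_moduleI:
  assumes "\<And>i. c i \<in> carrier R" "finite {i. c i \<noteq> \<zero>\<^bsub>R\<^esub>}" "\<And>i. i \<notin> I \<Longrightarrow> c i = \<zero>\<^bsub>R\<^esub>"
  shows "c \<in> carrier (free_module R I)"
  using assms by (auto simp: free_module_def)

lemma finite_free_moduleI:
  assumes "finite I" "\<And>i. c i \<in> carrier R" "\<And>i. i \<notin> I \<Longrightarrow> c i = \<zero>\<^bsub>R\<^esub>"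
  shows "c \<in> carrier (free_module R I)"
  using assms by (intro free_moduleI) (auto intro: finite_subset)

lemma free_moduleD:
  assumes "c \<in> carrier (free_module R I)"
  shows "c i \<in> carrier R" "finite {i. c i \<noteq> \<zero>\<^bsub>R\<^esub>}" "i \<notin> I \<Longrightarrow> c i = \<zero>\<^bsub>R\<^esub>"
  using assms by (auto simp: free_module_def)

context cring
begin

lemma free_module: "module R (free_module R I)"
proof (rule moduleI)
  have add: "(\<lambda>i. c i \<oplus> d i) \<in> carrier (free_module R I)"
    if "c \<in> carrier (free_module R I)" "d \<in> carrier (free_module R I)" for c d
  proof (rule free_moduleI)
    show "finite {i. c i \<oplus> d i \<noteq> \<zero>}"
      by (rule finite_subset[of _ "{i. c i \<noteq> \<zero>} \<union> {i. d i \<noteq> \<zero>}"])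
        (use free_moduleD(2)[OF that(1)] free_moduleD(2)[OF that(2)] in auto)
  qed (use free_moduleD(1,3)[OF that(1)] free_moduleD(1,3)[OF that(2)] in auto)
  have smult: "(\<lambda>i. a \<otimes> c i) \<in> carrier (free_module R I)"
    if "a \<in> carrier R" "c \<in> carrier (free_module R I)" for a c
  proof (rule free_moduleI)
    show "finite {i. a \<otimes> c i \<noteq> \<zero>}"
      by (rule finite_subset[of _ "{i. c i \<noteq> \<zero>}"]) (use that(1) free_moduleD(2)[OF that(2)] in auto)
  qed (use that(1) free_moduleD(1,3)[OF that(2)] in auto)
  show "abelian_group (free_module R I)"
  proof (rule abelian_groupI)
    fix c assume c: "c \<in> carrier (free_module R I)"
    show "\<exists>d\<in>carrier (free_module R I). d \<oplus>\<^bsub>free_module R I\<^esub> c = \<zero>\<^bsub>free_module R I\<^esub>"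
      using smult[OF _ c, of "\<ominus> \<one>"] free_moduleD(1)[OF c]
      by (intro bexI[of _ "\<lambda>i. (\<ominus> \<one>) \<otimes> c i"]) (auto simp: l_minus l_neg)
  next
    show "\<zero>\<^bsub>free_module R I\<^esub> \<in> carrier (free_module R I)" by (simp add: free_moduleI)
  qed (simp_all add: add free_moduleD(1)[of _ R I] a_ac)
  show "a \<odot>\<^bsub>free_module R I\<^esub> c \<in> carrier (free_module R I)"
    if "a \<in> carrier R" "c \<in> carrier (free_module R I)" for a c
    using smult that by simp
qed (simp_all add: is_cring free_moduleD(1)[of _ R I] l_distr r_distr m_assoc)

lemma unit_vec_closed [simp]: "i \<in> I \<Longrightarrow> unit_vec R i \<in> carrier (free_module R I)"
  by (rule free_moduleI) (auto simp: unit_vec_def)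

lemma unit_vec_apply_closed [simp]: "unit_vec R i j \<in> carrier R"
  by (simp add: unit_vec_def)

lemma ones_closed: "finite J \<Longrightarrow> (\<lambda>j. if j \<in> J then \<one> else \<zero>) \<in> carrier (free_module R J)"
  by (rule finite_free_moduleI) auto

lemma free_module_mono: "I \<subseteq> J \<Longrightarrow> c \<in> carrier (free_module R I) \<Longrightarrow> c \<in> carrier (free_module R J)"
  using free_moduleD[of c R I] by (intro free_moduleI) auto

lemma coordinate_linear_map: "linear_map R (free_module R I) (regular_module R) (\<lambda>c. c i)"
  by (intro linear_mapI free_module regular_module lin_homI)
    (auto simp: free_moduleD(1))

lemma free_module_diff:
  assumes "c \<in> carrier (free_module R I)" "d \<in> carrier (free_module R I)"
  shows "(c \<ominus>\<^bsub>free_module R I\<^esub> d) i = c i \<ominus> d i"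
  using linear_map.diff[OF coordinate_linear_map assms] by simp

lemma free_module_induct [consumes 1, case_names zero add]:
  assumes "c \<in> carrier (free_module R I)" and zero: "P (\<lambda>i. \<zero>)"
    and add: "\<And>c a i. \<lbrakk>c \<in> carrier (free_module R I); P c; a \<in> carrier R; i \<in> I\<rbrakk> \<Longrightarrow>
      P (c \<oplus>\<^bsub>free_module R I\<^esub> a \<odot>\<^bsub>free_module R I\<^esub> unit_vec R i)"
  shows "P c"
proof -
  have "P c" if "finite J" "J \<subseteq> I" "c \<in> carrier (free_module R J)" for J c
    using that
  proof (induction J arbitrary: c rule: finite_induct)
    case empty
    then have "c = (\<lambda>i. \<zero>)" using free_moduleD(3)[OF empty(2)] by auto
    then show ?case using zero by simp
  next
    case (insert j J)
    note c = free_moduleD[OF insert.prems(2)]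
    have c': "c(j := \<zero>) \<in> carrier (free_module R J)"
      using insert c by (intro finite_free_moduleI) auto
    have "P (c(j := \<zero>) \<oplus>\<^bsub>free_module R I\<^esub> c j \<odot>\<^bsub>free_module R I\<^esub> unit_vec R j)"
    proof (rule add)
      show "c(j := \<zero>) \<in> carrier (free_module R I)"
        using insert.prems(1) by (intro free_module_mono[OF _ c']) auto
      show "P (c(j := \<zero>))" using insert.prems(1) by (intro insert.IH[OF _ c']) auto
    qed (use insert.prems(1) c(1) in auto)
    also have "c(j := \<zero>) \<oplus>\<^bsub>free_module R I\<^esub> c j \<odot>\<^bsub>free_module R I\<^esub> unit_vec R j = c"
      using c(1) by (auto simp: unit_vec_def)
    finally show ?case .
  qed
  moreover have "c \<in> carrier (free_module R {i. c i \<noteq> \<zero>})"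
    using free_moduleD[OF assms(1)] by (intro free_moduleI) auto
  ultimately show ?thesis using free_moduleD(2,3)[OF assms(1)] by blast
qed

end

context module
begin

lemma lin_ext_eq_finsum:
  assumes "c \<in> carrier (free_module R I)" "e \<in> I \<rightarrow> carrier M"
    and "finite J" "J \<subseteq> I" "\<And>i. i \<notin> J \<Longrightarrow> c i = \<zero>"
  shows "lin_ext R M e c = (\<Oplus>\<^bsub>M\<^esub> i \<in> J. c i \<odot>\<^bsub>M\<^esub> e i)"
proof -
  have "e i \<in> carrier M" if "i \<in> J" for i using that assms(2,4) by auto
  then show ?thesis
    unfolding lin_ext_def
    by (intro M.add.finprod_mono_neutral_cong_left)
      (use assms(3,5) free_moduleD(1)[OF assms(1)] in auto)
qed

lemma lin_ext_mem_submodule: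
  assumes "submodule N R M" "\<And>i. c i \<noteq> \<zero> \<Longrightarrow> c i \<odot>\<^bsub>M\<^esub> e i \<in> N"
  shows "lin_ext R M e c \<in> N"
  unfolding lin_ext_def using assms by (intro finsum_mem_submodule) auto

lemma lin_ext_closed [simp]:
  assumes "c \<in> carrier (free_module R I)" "e \<in> I \<rightarrow> carrier M"
  shows "lin_ext R M e c \<in> carrier M"
  by (intro lin_ext_mem_submodule carrier_is_submodule smult_closed free_moduleD(1)[OF assms(1)])
    (use free_moduleD(3)[OF assms(1)] assms(2) in auto)

lemma lin_ext_hom:
  assumes e: "e \<in> I \<rightarrow> carrier M"
  shows "lin_ext R M e \<in> lin_hom R (free_module R I) M"
proof (rule lin_homI)
  interpret Free: module R "free_module R I" by (rule R.free_module)
  fix c assume c: "c \<in> carrier (free_module R I)"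
  show "lin_ext R M e c \<in> carrier M" using c e by simp
  fix d assume d: "d \<in> carrier (free_module R I)"
  let ?J = "{i. c i \<noteq> \<zero>} \<union> {i. d i \<noteq> \<zero>}"
  have J: "finite ?J" "?J \<subseteq> I" using free_moduleD[OF c] free_moduleD[OF d] by auto
  have e_closed: "e i \<in> carrier M" if "i \<in> ?J" for i
    using subsetD[OF J(2) that] e by auto
  note cd = free_moduleD(1)[OF c] free_moduleD(1)[OF d]
  have "lin_ext R M e (c \<oplus>\<^bsub>free_module R I\<^esub> d) = (\<Oplus>\<^bsub>M\<^esub> i \<in> ?J. (c i \<oplus> d i) \<odot>\<^bsub>M\<^esub> e i)"
    using Free.a_closed[OF c d] J by (subst lin_ext_eq_finsum[OF _ e]) auto
  also have "\<dots> = (\<Oplus>\<^bsub>M\<^esub> i \<in> ?J. c i \<odot>\<^bsub>M\<^esub> e i \<oplus>\<^bsub>M\<^esub> d i \<odot>\<^bsub>M\<^esub> e i)"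
    by (rule M.finsum_cong') (use e_closed cd in \<open>auto simp: smult_l_distr\<close>)
  also have "\<dots> = (\<Oplus>\<^bsub>M\<^esub> i \<in> ?J. c i \<odot>\<^bsub>M\<^esub> e i) \<oplus>\<^bsub>M\<^esub> (\<Oplus>\<^bsub>M\<^esub> i \<in> ?J. d i \<odot>\<^bsub>M\<^esub> e i)"
    by (rule M.finsum_addf) (use e_closed cd in auto)
  also have "\<dots> = lin_ext R M e c \<oplus>\<^bsub>M\<^esub> lin_ext R M e d"
    using lin_ext_eq_finsum[OF c e J] lin_ext_eq_finsum[OF d e J] by simp
  finally show "lin_ext R M e (c \<oplus>\<^bsub>free_module R I\<^esub> d) = lin_ext R M e c \<oplus>\<^bsub>M\<^esub> lin_ext R M e d" .
next
  interpret Free: module R "free_module R I" by (rule R.free_module)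
  fix a c assume a: "a \<in> carrier R" and c: "c \<in> carrier (free_module R I)"
  let ?J = "{i. c i \<noteq> \<zero>}"
  have J: "finite ?J" "?J \<subseteq> I" using free_moduleD[OF c] by auto
  have e_closed: "e i \<in> carrier M" if "i \<in> ?J" for i
    using subsetD[OF J(2) that] e by auto
  have "lin_ext R M e (a \<odot>\<^bsub>free_module R I\<^esub> c) = (\<Oplus>\<^bsub>M\<^esub> i \<in> ?J. (a \<otimes> c i) \<odot>\<^bsub>M\<^esub> e i)"
    using Free.smult_closed[OF a c] J a by (subst lin_ext_eq_finsum[OF _ e J]) auto
  also have "\<dots> = (\<Oplus>\<^bsub>M\<^esub> i \<in> ?J. a \<odot>\<^bsub>M\<^esub> (c i \<odot>\<^bsub>M\<^esub> e i))"
    by (rule M.finsum_cong') (use e_closed a free_moduleD(1)[OF c] in \<open>auto simp: smult_assoc1\<close>)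
  also have "\<dots> = a \<odot>\<^bsub>M\<^esub> lin_ext R M e c"
    unfolding lin_ext_def using J a e_closed free_moduleD(1)[OF c]
    by (intro finsum_smult_ldistr[symmetric]) auto
  finally show "lin_ext R M e (a \<odot>\<^bsub>free_module R I\<^esub> c) = a \<odot>\<^bsub>M\<^esub> lin_ext R M e c" .
qed

lemma lin_ext_linear_map:
  "e \<in> I \<rightarrow> carrier M \<Longrightarrow> linear_map R (free_module R I) M (lin_ext R M e)"
  by (intro linear_mapI R.free_module lin_ext_hom module_axioms)

lemma lin_ext_zero [simp]: "lin_ext R M e (\<lambda>i. \<zero>) = \<zero>\<^bsub>M\<^esub>"
  by (simp add: lin_ext_def)

lemma lin_ext_unit_vec [simp]: "e i \<in> carrier M \<Longrightarrow> lin_ext R M e (unit_vec R i) = e i"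
  using lin_ext_eq_finsum[OF R.unit_vec_closed[of i "{i}"], of e "{i}"] by (simp add: unit_vec_def)

lemma lin_ext_cong:
  assumes "c \<in> carrier (free_module R I)" "e' \<in> I \<rightarrow> carrier M" "\<And>i. i \<in> I \<Longrightarrow> e i = e' i"
  shows "lin_ext R M e c = lin_ext R M e' c"
proof -
  have "i \<in> I" if "c i \<noteq> \<zero>" for i using that free_moduleD(3)[OF assms(1)] by blast
  then show ?thesis
    unfolding lin_ext_def
    by (intro M.finsum_cong') (use assms(2,3) free_moduleD(1)[OF assms(1)] in \<open>auto simp: Pi_iff\<close>)
qed

lemma free_module_hom_eqI:
  assumes f: "f \<in> lin_hom R (free_module R I) M" and g: "g \<in> lin_hom R (free_module R I) M"
    and "\<And>i. i \<in> I \<Longrightarrow> f (unit_vec R i) = g (unit_vec R i)"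
    and "c \<in> carrier (free_module R I)"
  shows "f c = g c"
proof -
  interpret f: linear_map R "free_module R I" M f
    by (intro linear_mapI R.free_module module_axioms f)
  interpret g: linear_map R "free_module R I" M g
    by (intro linear_mapI R.free_module module_axioms g)
  show ?thesis using assms(4)
  proof (induction rule: R.free_module_induct)
    case zero
    then show ?case using f.zero g.zero by simp
  next
    case (add c a i)
    then show ?case using assms(3)
      by (simp del: free_module_simps)
  qed
qed

lemma lin_ext_add:
  assumes "c \<in> carrier (free_module R I)" "e \<in> I \<rightarrow> carrier M" "e' \<in> I \<rightarrow> carrier M"
  shows "lin_ext R M (\<lambda>i. e i \<oplus>\<^bsub>M\<^esub> e' i) c = lin_ext R M e c \<oplus>\<^bsub>M\<^esub> lin_ext R M e' c"
proof -
  note c = free_moduleD[OF assms(1)]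
  have e: "e i \<in> carrier M" "e' i \<in> carrier M" if "c i \<noteq> \<zero>" for i
    using that c(3) assms(2,3) by auto
  have "lin_ext R M (\<lambda>i. e i \<oplus>\<^bsub>M\<^esub> e' i) c
      = (\<Oplus>\<^bsub>M\<^esub> i \<in> {i. c i \<noteq> \<zero>}. c i \<odot>\<^bsub>M\<^esub> e i \<oplus>\<^bsub>M\<^esub> c i \<odot>\<^bsub>M\<^esub> e' i)"
    unfolding lin_ext_def
    by (rule M.finsum_cong') (use e c(1) in \<open>auto simp: smult_r_distr\<close>)
  also have "\<dots> = lin_ext R M e c \<oplus>\<^bsub>M\<^esub> lin_ext R M e' c"
    unfolding lin_ext_def by (rule M.finsum_addf) (use e c(1) in auto)
  finally show ?thesis .
qed

end

lemma (in linear_map) lin_ext_image: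
  assumes "c \<in> carrier (free_module R I)" "e \<in> I \<rightarrow> carrier M"
  shows "f (lin_ext R M e c) = lin_ext R N (\<lambda>i. f (e i)) c"
proof (rule N.free_module_hom_eqI[OF _ _ _ assms(1)])
  show "(\<lambda>c. f (lin_ext R M e c)) \<in> lin_hom R (free_module R I) N"
    by (rule lin_hom_compose[OF M.lin_ext_hom[OF assms(2)] lin_hom])
  show "lin_ext R N (\<lambda>i. f (e i)) \<in> lin_hom R (free_module R I) N"
    by (rule N.lin_ext_hom) (use assms(2) in auto)
  fix i assume "i \<in> I"
  then show "f (lin_ext R M e (unit_vec R i)) = lin_ext R N (\<lambda>i. f (e i)) (unit_vec R i)"
    using assms(2) by (simp add: M.lin_ext_unit_vec N.lin_ext_unit_vec Pi_iff)
qed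

context module
begin

lemma lin_ext_smult:
  assumes "c \<in> carrier (free_module R I)" "e \<in> I \<rightarrow> carrier M" "a \<in> carrier R"
  shows "lin_ext R M (\<lambda>i. a \<odot>\<^bsub>M\<^esub> e i) c = a \<odot>\<^bsub>M\<^esub> lin_ext R M e c"
proof -
  interpret linear_map R M M "\<lambda>x. a \<odot>\<^bsub>M\<^esub> x"
    by (intro linear_mapI module_axioms lin_homI)
      (use assms(3) in \<open>auto simp: smult_r_distr smult_lcomm\<close>)
  show ?thesis using lin_ext_image[OF assms(1,2)] by simp
qed

lemma lin_ext_diff:
  assumes "c \<in> carrier (free_module R I)" "e \<in> I \<rightarrow> carrier M" "e' \<in> I \<rightarrow> carrier M"
  shows "lin_ext R M (\<lambda>i. e i \<ominus>\<^bsub>M\<^esub> e' i) c = lin_ext R M e c \<ominus>\<^bsub>M\<^esub> lin_ext R M e' c"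
proof -
  have d: "(\<lambda>i. e i \<ominus>\<^bsub>M\<^esub> e' i) \<in> I \<rightarrow> carrier M" using assms(2,3) by auto
  have "lin_ext R M e c = lin_ext R M (\<lambda>i. (e i \<ominus>\<^bsub>M\<^esub> e' i) \<oplus>\<^bsub>M\<^esub> e' i) c"
    by (rule lin_ext_cong[OF assms(1)])
      (use assms(2,3) in \<open>auto simp: M.diff_add_cancel Pi_iff\<close>)
  also have "\<dots> = lin_ext R M (\<lambda>i. e i \<ominus>\<^bsub>M\<^esub> e' i) c \<oplus>\<^bsub>M\<^esub> lin_ext R M e' c"
    by (rule lin_ext_add[OF assms(1) d assms(3)])
  finally show ?thesis
    using M.add_diff_cancel[OF lin_ext_closed[OF assms(1) d] lin_ext_closed[OF assms(1,3)]] by simp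
qed

lemma lin_hom_eq_lin_ext:
  assumes "f \<in> lin_hom R (free_module R I) M" "c \<in> carrier (free_module R I)"
  shows "f c = lin_ext R M (\<lambda>i. f (unit_vec R i)) c"
proof -
  have "(\<lambda>i. f (unit_vec R i)) \<in> I \<rightarrow> carrier M"
    using assms(1) by (auto simp: lin_hom_def)
  then show ?thesis
    by (intro free_module_hom_eqI[OF assms(1) lin_ext_hom _ assms(2)]) (auto simp: Pi_iff)
qed

lemma lin_ext_scale:
  assumes c: "c \<in> carrier (free_module R I)" and s: "\<And>i. s i \<in> carrier R" and e: "e \<in> I \<rightarrow> carrier M"
  shows "lin_ext R M (\<lambda>i. s i \<odot>\<^bsub>M\<^esub> e i) c = lin_ext R M e (\<lambda>i. s i \<otimes> c i)"
proof -
  note cD = free_moduleD[OF c]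
  have e_closed: "e i \<in> carrier M" if "c i \<noteq> \<zero>" for i using that cD(3) e by auto
  have scaled_closed: "(\<lambda>i. s i \<otimes> c i) \<in> carrier (free_module R I)"
    by (rule free_moduleI) (use s cD in \<open>auto intro: finite_subset[OF _ cD(2)]\<close>)
  have "lin_ext R M e (\<lambda>i. s i \<otimes> c i) = (\<Oplus>\<^bsub>M\<^esub> i \<in> {i. c i \<noteq> \<zero>}. (s i \<otimes> c i) \<odot>\<^bsub>M\<^esub> e i)"
    by (rule lin_ext_eq_finsum[OF scaled_closed e]) (use cD s in auto)
  also have "\<dots> = lin_ext R M (\<lambda>i. s i \<odot>\<^bsub>M\<^esub> e i) c"
    unfolding lin_ext_def
    by (rule M.finsum_cong') (use cD(1) s e_closed in \<open>auto simp: smult_assoc1 smult_lcomm\<close>)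
  finally show ?thesis by simp
qed

lemma lin_ext_ones:
  assumes "finite J" "e \<in> J \<rightarrow> carrier M"
  shows "lin_ext R M e (\<lambda>j. if j \<in> J then \<one> else \<zero>) = (\<Oplus>\<^bsub>M\<^esub>j\<in>J. e j)"
proof -
  have "lin_ext R M e (\<lambda>j. if j \<in> J then \<one> else \<zero>)
      = (\<Oplus>\<^bsub>M\<^esub>j\<in>J. (if j \<in> J then \<one> else \<zero>) \<odot>\<^bsub>M\<^esub> e j)"
    by (intro lin_ext_eq_finsum[of _ J] finite_free_moduleI assms order_refl) auto
  also have "\<dots> = (\<Oplus>\<^bsub>M\<^esub>j\<in>J. e j)"
    using assms(2) by (intro M.finsum_cong') (auto simp: Pi_iff)
  finally show ?thesis .
qed

end

lemma (in linear_map) finsum_image: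
  assumes "finite J" "e \<in> J \<rightarrow> carrier M"
  shows "f (\<Oplus>\<^bsub>M\<^esub>j\<in>J. e j) = (\<Oplus>\<^bsub>N\<^esub>j\<in>J. f (e j))"
proof -
  have "(\<lambda>j. f (e j)) \<in> J \<rightarrow> carrier N" using assms(2) by auto
  then show ?thesis
    using lin_ext_image[OF M.R.ones_closed[OF assms(1)] assms(2)] assms
    by (simp add: M.lin_ext_ones N.lin_ext_ones)
qed

lemma (in cring) lin_ext_free_module_apply:
  assumes c: "c \<in> carrier (free_module R J)" and U: "\<And>j. j \<in> J \<Longrightarrow> U j \<in> carrier (free_module R K)"
    and J: "finite J"
  shows "lin_ext R (free_module R K) U c i = (\<Oplus>j\<in>J. c j \<otimes> U j i)"
proof -
  interpret Reg: module R "regular_module R" by (rule regular_module)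
  have Ui: "(\<lambda>j. U j i) \<in> J \<rightarrow> carrier (regular_module R)" using free_moduleD(1)[OF U] by simp
  have "lin_ext R (free_module R K) U c i = lin_ext R (regular_module R) (\<lambda>j. U j i) c"
    by (rule linear_map.lin_ext_image[OF coordinate_linear_map c]) (use U in auto)
  also have "\<dots> = (\<Oplus>j\<in>J. c j \<otimes> U j i)"
    using Reg.lin_ext_eq_finsum[OF c Ui J order_refl free_moduleD(3)[OF c]] by simp
  finally show ?thesis .
qed

section \<open>Congruence modulo a submodule\<close>

locale module_submodule = module + fixes N assumes submodule: "submodule N R M"
begin

definition cong :: "'c \<Rightarrow> 'c \<Rightarrow> bool" (infix \<open>\<asymp>\<close> 50)
  where "x \<asymp> y \<longleftrightarrow> x \<in> carrier M \<and> y \<in> carrier M \<and> x \<ominus>\<^bsub>M\<^esub> y \<in> N"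

lemma cong_closed: "x \<asymp> y \<Longrightarrow> x \<in> carrier M" "x \<asymp> y \<Longrightarrow> y \<in> carrier M"
  by (simp_all add: cong_def)

lemma cong_zero_iff: "x \<asymp> \<zero>\<^bsub>M\<^esub> \<longleftrightarrow> x \<in> N"
  using submoduleE(1)[OF submodule] by (auto simp: cong_def M.diff_zero)

lemma cong_refl [simp]: "x \<in> carrier M \<Longrightarrow> x \<asymp> x"
  by (simp add: cong_def M.diff_eq_zero_iff[THEN iffD2] submodule_zero[OF submodule])

lemma cong_sym: "x \<asymp> y \<Longrightarrow> y \<asymp> x"
  using submoduleE(3)[OF submodule, of "x \<ominus>\<^bsub>M\<^esub> y"] by (auto simp: cong_def M.minus_diff)

lemma cong_trans [trans]: "\<lbrakk>x \<asymp> y; y \<asymp> z\<rbrakk> \<Longrightarrow> x \<asymp> z"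
  using submoduleE(5)[OF submodule, of "x \<ominus>\<^bsub>M\<^esub> y" "y \<ominus>\<^bsub>M\<^esub> z"]
  by (auto simp: cong_def M.diff_add_diff)

lemma cong_add: "\<lbrakk>x \<asymp> y; x' \<asymp> y'\<rbrakk> \<Longrightarrow> x \<oplus>\<^bsub>M\<^esub> x' \<asymp> y \<oplus>\<^bsub>M\<^esub> y'"
  using submoduleE(5)[OF submodule] by (auto simp: cong_def M.add_diff_add)

lemma cong_smult: "\<lbrakk>r \<in> carrier R; x \<asymp> y\<rbrakk> \<Longrightarrow> r \<odot>\<^bsub>M\<^esub> x \<asymp> r \<odot>\<^bsub>M\<^esub> y"
  using submoduleE(4)[OF submodule] by (auto simp: cong_def simp flip: smult_diff)

lemma cong_diff: "\<lbrakk>x \<asymp> y; x' \<asymp> y'\<rbrakk> \<Longrightarrow> x \<ominus>\<^bsub>M\<^esub> x' \<asymp> y \<ominus>\<^bsub>M\<^esub> y'"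
  using cong_add[of x y "\<ominus> \<one> \<odot>\<^bsub>M\<^esub> x'" "\<ominus> \<one> \<odot>\<^bsub>M\<^esub> y'"] cong_smult[of "\<ominus> \<one>" x' y'] cong_closed[of x' y']
  by (simp add: smult_l_minus M.minus_eq)

lemma cong_lin_ext:
  assumes c: "c \<in> carrier (free_module R I)" and e: "\<And>i. i \<in> I \<Longrightarrow> e i \<asymp> e' i"
  shows "lin_ext R M e c \<asymp> lin_ext R M e' c"
proof -
  have e_Pi: "e \<in> I \<rightarrow> carrier M" "e' \<in> I \<rightarrow> carrier M" using cong_closed[OF e] by auto
  have "lin_ext R M (\<lambda>i. e i \<ominus>\<^bsub>M\<^esub> e' i) c \<in> N"
  proof (rule lin_ext_mem_submodule[OF submodule])
    fix i assume "c i \<noteq> \<zero>"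
    then have "e i \<ominus>\<^bsub>M\<^esub> e' i \<in> N" using e[of i] free_moduleD(3)[OF c] by (auto simp: cong_def)
    then show "c i \<odot>\<^bsub>M\<^esub> (e i \<ominus>\<^bsub>M\<^esub> e' i) \<in> N"
      by (rule submoduleE(4)[OF submodule free_moduleD(1)[OF c]])
  qed
  then show ?thesis using e_Pi c by (auto simp: cong_def lin_ext_diff[OF c e_Pi])
qed

lemma cong_finsum:
  assumes "finite J" "\<And>j. j \<in> J \<Longrightarrow> e j \<asymp> e' j"
  shows "(\<Oplus>\<^bsub>M\<^esub>j\<in>J. e j) \<asymp> (\<Oplus>\<^bsub>M\<^esub>j\<in>J. e' j)"
proof -
  have "e \<in> J \<rightarrow> carrier M" "e' \<in> J \<rightarrow> carrier M" using cong_closed[OF assms(2)] by auto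
  then show ?thesis
    using cong_lin_ext[of _ J e e', OF R.ones_closed[OF assms(1)] assms(2)]
    by (simp add: lin_ext_ones assms(1))
qed

lemma cong_lin_ext_coeffs:
  assumes c: "c \<in> carrier (free_module R I)" "d \<in> carrier (free_module R I)"
    and e: "e \<in> I \<rightarrow> carrier M"
    and "\<And>i m. \<lbrakk>i \<in> I; m \<in> carrier M\<rbrakk> \<Longrightarrow> (c i \<ominus> d i) \<odot>\<^bsub>M\<^esub> m \<in> N"
  shows "lin_ext R M e c \<asymp> lin_ext R M e d"
proof -
  interpret Free: module R "free_module R I" by (rule R.free_module)
  interpret e: linear_map R "free_module R I" M "lin_ext R M e" by (rule lin_ext_linear_map[OF e])
  have "lin_ext R M e (c \<ominus>\<^bsub>free_module R I\<^esub> d) \<in> N"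
  proof (rule lin_ext_mem_submodule[OF submodule])
    fix i assume "(c \<ominus>\<^bsub>free_module R I\<^esub> d) i \<noteq> \<zero>"
    then have "i \<in> I" using free_moduleD(3)[OF Free.M.minus_closed[OF c]] by blast
    then show "(c \<ominus>\<^bsub>free_module R I\<^esub> d) i \<odot>\<^bsub>M\<^esub> e i \<in> N"
      using assms(4)[of i "e i"] e by (auto simp: R.free_module_diff[OF c])
  qed
  then show ?thesis using c e by (simp add: cong_def)
qed

end

section \<open>Noetherian modules\<close>

definition noetherian_module :: "('r, 'x) ring_scheme \<Rightarrow> ('r, 'm, 'e) module_scheme \<Rightarrow> bool" where
  "noetherian_module R M \<longleftrightarrow> wf {(W, V). submodule V R M \<and> submodule W R M \<and> V \<subset> W}"

lemma noetherian_module_maximal: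
  assumes "noetherian_module R M" and V: "\<And>V. V \<in> \<V> \<Longrightarrow> submodule V R M" and "\<V> \<noteq> {}"
  shows "\<exists>V\<in>\<V>. \<forall>W\<in>\<V>. V \<subseteq> W \<longrightarrow> W = V"
proof -
  have "wf {(W, V). submodule V R M \<and> submodule W R M \<and> V \<subset> W}"
    using assms(1) by (simp add: noetherian_module_def)
  moreover obtain U where "U \<in> \<V>" using assms(3) by blast
  ultimately obtain V where V_mem: "V \<in> \<V>"
    and max: "\<And>W. (W, V) \<in> {(W, V). submodule V R M \<and> submodule W R M \<and> V \<subset> W} \<Longrightarrow> W \<notin> \<V>"
    by (rule wfE_min) auto
  have "W = V" if W: "W \<in> \<V>" and "V \<subseteq> W" for W
  proof (rule ccontr)
    assume "W \<noteq> V"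
    then have "V \<subset> W" using that(2) by blast
    then have "W \<notin> \<V>" using V[OF W] V[OF V_mem] by (intro max) simp
    then show False using W ..
  qed
  with V_mem show ?thesis by blast
qed

lemma noetherian_module_chain_stabilises:
  assumes noeth: "noetherian_module R M" and V: "\<And>n. submodule (V n) R M"
    and mono: "\<And>n::nat. V n \<subseteq> V (Suc n)"
  shows "\<exists>d. \<forall>e. V (d + e) = V d"
proof -
  obtain d where d: "\<And>e. V d \<subseteq> V e \<Longrightarrow> V e = V d"
    using noetherian_module_maximal[OF noeth, of "range V"] V by auto
  then show ?thesis using lift_Suc_mono_le[of V, OF mono] by (meson le_add1)
qed

lemma (in cring) submodule_regular_module_iff: "submodule I R (regular_module R) \<longleftrightarrow> ideal I R"
proof -
  interpret Reg: module R "regular_module R" by (rule regular_module)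
  show ?thesis
  proof
    assume I: "submodule I R (regular_module R)"
    note sub = Reg.submoduleE[OF I, simplified]
    show "ideal I R"
    proof (rule idealI)
      show "subgroup I (add_monoid R)"
        by (rule group.subgroupI[OF a_group]) (use sub in \<open>auto simp flip: a_inv_def\<close>)
      show "x \<otimes> a \<in> I" "a \<otimes> x \<in> I" if "a \<in> I" "x \<in> carrier R" for a x
        using that sub(1,4) by (auto simp: subset_iff m_comm[of a x])
    qed (rule ring_axioms)
  next
    assume "ideal I R"
    then interpret ideal I R .
    show "submodule I R (regular_module R)"
      by (rule Reg.submoduleI) (auto simp: I_l_closed)
  qed
qed

lemma (in cring) noetherian_regular_module:
  assumes "noetherian_ring R"
  shows "noetherian_module R (regular_module R)"
proof -
  interpret noetherian_ring R by (rule assms)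
  have False if chain: "\<forall>n. (J (Suc n), J n) \<in> {(W, V). ideal V R \<and> ideal W R \<and> V \<subset> W}" for J
  proof -
    have J: "\<And>n. ideal (J n) R" "\<And>n. J n \<subset> J (Suc n)" using chain by auto
    have mono: "J m \<subseteq> J n" if "m \<le> n" for m n
      using lift_Suc_mono_le[of J] J(2) that by blast
    have "J m \<subseteq> J n \<or> J n \<subseteq> J m" for m n
      using mono[of m n] mono[of n m] linear[of m n] by blast
    then have "subset.chain {I. ideal I R} (range J)"
      unfolding subset.chain_def using J(1) by auto
    from ideal_chain_is_trivial[OF _ this] obtain n where "\<Union>(range J) = J n" by auto
    then show False using J(2)[of n] by blast
  qed
  then show ?thesis
    unfolding noetherian_module_def submodule_regular_module_iff wf_iff_no_infinite_down_chain
    by (intro notI) (elim exE)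
qed

lemma (in module) submodule_Int:
  assumes "submodule V R M" "submodule W R M"
  shows "submodule (V \<inter> W) R M"
proof (rule submoduleI)
  show "V \<inter> W \<subseteq> carrier M" using submoduleE(1)[OF assms(1)] by blast
qed (simp_all add: submodule_zero[OF assms(1)] submodule_zero[OF assms(2)]
    submoduleE(3-5)[OF assms(1)] submoduleE(3-5)[OF assms(2)])

lemma (in module) submodule_Ball:
  assumes "\<And>j. j \<in> J \<Longrightarrow> submodule {v \<in> carrier M. P j v} R M"
  shows "submodule {v \<in> carrier M. \<forall>j\<in>J. P j v} R M"
proof (rule submoduleI)
  let ?W = "{v \<in> carrier M. \<forall>j\<in>J. P j v}"
  show "\<zero>\<^bsub>M\<^esub> \<in> ?W" using submodule_zero[OF assms] by auto
  show "\<ominus>\<^bsub>M\<^esub> v \<in> ?W" if "v \<in> ?W" for v using that submoduleE(3)[OF assms] by auto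
  show "v \<oplus>\<^bsub>M\<^esub> w \<in> ?W" if "v \<in> ?W" "w \<in> ?W" for v w using that submoduleE(5)[OF assms] by auto
  show "a \<odot>\<^bsub>M\<^esub> v \<in> ?W" if "a \<in> carrier R" "v \<in> ?W" for a v
    using that submoduleE(4)[OF assms] by auto
qed blast

lemma (in module) submodule_of_submodule:
  assumes "submodule V R M" "submodule W R M" "V \<subseteq> W"
  shows "submodule V R (M\<lparr>carrier := W\<rparr>)"
proof -
  interpret W: module R "M\<lparr>carrier := W\<rparr>"
    by (rule submodule.submodule_is_module[OF assms(2) module_axioms])
  show ?thesis
    by (rule W.module_incl_imp_submodule)
      (use submodule.submodule_is_module[OF assms(1) module_axioms] assms(3) in auto)
qed

lemma (in linear_map) submodule_eqI:
  assumes V: "submodule V R M" and W: "submodule W R M" and "V \<subseteq> W"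
    and "f ` V = f ` W" and kernel: "V \<inter> a_kernel M N f = W \<inter> a_kernel M N f"
  shows "V = W"
proof
  show "W \<subseteq> V"
  proof
    fix w assume w: "w \<in> W"
    then obtain v where v: "v \<in> V" "f w = f v" using assms(4) by blast
    have vw: "v \<in> carrier M" "w \<in> carrier M"
      using M.submoduleE(1)[OF V] M.submoduleE(1)[OF W] v(1) w by auto
    have "f (w \<ominus>\<^bsub>M\<^esub> v) = \<zero>\<^bsub>N\<^esub>" using vw v(2) by (simp add: N.M.diff_eq_zero_iff)
    then have "w \<ominus>\<^bsub>M\<^esub> v \<in> a_kernel M N f" unfolding a_kernel_def' using vw by simp
    moreover have "w \<ominus>\<^bsub>M\<^esub> v \<in> W" using M.submodule_diff[OF W w] assms(3) v(1) by blast
    ultimately have "(w \<ominus>\<^bsub>M\<^esub> v) \<oplus>\<^bsub>M\<^esub> v \<in> V" using M.submoduleE(5)[OF V] v(1) kernel by blast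
    then show "w \<in> V" by (simp add: M.M.diff_add_cancel vw)
  qed
qed (rule assms(3))

lemma (in linear_map) noetherian_extension:
  assumes ker: "noetherian_module R (M\<lparr>carrier := a_kernel M N f\<rparr>)" and N: "noetherian_module R N"
  shows "noetherian_module R M"
proof -
  let ?K = "a_kernel M N f"
  define r where "r = {(W, V). submodule V R N \<and> submodule W R N \<and> V \<subset> W} <*lex*>
    {(W, V). submodule V R (M\<lparr>carrier := ?K\<rparr>) \<and> submodule W R (M\<lparr>carrier := ?K\<rparr>) \<and> V \<subset> W}"
  have int: "submodule (V \<inter> ?K) R (M\<lparr>carrier := ?K\<rparr>)" if "submodule V R M" for V
    by (rule M.submodule_of_submodule[OF M.submodule_Int[OF that submodule_kernel] submodule_kernel])
      simp
  have "((f ` W, W \<inter> ?K), (f ` V, V \<inter> ?K)) \<in> r"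
    if V: "submodule V R M" and W: "submodule W R M" and VW: "V \<subset> W" for V W
  proof (cases "f ` V = f ` W")
    case True
    then have "V \<inter> ?K \<noteq> W \<inter> ?K" using submodule_eqI[OF V W] VW by blast
    then show ?thesis using True VW int[OF V] int[OF W] by (auto simp: r_def)
  next
    case False
    then show ?thesis using VW submodule_image[OF V] submodule_image[OF W] by (auto simp: r_def)
  qed
  then have "{(W, V). submodule V R M \<and> submodule W R M \<and> V \<subset> W}
      \<subseteq> inv_image r (\<lambda>V. (f ` V, V \<inter> ?K))"
    unfolding inv_image_def by blast
  moreover have "wf r"
    using ker N unfolding r_def noetherian_module_def by (intro wf_lex_prod)
  ultimately show ?thesis
    unfolding noetherian_module_def by (blast intro: wf_subset wf_inv_image)
qed

lemma (in cring) noetherian_free_module: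
  fixes I :: "'i set"
  assumes "noetherian_ring R" "finite I"
  shows "noetherian_module R (free_module R I)"
  using assms(2)
proof (induction I rule: finite_induct)
  case empty
  interpret Free: module R "free_module R {}" by (rule free_module)
  have "V = {\<zero>\<^bsub>free_module R {}\<^esub>}" if V: "submodule V R (free_module R {})" for V :: "('i \<Rightarrow> 'a) set"
  proof -
    have "v = \<zero>\<^bsub>free_module R {}\<^esub>" if "v \<in> V" for v
      unfolding free_module_simps
      by (intro ext free_moduleD(3)[OF subsetD[OF Free.submoduleE(1)[OF V] that]]) simp
    then show ?thesis using Free.submodule_zero[OF V] by blast
  qed
  then have "\<not> V \<subset> W" if "submodule V R (free_module R {})" "submodule W R (free_module R {})"
    for V W :: "('i \<Rightarrow> 'a) set"
    using that by (metis psubset_eq)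
  then have "{(W, V). submodule V R (free_module R {}) \<and> submodule W R (free_module R {}) \<and> V \<subset> W}
      = ({} :: (('i \<Rightarrow> 'a) set \<times> ('i \<Rightarrow> 'a) set) set)"
    by (simp cong: conj_cong)
  then show ?case unfolding noetherian_module_def by (simp only:) simp
next
  case (insert i I)
  have "a_kernel (free_module R (insert i I)) (regular_module R) (\<lambda>c. c i) = carrier (free_module R I)"
    using insert.hyps(2) unfolding a_kernel_def' by (auto simp: free_module_def)
  then have kernel: "(free_module R (insert i I))
      \<lparr>carrier := a_kernel (free_module R (insert i I)) (regular_module R) (\<lambda>c. c i)\<rparr> = free_module R I"
    by (simp add: free_module_def)
  show ?case
    using linear_map.noetherian_extension[OF coordinate_linear_map, of "insert i I" i]
      insert.IH noetherian_regular_module[OF assms(1)] unfolding kernel by blast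
qed

section \<open>Linear functionals modulo a prime ideal\<close>

context cring
begin

lemma prime_elimination:
  assumes p: "primeideal p R" and W: "submodule W R V" and V: "module R V"
    and \<xi>: "\<xi> \<in> lin_hom R V (regular_module R)" and \<eta>: "\<eta> \<in> lin_hom R V (regular_module R)"
    and ker: "\<And>v. \<lbrakk>v \<in> W; \<xi> v \<in> p\<rbrakk> \<Longrightarrow> \<eta> v \<in> p"
  shows "\<exists>a\<in>carrier R - p. \<exists>b\<in>carrier R. \<forall>v\<in>W. a \<otimes> \<eta> v \<ominus> b \<otimes> \<xi> v \<in> p"
proof -
  interpret p: primeideal p R by (rule p)
  interpret V: module R V by (rule V)
  interpret \<xi>: linear_map R V "regular_module R" \<xi>
    by (intro linear_mapI V regular_module \<xi>)
  interpret \<eta>: linear_map R V "regular_module R" \<eta>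
    by (intro linear_mapI V regular_module \<eta>)
  have WV: "v \<in> carrier V" if "v \<in> W" for v using V.submoduleE(1)[OF W] that by blast
  have closed: "\<xi> v \<in> carrier R" "\<eta> v \<in> carrier R" if "v \<in> W" for v
    using \<xi>.closed[OF WV[OF that]] \<eta>.closed[OF WV[OF that]] by simp_all
  show ?thesis
  proof (cases "\<forall>v\<in>W. \<xi> v \<in> p")
    case True
    have "\<one> \<notin> p" using p.I_notcarr p.one_imp_carrier by blast
    moreover have "\<forall>v\<in>W. \<one> \<otimes> \<eta> v \<ominus> \<zero> \<otimes> \<xi> v \<in> p"
      using ker True by (simp add: closed diff_zero)
    ultimately show ?thesis by blast
  next
    case False
    then obtain v0 where v0: "v0 \<in> W" "\<xi> v0 \<notin> p" by blast
    have "\<xi> v0 \<otimes> \<eta> v \<ominus> \<eta> v0 \<otimes> \<xi> v \<in> p" if v: "v \<in> W" for v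
    proof -
      define w where "w = \<xi> v0 \<odot>\<^bsub>V\<^esub> v \<ominus>\<^bsub>V\<^esub> \<xi> v \<odot>\<^bsub>V\<^esub> v0"
      have "w \<in> W"
        unfolding w_def using closed v v0(1) V.submoduleE(4)[OF W] by (intro V.submodule_diff[OF W]) auto
      moreover have "\<xi> w = \<zero>"
        using closed v v0(1) WV by (simp add: w_def m_comm[of "\<xi> v0"] diff_eq_zero_iff)
      ultimately have "\<eta> w \<in> p" by (intro ker) auto
      then show ?thesis
        using closed v v0(1) WV by (simp add: w_def m_comm[of "\<xi> v"])
    qed
    then show ?thesis using v0 closed by blast
  qed
qed

lemma finsum_insert_fun_upd:
  assumes "finite J" "i \<notin> J" "u \<in> J \<rightarrow> carrier R" "b \<in> carrier R" "x \<in> insert i J \<rightarrow> carrier R"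
  shows "(\<Oplus>j\<in>insert i J. (u(i := b)) j \<otimes> x j) = b \<otimes> x i \<oplus> (\<Oplus>j\<in>J. u j \<otimes> x j)"
proof -
  have ux: "u j \<otimes> x j \<in> carrier R" if "j \<in> J" for j using that assms(3,5) by auto
  have "(\<Oplus>j\<in>insert i J. (u(i := b)) j \<otimes> x j) = b \<otimes> x i \<oplus> (\<Oplus>j\<in>J. (u(i := b)) j \<otimes> x j)"
    using assms ux by (subst finsum_insert) auto
  also have "(\<Oplus>j\<in>J. (u(i := b)) j \<otimes> x j) = (\<Oplus>j\<in>J. u j \<otimes> x j)"
    using assms(2) ux by (intro finsum_cong') auto
  finally show ?thesis .
qed

lemma eliminated_combination_eq:
  assumes "finite J" "i \<notin> J" and u: "u \<in> J \<rightarrow> carrier R" and x: "x \<in> insert i J \<rightarrow> carrier R"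
    and "a \<in> carrier R" "b \<in> carrier R" "s \<in> carrier R" "y \<in> carrier R"
  shows "s \<otimes> (a \<otimes> y \<ominus> b \<otimes> x i) \<ominus> (\<Oplus>j\<in>J. u j \<otimes> x j) =
    s \<otimes> a \<otimes> y \<ominus> (\<Oplus>j\<in>insert i J. (u(i := s \<otimes> b)) j \<otimes> x j)"
proof -
  have "(\<Oplus>j\<in>J. u j \<otimes> x j) \<in> carrier R" using u x by (intro finsum_closed) auto
  moreover have "x i \<in> carrier R" using x by simp
  ultimately show ?thesis
    unfolding finsum_insert_fun_upd[OF assms(1,2) u m_closed[OF assms(7,6)] x]
    using assms(5-) by (simp add: minus_eq minus_add r_distr r_minus m_assoc a_assoc)
qed

text \<open>The double annihilator property of finitely many functionals over the domain \<open>R/p\<close>, with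
  denominators cleared.\<close>

lemma functional_combination_mod_prime:
  assumes p: "primeideal p R" and V: "module R V" and "finite J"
    and \<xi>: "\<And>j. j \<in> J \<Longrightarrow> \<xi> j \<in> lin_hom R V (regular_module R)"
    and "\<eta> \<in> lin_hom R V (regular_module R)"
    and "\<And>v. \<lbrakk>v \<in> carrier V; \<forall>j\<in>J. \<xi> j v \<in> p\<rbrakk> \<Longrightarrow> \<eta> v \<in> p"
  shows "\<exists>s\<in>carrier R - p. \<exists>u\<in>J \<rightarrow> carrier R. \<forall>v\<in>carrier V.
    s \<otimes> \<eta> v \<ominus> (\<Oplus>j\<in>J. u j \<otimes> \<xi> j v) \<in> p"
  using assms(3-)
proof (induction J arbitrary: \<eta> rule: finite_induct)
  case empty
  interpret p: primeideal p R by (rule p)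
  have "\<one> \<notin> p" using p.I_notcarr p.one_imp_carrier by blast
  moreover have "\<one> \<otimes> \<eta> v \<ominus> (\<Oplus>j\<in>{}. \<zero> \<otimes> \<xi> j v) \<in> p" if "v \<in> carrier V" for v
    using empty.prems(3)[OF that] by (simp add: diff_zero)
  ultimately show ?case by (intro bexI[of _ \<one>] bexI[of _ "\<lambda>j. \<zero>"]) auto
next
  case (insert i J)
  interpret p: primeideal p R by (rule p)
  interpret V: module R V by (rule V)
  interpret Reg: module R "regular_module R" by (rule regular_module)
  have \<xi>: "linear_map R V (regular_module R) (\<xi> j)" if "j \<in> insert i J" for j
    using insert.prems(1)[OF that] by (intro linear_mapI V regular_module)
  interpret \<eta>: linear_map R V "regular_module R" \<eta>
    by (intro linear_mapI V regular_module insert.prems(2))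
  let ?W = "{v \<in> carrier V. \<forall>j\<in>J. \<xi> j v \<in> p}"
  have "submodule p R (regular_module R)"
    using p.is_ideal by (simp add: submodule_regular_module_iff)
  note vimage = linear_map.submodule_vimage[OF \<xi> this]
  have W: "submodule ?W R V" by (rule V.submodule_Ball) (rule vimage, simp)
  have "\<exists>a\<in>carrier R - p. \<exists>b\<in>carrier R. \<forall>v\<in>?W. a \<otimes> \<eta> v \<ominus> b \<otimes> \<xi> i v \<in> p"
    by (rule prime_elimination[OF p W V insert.prems(1,2)]) (use insert.prems(3) in auto)
  then obtain a b where a: "a \<in> carrier R" "a \<notin> p" and b: "b \<in> carrier R"
    and ab: "\<And>v. \<lbrakk>v \<in> carrier V; \<forall>j\<in>J. \<xi> j v \<in> p\<rbrakk> \<Longrightarrow> a \<otimes> \<eta> v \<ominus> b \<otimes> \<xi> i v \<in> p"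
    by blast
  have \<eta>': "(\<lambda>v. a \<otimes> \<eta> v \<ominus> b \<otimes> \<xi> i v) \<in> lin_hom R V (regular_module R)"
    using Reg.lin_hom_diff[OF Reg.lin_hom_smult[OF a(1) \<eta>.lin_hom] Reg.lin_hom_smult[OF b]]
      insert.prems(1)[of i] by simp
  from insert.IH[OF insert.prems(1) \<eta>' ab] obtain s u
    where s: "s \<in> carrier R" "s \<notin> p" and u: "u \<in> J \<rightarrow> carrier R"
      and su: "\<And>v. v \<in> carrier V \<Longrightarrow>
        s \<otimes> (a \<otimes> \<eta> v \<ominus> b \<otimes> \<xi> i v) \<ominus> (\<Oplus>j\<in>J. u j \<otimes> \<xi> j v) \<in> p"
    by auto
  have "s \<otimes> a \<otimes> \<eta> v \<ominus> (\<Oplus>j\<in>insert i J. (u(i := s \<otimes> b)) j \<otimes> \<xi> j v) \<in> p" if v: "v \<in> carrier V" for v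
    using su[OF v] s(1) a(1) b \<eta>.closed[OF v] linear_map.closed[OF \<xi> v]
      eliminated_combination_eq[OF insert.hyps(1,2) u, of "\<lambda>j. \<xi> j v" a b s "\<eta> v"] by auto
  moreover have "s \<otimes> a \<notin> p" using p.I_prime[OF s(1) a(1)] s(2) a(2) by blast
  moreover have "u(i := s \<otimes> b) \<in> insert i J \<rightarrow> carrier R" using u s(1) b by auto
  ultimately show ?case using s(1) a(1) by blast
qed

end

section \<open>Ext from an arbitrary free presentation\<close>

definition syzygies :: "('r, 'x) ring_scheme \<Rightarrow> ('r, 'm, 'e) module_scheme \<Rightarrow> ('i \<Rightarrow> 'm) \<Rightarrow> 'i set \<Rightarrow>
    ('r, 'i \<Rightarrow> 'r) module" where
  "syzygies R F e I =
     (free_module R I)\<lparr>carrier := a_kernel (free_module R I) F (lin_ext R F e)\<rparr>"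

definition ext1_vanishes_via :: "('r, 'x) ring_scheme \<Rightarrow> ('r, 'm, 'e1) module_scheme \<Rightarrow>
    ('i \<Rightarrow> 'm) \<Rightarrow> 'i set \<Rightarrow> ('r, 'c, 'e2) module_scheme \<Rightarrow> bool" where
  "ext1_vanishes_via R F e I C \<longleftrightarrow>
     (\<forall>\<phi>\<in>lin_hom R (syzygies R F e I) C. \<exists>\<psi>\<in>lin_hom R (free_module R I) C.
        \<forall>c\<in>carrier (syzygies R F e I). \<psi> c = \<phi> c)"

lemma coeffs_eq_free_module: "coeffs R M = carrier (free_module R (carrier M))"
  by (simp add: coeffs_def free_module_def)

lemma lin_comb_eq_lin_ext: "lin_comb R M = lin_ext R M (\<lambda>x. x)"
  by (simp add: lin_comb_def lin_ext_def fun_eq_iff)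

lemma free_mod_eq_free_module: "free_mod R M = free_module R (carrier M)"
  by (simp add: free_mod_def free_module_def coeffs_def)

lemma pres_kernel_eq_syzygies: "pres_kernel R M = syzygies R M (\<lambda>x. x) (carrier M)"
  by (simp add: pres_kernel_def syzygies_def a_kernel_def' coeffs_eq_free_module lin_comb_eq_lin_ext
      free_mod_eq_free_module)

lemma ext1_vanishes_iff_via_carrier:
  "ext1_vanishes R F C \<longleftrightarrow> ext1_vanishes_via R F (\<lambda>x. x) (carrier F) C"
  by (simp add: ext1_vanishes_def ext1_vanishes_via_def pres_kernel_eq_syzygies free_mod_eq_free_module)

locale cover_extension =
  \<pi>: linear_map R P F \<pi> + \<rho>: linear_map R Q F \<rho> + \<theta>: linear_map R P Q \<theta> + \<psi>: linear_map R P C \<psi> +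
  \<phi>: linear_map R "Q\<lparr>carrier := a_kernel Q F \<rho>\<rparr>" C \<phi>
  for R (structure) and P Q F C \<pi> \<rho> \<theta> \<psi> \<phi> +
  assumes over: "p \<in> carrier P \<Longrightarrow> \<rho> (\<theta> p) = \<pi> p"
    and surjective: "carrier F \<subseteq> \<pi> ` carrier P"
    and extends: "p \<in> a_kernel P F \<pi> \<Longrightarrow> \<psi> p = \<phi> (\<theta> p)"
begin

definition cover_lift where
  "cover_lift q = (SOME p. p \<in> carrier P \<and> \<pi> p = \<rho> q)"

text \<open>Dimension shifting: the value does not depend on the choice of the lift.\<close>

definition extension where
  "extension q = \<psi> (cover_lift q) \<oplus>\<^bsub>C\<^esub> \<phi> (q \<ominus>\<^bsub>Q\<^esub> \<theta> (cover_lift q))"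

lemmas \<phi>_closed = \<phi>.closed[simplified] and \<phi>_add = \<phi>.add[simplified] and \<phi>_smult = \<phi>.smult[simplified]

lemma cover_lift:
  assumes "q \<in> carrier Q"
  shows "cover_lift q \<in> carrier P" "\<pi> (cover_lift q) = \<rho> q"
proof -
  have "\<exists>p. p \<in> carrier P \<and> \<pi> p = \<rho> q"
    using surjective \<rho>.closed[OF assms] by (metis imageE subsetD)
  from someI_ex[OF this] show "cover_lift q \<in> carrier P" "\<pi> (cover_lift q) = \<rho> q"
    unfolding cover_lift_def by blast+
qed

lemma lift_diff_kernel:
  "\<lbrakk>p \<in> carrier P; q \<in> carrier Q; \<pi> p = \<rho> q\<rbrakk> \<Longrightarrow> q \<ominus>\<^bsub>Q\<^esub> \<theta> p \<in> a_kernel Q F \<rho>"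
  unfolding a_kernel_def' using over by (simp add: \<pi>.N.M.diff_eq_zero_iff)

lemma extension_eq:
  assumes p: "p \<in> carrier P" and q: "q \<in> carrier Q" and pq: "\<pi> p = \<rho> q"
  shows "extension q = \<psi> p \<oplus>\<^bsub>C\<^esub> \<phi> (q \<ominus>\<^bsub>Q\<^esub> \<theta> p)"
proof -
  note lift = cover_lift[OF q] and diff = lift_diff_kernel[OF cover_lift(1)[OF q] q cover_lift(2)[OF q]]
  define d where "d = cover_lift q \<ominus>\<^bsub>P\<^esub> p"
  have d: "d \<in> carrier P" "d \<in> a_kernel P F \<pi>"
    unfolding d_def a_kernel_def' using lift p q pq by (simp_all add: \<pi>.N.M.diff_eq_zero_iff)
  have \<theta>d: "\<theta> d \<in> a_kernel Q F \<rho>" using d over unfolding a_kernel_def' by simp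
  have "cover_lift q = d \<oplus>\<^bsub>P\<^esub> p" using lift(1) p by (simp add: d_def \<pi>.M.M.diff_add_cancel)
  then have "\<psi> (cover_lift q) = \<phi> (\<theta> d) \<oplus>\<^bsub>C\<^esub> \<psi> p"
    using p d(1) by (simp add: extends[OF d(2)])
  moreover have "\<phi> (\<theta> d) \<oplus>\<^bsub>C\<^esub> \<phi> (q \<ominus>\<^bsub>Q\<^esub> \<theta> (cover_lift q)) = \<phi> (q \<ominus>\<^bsub>Q\<^esub> \<theta> p)"
    using lift p q diff \<theta>d
    by (simp add: d_def \<rho>.M.M.a_comm[of "\<theta> (cover_lift q) \<ominus>\<^bsub>Q\<^esub> \<theta> p"] \<rho>.M.M.diff_add_diff flip: \<phi>_add)
  ultimately show ?thesis
    using \<psi>.closed[OF p] \<phi>_closed[OF \<theta>d] \<phi>_closed[OF diff] by (simp add: extension_def \<psi>.N.M.a_ac)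
qed

lemma extension_hom: "extension \<in> lin_hom R Q C"
proof (rule lin_homI)
  fix q assume q: "q \<in> carrier Q"
  note pq = cover_lift[OF q] and diff_q = lift_diff_kernel[OF cover_lift(1)[OF q] q cover_lift(2)[OF q]]
  show "extension q \<in> carrier C"
    using \<psi>.closed[OF pq(1)] \<phi>_closed[OF diff_q] by (simp add: extension_def)
  show "extension (a \<odot>\<^bsub>Q\<^esub> q) = a \<odot>\<^bsub>C\<^esub> extension q" if a: "a \<in> carrier R" for a
  proof -
    have "extension (a \<odot>\<^bsub>Q\<^esub> q)
        = \<psi> (a \<odot>\<^bsub>P\<^esub> cover_lift q) \<oplus>\<^bsub>C\<^esub> \<phi> (a \<odot>\<^bsub>Q\<^esub> (q \<ominus>\<^bsub>Q\<^esub> \<theta> (cover_lift q)))"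
      using a q pq by (subst extension_eq[of "a \<odot>\<^bsub>P\<^esub> cover_lift q"]) (simp_all add: \<rho>.M.smult_diff)
    then show ?thesis
      using a q pq diff_q \<phi>_closed by (simp add: extension_def \<phi>_smult \<psi>.N.smult_r_distr)
  qed
  fix r assume r: "r \<in> carrier Q"
  note pr = cover_lift[OF r] and diff_r = lift_diff_kernel[OF cover_lift(1)[OF r] r cover_lift(2)[OF r]]
  have "extension (q \<oplus>\<^bsub>Q\<^esub> r) = \<psi> (cover_lift q \<oplus>\<^bsub>P\<^esub> cover_lift r)
      \<oplus>\<^bsub>C\<^esub> \<phi> ((q \<ominus>\<^bsub>Q\<^esub> \<theta> (cover_lift q)) \<oplus>\<^bsub>Q\<^esub> (r \<ominus>\<^bsub>Q\<^esub> \<theta> (cover_lift r)))"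
    using q r pq pr
    by (subst extension_eq[of "cover_lift q \<oplus>\<^bsub>P\<^esub> cover_lift r"]) (simp_all add: \<rho>.M.M.add_diff_add)
  then show "extension (q \<oplus>\<^bsub>Q\<^esub> r) = extension q \<oplus>\<^bsub>C\<^esub> extension r"
    using pq pr diff_q diff_r \<phi>_closed by (simp add: extension_def \<phi>_add \<psi>.N.M.a_ac)
qed

lemma extension_kernel:
  assumes q: "q \<in> a_kernel Q F \<rho>"
  shows "extension q = \<phi> q"
proof -
  have "q \<in> carrier Q" "\<rho> q = \<zero>\<^bsub>F\<^esub>" using q unfolding a_kernel_def' by simp_all
  then show ?thesis
    using extension_eq[of "\<zero>\<^bsub>P\<^esub>" q] \<phi>_closed[OF q] by (simp add: \<rho>.M.M.diff_zero)
qed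

end

lemma (in module) cover_lift_over:
  assumes e: "e \<in> I \<rightarrow> carrier M"
    and f: "f \<in> J \<rightarrow> carrier M" "carrier M \<subseteq> lin_ext R M f ` carrier (free_module R J)"
  obtains g where "g \<in> I \<rightarrow> carrier (free_module R J)"
    "\<And>p. p \<in> carrier (free_module R I) \<Longrightarrow>
       lin_ext R M f (lin_ext R (free_module R J) g p) = lin_ext R M e p"
proof -
  have "\<forall>i\<in>I. \<exists>q\<in>carrier (free_module R J). lin_ext R M f q = e i"
    using e f(2) by (fastforce simp: Pi_iff)
  then obtain g where g: "\<And>i. i \<in> I \<Longrightarrow> g i \<in> carrier (free_module R J)"
    "\<And>i. i \<in> I \<Longrightarrow> lin_ext R M f (g i) = e i"
    by metis
  have g_Pi: "g \<in> I \<rightarrow> carrier (free_module R J)" using g(1) by blast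
  have "lin_ext R M f (lin_ext R (free_module R J) g p) = lin_ext R M e p"
    if p: "p \<in> carrier (free_module R I)" for p
    using linear_map.lin_ext_image[OF lin_ext_linear_map[OF f(1)] p g_Pi] lin_ext_cong[OF p e g(2)]
    by simp
  with g_Pi show thesis by (rule that)
qed

lemma (in module) ext1_vanishes_via_transfer:
  assumes C: "module R C"
    and e: "e \<in> I \<rightarrow> carrier M" "carrier M \<subseteq> lin_ext R M e ` carrier (free_module R I)"
    and f: "f \<in> J \<rightarrow> carrier M" "carrier M \<subseteq> lin_ext R M f ` carrier (free_module R J)"
    and ext: "ext1_vanishes_via R M e I C"
  shows "ext1_vanishes_via R M f J C"
  unfolding ext1_vanishes_via_def
proof
  interpret e: linear_map R "free_module R I" M "lin_ext R M e" by (rule lin_ext_linear_map[OF e(1)])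
  interpret f: linear_map R "free_module R J" M "lin_ext R M f" by (rule lin_ext_linear_map[OF f(1)])
  fix \<phi> assume \<phi>: "\<phi> \<in> lin_hom R (syzygies R M f J) C"
  obtain g where g: "g \<in> I \<rightarrow> carrier (free_module R J)" and over: "\<And>p. p \<in> carrier (free_module R I) \<Longrightarrow>
      lin_ext R M f (lin_ext R (free_module R J) g p) = lin_ext R M e p"
    by (rule cover_lift_over[OF e(1) f]) blast
  let ?\<theta> = "lin_ext R (free_module R J) g"
  interpret \<theta>: linear_map R "free_module R I" "free_module R J" ?\<theta>
    by (rule module.lin_ext_linear_map[OF R.free_module g])
  have "?\<theta> \<in> lin_hom R (syzygies R M e I) (syzygies R M f J)"
    unfolding syzygies_def a_kernel_def'
    by (rule lin_homI) (simp_all add: over del: free_module_simps)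
  from bspec[OF ext[unfolded ext1_vanishes_via_def] lin_hom_compose[OF this \<phi>]]
  obtain \<psi> where \<psi>: "\<psi> \<in> lin_hom R (free_module R I) C"
    and "\<And>p. p \<in> carrier (syzygies R M e I) \<Longrightarrow> \<psi> p = \<phi> (?\<theta> p)"
    by blast
  then have extends: "\<psi> p = \<phi> (?\<theta> p)" if "p \<in> a_kernel (free_module R I) M (lin_ext R M e)" for p
    using that by (simp add: syzygies_def)
  let ?kernel = "a_kernel (free_module R J) M (lin_ext R M f)"
  have \<phi>_map: "linear_map R ((free_module R J)\<lparr>carrier := ?kernel\<rparr>) C \<phi>"
    by (intro linear_mapI \<phi>[unfolded syzygies_def] C
        submodule.submodule_is_module[OF f.submodule_kernel f.M.module_axioms])
  have \<psi>_map: "linear_map R (free_module R I) C \<psi>" by (intro linear_mapI R.free_module C \<psi>)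
  interpret cover_extension R "free_module R I" "free_module R J" M C
    "lin_ext R M e" "lin_ext R M f" ?\<theta> \<psi> \<phi>
    by (intro cover_extension.intro cover_extension_axioms.intro e.linear_map_axioms f.linear_map_axioms
        \<theta>.linear_map_axioms \<psi>_map \<phi>_map over e(2) extends)
  show "\<exists>\<psi>\<in>lin_hom R (free_module R J) C. \<forall>c\<in>carrier (syzygies R M f J). \<psi> c = \<phi> c"
    using extension_hom extension_kernel by (auto simp: syzygies_def)
qed

theorem (in module) ext1_vanishes_iff_via:
  assumes "module R C" "e \<in> I \<rightarrow> carrier M" "carrier M \<subseteq> lin_ext R M e ` carrier (free_module R I)"
  shows "ext1_vanishes R M C \<longleftrightarrow> ext1_vanishes_via R M e I C"
proof -
  have id: "(\<lambda>x. x) \<in> carrier M \<rightarrow> carrier M" by simp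
  have span: "carrier M \<subseteq> lin_ext R M (\<lambda>x. x) ` carrier (free_module R (carrier M))"
    using lin_ext_unit_vec[of "\<lambda>x. x"] R.unit_vec_closed by (metis image_eqI subsetI)
  show ?thesis
    unfolding ext1_vanishes_iff_via_carrier
    using ext1_vanishes_via_transfer[OF assms(1) id span assms(2,3)]
      ext1_vanishes_via_transfer[OF assms id span] by blast
qed

section \<open>Telescopes of finite free modules\<close>

text \<open>For \<open>L\<^sub>n = R\<^bsup>I n\<^esup>\<close> with maps \<open>L\<^sub>n \<rightarrow> L\<^sub>n\<^sub>+\<^sub>1\<close> sending the \<open>i\<close>-th basis vector to \<open>A n i\<close>, the
  cokernel of the coboundary on \<open>\<Prod>\<^sub>n M\<^bsup>I n\<^esup> = \<Prod>\<^sub>n Hom(L\<^sub>n, M)\<close> is \<open>lim\<^sup>1 Hom(L\<^sub>n, M)\<close>.\<close>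

definition cochains :: "(nat \<Rightarrow> 'i set) \<Rightarrow> ('r, 'm, 'e) module_scheme \<Rightarrow> (nat \<Rightarrow> 'i \<Rightarrow> 'm) set" where
  "cochains I M = {x. \<forall>n. x n \<in> I n \<rightarrow> carrier M}"

definition coboundary :: "('r, 'x) ring_scheme \<Rightarrow> (nat \<Rightarrow> 'i \<Rightarrow> 'i \<Rightarrow> 'r) \<Rightarrow> ('r, 'm, 'e) module_scheme \<Rightarrow>
    (nat \<Rightarrow> 'i \<Rightarrow> 'm) \<Rightarrow> nat \<Rightarrow> 'i \<Rightarrow> 'm" where
  "coboundary R A M x n i = x n i \<ominus>\<^bsub>M\<^esub> lin_ext R M (x (Suc n)) (A n i)"

definition lim1_vanishes_mod :: "('r, 'x) ring_scheme \<Rightarrow> (nat \<Rightarrow> 'i set) \<Rightarrow> (nat \<Rightarrow> 'i \<Rightarrow> 'i \<Rightarrow> 'r) \<Rightarrow>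
    ('r, 'm, 'e) module_scheme \<Rightarrow> 'm set \<Rightarrow> bool" where
  "lim1_vanishes_mod R I A M N \<longleftrightarrow>
     (\<forall>c\<in>cochains I M. \<exists>x\<in>cochains I M. \<forall>n. \<forall>i\<in>I n. c n i \<ominus>\<^bsub>M\<^esub> coboundary R A M x n i \<in> N)"

lemma cochainsD: "x \<in> cochains I M \<Longrightarrow> x n \<in> I n \<rightarrow> carrier M"
  by (simp add: cochains_def)

lemma cochain_closed: "x \<in> cochains I M \<Longrightarrow> i \<in> I n \<Longrightarrow> x n i \<in> carrier M"
  by (auto simp: cochains_def)

lemma cochain_choice:
  assumes "\<And>n i. i \<in> I n \<Longrightarrow> \<exists>m\<in>carrier M. P n i m"
  shows "\<exists>x\<in>cochains I M. \<forall>n. \<forall>i\<in>I n. P n i (x n i)"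
proof
  let ?x = "\<lambda>n i. SOME m. m \<in> carrier M \<and> P n i m"
  have "?x n i \<in> carrier M \<and> P n i (?x n i)" if "i \<in> I n" for n i
    by (rule someI_ex) (use assms[OF that] in blast)
  then show "?x \<in> cochains I M" "\<forall>n. \<forall>i\<in>I n. P n i (?x n i)"
    by (simp_all add: cochains_def)
qed

locale telescope = R?: cring R for R (structure) +
  fixes I :: "nat \<Rightarrow> 'i set" and A :: "nat \<Rightarrow> 'i \<Rightarrow> 'i \<Rightarrow> 'a"
  assumes finite_index [simp]: "finite (I n)"
    and matrix_closed: "i \<in> I n \<Longrightarrow> A n i \<in> carrier (free_module R (I (Suc n)))"
begin

abbreviation level :: "nat \<Rightarrow> ('a, 'i \<Rightarrow> 'a) module" where
  "level n \<equiv> free_module R (I n)"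

definition step :: "nat \<Rightarrow> ('i \<Rightarrow> 'a) \<Rightarrow> 'i \<Rightarrow> 'a" where
  "step n = lin_ext R (level (Suc n)) (A n)"

primrec transition :: "nat \<Rightarrow> nat \<Rightarrow> ('i \<Rightarrow> 'a) \<Rightarrow> 'i \<Rightarrow> 'a" where
  "transition n 0 v = v"
| "transition n (Suc d) v = step (n + d) (transition n d v)"

lemma matrix_Pi: "A n \<in> I n \<rightarrow> carrier (level (Suc n))"
  using matrix_closed by blast

lemma step_linear_map: "linear_map R (level n) (level (Suc n)) (step n)"
  unfolding step_def by (rule module.lin_ext_linear_map[OF free_module matrix_Pi])

lemma step_closed [simp]: "v \<in> carrier (level n) \<Longrightarrow> step n v \<in> carrier (level (Suc n))"
  by (rule linear_map.closed[OF step_linear_map])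

lemma step_unit_vec: "i \<in> I n \<Longrightarrow> step n (unit_vec R i) = A n i"
  unfolding step_def by (rule module.lin_ext_unit_vec[OF free_module matrix_closed])

lemma transition_linear_map: "linear_map R (level n) (level (n + d)) (transition n d)"
proof (induction d)
  case 0
  show ?case
    by (intro linear_mapI free_module lin_homI) simp_all
next
  case (Suc d)
  from lin_hom_compose[OF linear_map.lin_hom[OF Suc] linear_map.lin_hom[OF step_linear_map]]
  show ?case
    by (intro linear_mapI free_module) (simp add: fun_eq_iff[symmetric])
qed

lemma transition_closed [simp]:
  "v \<in> carrier (level n) \<Longrightarrow> transition n d v \<in> carrier (level (n + d))"
  by (rule linear_map.closed[OF transition_linear_map])

end

locale telescope_module = telescope + module R M for M (structure)
begin

lemma lin_ext_step:
  assumes "v \<in> carrier (level n)" "x \<in> I (Suc n) \<rightarrow> carrier M"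
  shows "lin_ext R M x (step n v) = lin_ext R M (\<lambda>i. lin_ext R M x (A n i)) v"
  unfolding step_def
  by (rule linear_map.lin_ext_image[OF lin_ext_linear_map[OF assms(2)] assms(1) matrix_Pi])

lemma coboundary_closed:
  "\<lbrakk>x \<in> cochains I M; i \<in> I n\<rbrakk> \<Longrightarrow> coboundary R A M x n i \<in> carrier M"
  unfolding coboundary_def
  by (intro M.minus_closed lin_ext_closed[OF matrix_closed] cochain_closed cochainsD)

lemma coboundary_add:
  assumes x: "x \<in> cochains I M" and y: "y \<in> cochains I M" and i: "i \<in> I n"
  shows "coboundary R A M (\<lambda>n i. x n i \<oplus>\<^bsub>M\<^esub> y n i) n i =
    coboundary R A M x n i \<oplus>\<^bsub>M\<^esub> coboundary R A M y n i"
proof -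
  note A = matrix_closed[OF i]
  show ?thesis
    unfolding coboundary_def lin_ext_add[OF A cochainsD[OF x] cochainsD[OF y]]
    by (rule M.add_diff_add) (use i in \<open>simp_all add: cochain_closed[OF x] cochain_closed[OF y]
        lin_ext_closed[OF A cochainsD[OF x]] lin_ext_closed[OF A cochainsD[OF y]]\<close>)
qed

lemma coboundary_smult:
  assumes a: "a \<in> carrier R" and x: "x \<in> cochains I M" and i: "i \<in> I n"
  shows "coboundary R A M (\<lambda>n i. a \<odot>\<^bsub>M\<^esub> x n i) n i = a \<odot>\<^bsub>M\<^esub> coboundary R A M x n i"
proof -
  note A = matrix_closed[OF i]
  show ?thesis
    unfolding coboundary_def lin_ext_smult[OF A cochainsD[OF x] a]
    by (rule smult_diff[symmetric])
      (use i a in \<open>simp_all add: cochain_closed[OF x] lin_ext_closed[OF A cochainsD[OF x]]\<close>)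
qed

lemma coboundary_cong:
  assumes y: "y \<in> cochains I M" and xy: "\<And>n i. i \<in> I n \<Longrightarrow> x n i = y n i" and i: "i \<in> I n"
  shows "coboundary R A M x n i = coboundary R A M y n i"
  unfolding coboundary_def
  using lin_ext_cong[OF matrix_closed[OF i] cochainsD[OF y] xy] xy[OF i] by simp

lemma lim1_vanishes_mod_zero_iff:
  "lim1_vanishes_mod R I A M {\<zero>\<^bsub>M\<^esub>} \<longleftrightarrow>
     (\<forall>c\<in>cochains I M. \<exists>x\<in>cochains I M. \<forall>n. \<forall>i\<in>I n. c n i = coboundary R A M x n i)"
  unfolding lim1_vanishes_mod_def
  by (intro ball_cong bex_cong all_cong1)
    (simp_all add: M.diff_eq_zero_iff cochain_closed coboundary_closed)

end

lemma (in linear_map) coboundary_image: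
  assumes "telescope R I A" "x \<in> cochains I M" "i \<in> I n"
  shows "f (coboundary R A M x n i) = coboundary R A N (\<lambda>n i. f (x n i)) n i"
proof -
  interpret telescope R I A by (rule assms(1))
  note A = matrix_closed[OF assms(3)] and x = cochainsD[OF assms(2)]
  show ?thesis
    using M.lin_ext_closed[OF A x] lin_ext_image[OF A x] cochain_closed[OF assms(2,3)]
    by (simp add: coboundary_def)
qed

locale telescope_colimit = telescope R I A + F: module R F
  for R (structure) and I :: "nat \<Rightarrow> 'i set" and A and F (structure) +
  fixes x
  assumes generator_closed: "x n \<in> I n \<rightarrow> carrier F"
    and compatible: "i \<in> I n \<Longrightarrow> x n i = lin_ext R F (x (Suc n)) (A n i)"
    and jointly_surjective: "z \<in> carrier F \<Longrightarrow> \<exists>n. \<exists>v\<in>carrier (level n). lin_ext R F (x n) v = z"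
    and kernel_eventually_zero: "\<lbrakk>v \<in> carrier (level n); lin_ext R F (x n) v = \<zero>\<^bsub>F\<^esub>\<rbrakk> \<Longrightarrow>
      \<exists>d. transition n d v = (\<lambda>i. \<zero>)"
begin

lemma lin_ext_generator_step:
  assumes "v \<in> carrier (level n)"
  shows "lin_ext R F (x (Suc n)) (step n v) = lin_ext R F (x n) v"
proof -
  interpret telescope_module R I A F ..
  show ?thesis
    unfolding lin_ext_step[OF assms generator_closed]
    by (rule F.lin_ext_cong[OF assms generator_closed]) (simp add: compatible)
qed

abbreviation basis :: "(nat \<times> 'i) set" where
  "basis \<equiv> (SIGMA n:UNIV. I n)"

definition component :: "nat \<Rightarrow> (nat \<times> 'i \<Rightarrow> 'a) \<Rightarrow> 'i \<Rightarrow> 'a" where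
  "component n p = (\<lambda>i. p (n, i))"

definition embed :: "nat \<Rightarrow> ('i \<Rightarrow> 'a) \<Rightarrow> nat \<times> 'i \<Rightarrow> 'a" where
  "embed n v = (\<lambda>(m, i). if m = n then v i else \<zero>)"

text \<open>The partial sums are the inverse of \<open>shift_diff\<close>, which maps the basis bijectively onto the
  defining relations of the colimit.\<close>

primrec partial_sum :: "(nat \<times> 'i \<Rightarrow> 'a) \<Rightarrow> nat \<Rightarrow> 'i \<Rightarrow> 'a" where
  "partial_sum p 0 = component 0 p"
| "partial_sum p (Suc n) = component (Suc n) p \<oplus>\<^bsub>level (Suc n)\<^esub> step n (partial_sum p n)"

definition shift_diff :: "(nat \<times> 'i \<Rightarrow> 'a) \<Rightarrow> nat \<times> 'i \<Rightarrow> 'a" where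
  "shift_diff = lin_ext R (free_module R basis)
     (\<lambda>(n, i). unit_vec R (n, i) \<ominus>\<^bsub>free_module R basis\<^esub> embed (Suc n) (A n i))"

lemma component_closed [simp]:
  assumes "p \<in> carrier (free_module R basis)"
  shows "component n p \<in> carrier (level n)"
  unfolding component_def
  by (rule finite_free_moduleI) (use free_moduleD[OF assms] in auto)

lemma component_linear_map: "linear_map R (free_module R basis) (level n) (component n)"
  by (intro linear_mapI free_module lin_homI)
    (simp_all, simp_all add: component_def)

lemma embed_closed [simp]:
  assumes "v \<in> carrier (level n)"
  shows "embed n v \<in> carrier (free_module R basis)"
proof (rule free_moduleI)
  show "finite {b. embed n v b \<noteq> \<zero>}"
    by (rule finite_subset[of _ "{n} \<times> {i. v i \<noteq> \<zero>}"])
      (use free_moduleD(2)[OF assms] in \<open>auto simp: embed_def split: if_splits\<close>)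
  show "embed n v b \<in> carrier R" for b
    using free_moduleD(1)[OF assms] by (cases b) (simp add: embed_def)
  show "embed n v b = \<zero>" if "b \<notin> basis" for b
    using that free_moduleD(3)[OF assms] by (cases b) (auto simp: embed_def)
qed

lemma embed_linear_map: "linear_map R (level n) (free_module R basis) (embed n)"
  by (intro linear_mapI free_module lin_homI)
    (simp_all, auto simp: embed_def fun_eq_iff)

lemma embed_unit_vec: "embed n (unit_vec R i) = unit_vec R (n, i)"
  by (auto simp: embed_def unit_vec_def)

lemma component_embed: "component m (embed n v) = (if m = n then v else (\<lambda>i. \<zero>))"
  by (auto simp: component_def embed_def)

lemma component_unit_vec: "component m (unit_vec R (n, i)) = (if m = n then unit_vec R i else (\<lambda>i. \<zero>))"
  by (auto simp: component_def unit_vec_def)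

lemma lin_ext_embed:
  assumes C: "module R C" and y: "y \<in> basis \<rightarrow> carrier C" and v: "v \<in> carrier (level n)"
  shows "lin_ext R C y (embed n v) = lin_ext R C (\<lambda>i. y (n, i)) v"
proof -
  interpret C: module R C by (rule C)
  interpret y: linear_map R "free_module R basis" C "lin_ext R C y"
    by (rule C.lin_ext_linear_map[OF y])
  have yn: "(\<lambda>i. y (n, i)) \<in> I n \<rightarrow> carrier C" using y by auto
  show ?thesis
  proof (rule C.free_module_hom_eqI[OF _ C.lin_ext_hom[OF yn] _ v])
    show "(\<lambda>v. lin_ext R C y (embed n v)) \<in> lin_hom R (level n) C"
      by (rule lin_hom_compose[OF linear_map.lin_hom[OF embed_linear_map] y.lin_hom])
    show "lin_ext R C y (embed n (unit_vec R i)) = lin_ext R C (\<lambda>i. y (n, i)) (unit_vec R i)"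
      if "i \<in> I n" for i
      using that y by (simp add: embed_unit_vec C.lin_ext_unit_vec Pi_iff)
  qed
qed

lemma relation_closed:
  "i \<in> I n \<Longrightarrow>
     unit_vec R (n, i) \<ominus>\<^bsub>free_module R basis\<^esub> embed (Suc n) (A n i) \<in> carrier (free_module R basis)"
  by (intro abelian_group.minus_closed[OF module.axioms(2)[OF free_module]] embed_closed matrix_closed
      unit_vec_closed) auto

lemma shift_diff_linear_map: "linear_map R (free_module R basis) (free_module R basis) shift_diff"
  unfolding shift_diff_def
  by (rule module.lin_ext_linear_map[OF free_module]) (use relation_closed in auto)

lemma shift_diff_unit_vec:
  assumes "i \<in> I n"
  shows "shift_diff (unit_vec R (n, i)) = unit_vec R (n, i) \<ominus>\<^bsub>free_module R basis\<^esub> embed (Suc n) (A n i)"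
  unfolding shift_diff_def
  by (subst module.lin_ext_unit_vec[OF free_module]) (use relation_closed[OF assms] in auto)

lemma component_shift_diff:
  assumes q: "q \<in> carrier (free_module R basis)"
  shows "component n (shift_diff q) =
    component n q \<ominus>\<^bsub>level n\<^esub> (case n of 0 \<Rightarrow> (\<lambda>i. \<zero>) | Suc m \<Rightarrow> step m (component m q))"
proof -
  let ?shift = "\<lambda>q. case n of 0 \<Rightarrow> (\<lambda>i. \<zero>) | Suc m \<Rightarrow> step m (component m q)"
  interpret L: module R "level n" by (rule free_module)
  interpret component: linear_map R "free_module R basis" "level n" "component n"
    by (rule component_linear_map)
  have "?shift \<in> lin_hom R (free_module R basis) (level n)"
  proof (cases n)
    case 0
    then show ?thesis using L.zero_closed by (auto intro!: lin_homI)
  next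
    case (Suc m)
    then show ?thesis
      using lin_hom_compose[OF linear_map.lin_hom[OF component_linear_map]
          linear_map.lin_hom[OF step_linear_map]] by simp
  qed
  note hom = L.lin_hom_diff[OF component.lin_hom this]
  show ?thesis
  proof (rule L.free_module_hom_eqI[OF _ hom _ q])
    show "(\<lambda>q. component n (shift_diff q)) \<in> lin_hom R (free_module R basis) (level n)"
      by (rule lin_hom_compose[OF linear_map.lin_hom[OF shift_diff_linear_map] component.lin_hom])
    fix b assume "b \<in> basis"
    then obtain m i where b: "b = (m, i)" and i: "i \<in> I m" by auto
    have "component n (shift_diff (unit_vec R b))
        = component n (unit_vec R (m, i)) \<ominus>\<^bsub>level n\<^esub> component n (embed (Suc m) (A m i))"
      unfolding b shift_diff_unit_vec[OF i]
      by (rule component.diff) (use i matrix_closed in auto)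
    also have "component n (embed (Suc m) (A m i)) = ?shift (unit_vec R b)"
      using linear_map.zero[OF step_linear_map]
      by (auto simp: b component_embed component_unit_vec step_unit_vec[OF i] split: nat.split)
    finally show "component n (shift_diff (unit_vec R b))
        = component n (unit_vec R b) \<ominus>\<^bsub>level n\<^esub> ?shift (unit_vec R b)"
      by (simp add: b)
  qed
qed

lemma partial_sum_linear_map: "linear_map R (free_module R basis) (level n) (\<lambda>p. partial_sum p n)"
proof (induction n)
  case 0
  show ?case using component_linear_map by simp
next
  case (Suc n)
  interpret L: module R "level (Suc n)" by (rule free_module)
  from L.lin_hom_add[OF linear_map.lin_hom[OF component_linear_map]
      lin_hom_compose[OF linear_map.lin_hom[OF Suc] linear_map.lin_hom[OF step_linear_map]]]
  show ?case
    unfolding partial_sum.simps by (intro linear_mapI free_module)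
qed

lemma partial_sum_closed [simp]:
  "p \<in> carrier (free_module R basis) \<Longrightarrow> partial_sum p n \<in> carrier (level n)"
  by (rule linear_map.closed[OF partial_sum_linear_map])

lemma partial_sum_shift_diff:
  assumes q: "q \<in> carrier (free_module R basis)"
  shows "partial_sum (shift_diff q) n = component n q"
proof (induction n)
  case 0
  interpret L: module R "level 0" by (rule free_module)
  show ?case
    using L.M.diff_zero[OF component_closed[OF q]] by (simp add: component_shift_diff[OF q])
next
  case (Suc n)
  interpret L: module R "level (Suc n)" by (rule free_module)
  show ?case
    unfolding partial_sum.simps Suc component_shift_diff[OF q] nat.case
    by (rule L.M.diff_add_cancel) (use q in simp_all)
qed

lemma lin_ext_partial_sum_unit_vec:
  assumes i: "i \<in> I m" and "m \<le> n"
  shows "lin_ext R F (x n) (partial_sum (unit_vec R (m, i)) n) = x m i"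
  using \<open>m \<le> n\<close>
proof (induction n rule: dec_induct)
  case base
  have zero: "partial_sum (unit_vec R (m, i)) n = (\<lambda>i. \<zero>)" if "n < m" for n
    using that
  proof (induction n)
    case (Suc n)
    then show ?case using linear_map.zero[OF step_linear_map, of n] by (simp add: component_unit_vec)
  qed (simp add: component_unit_vec)
  have "partial_sum (unit_vec R (m, i)) m = unit_vec R i"
  proof (cases m)
    case (Suc k)
    have "step k (\<lambda>i. \<zero>) = (\<lambda>i. \<zero>)" using linear_map.zero[OF step_linear_map, of k] by simp
    then show ?thesis using zero[of k] unfolding Suc by (simp add: component_unit_vec)
  qed (simp add: component_unit_vec)
  then show ?case using i generator_closed by (auto simp: Pi_iff)
next
  case (step n)
  have u: "partial_sum (unit_vec R (m, i)) n \<in> carrier (level n)" using i by simp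
  have "partial_sum (unit_vec R (m, i)) (Suc n) = step n (partial_sum (unit_vec R (m, i)) n)"
    using step.hyps(1) free_moduleD(1)[OF step_closed[OF u]] by (simp add: component_unit_vec)
  then show ?case using step.IH lin_ext_generator_step[OF u] by simp
qed

lemma lin_ext_partial_sum_eventually:
  assumes "p \<in> carrier (free_module R basis)"
  shows "\<exists>N. \<forall>n\<ge>N. lin_ext R F (x n) (partial_sum p n) = lin_ext R F (case_prod x) p"
  using assms
proof (induction rule: free_module_induct)
  case zero
  have "partial_sum (\<lambda>i. \<zero>) n = (\<lambda>i. \<zero>)" for n
    using linear_map.zero[OF partial_sum_linear_map] by simp
  then show ?case by simp
next
  case (add p a b)
  obtain m i where b: "b = (m, i)" and i: "i \<in> I m" using add.hyps by auto
  obtain N where N: "\<And>n. n \<ge> N \<Longrightarrow> lin_ext R F (x n) (partial_sum p n) = lin_ext R F (case_prod x) p"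
    using add.IH by blast
  let ?p' = "p \<oplus>\<^bsub>free_module R basis\<^esub> a \<odot>\<^bsub>free_module R basis\<^esub> unit_vec R b"
  interpret x: linear_map R "free_module R basis" F "lin_ext R F (case_prod x)"
    by (rule F.lin_ext_linear_map) (use generator_closed in auto)
  have "lin_ext R F (x n) (partial_sum ?p' n) = lin_ext R F (case_prod x) ?p'" if "n \<ge> max N m" for n
  proof -
    interpret xn: linear_map R "level n" F "lin_ext R F (x n)"
      by (rule F.lin_ext_linear_map[OF generator_closed])
    interpret partial_sum: linear_map R "free_module R basis" "level n" "\<lambda>p. partial_sum p n"
      by (rule partial_sum_linear_map)
    have u: "unit_vec R b \<in> carrier (free_module R basis)" using b i by simp
    have "lin_ext R F (x n) (partial_sum ?p' n) = lin_ext R F (x n) (partial_sum p n)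
        \<oplus>\<^bsub>F\<^esub> a \<odot>\<^bsub>F\<^esub> lin_ext R F (x n) (partial_sum (unit_vec R b) n)"
      using add.hyps u by (simp del: free_module_simps partial_sum.simps)
    also have "\<dots> = lin_ext R F (case_prod x) p \<oplus>\<^bsub>F\<^esub> a \<odot>\<^bsub>F\<^esub> x m i"
      using that N lin_ext_partial_sum_unit_vec[OF i] by (simp add: b)
    also have "\<dots> = lin_ext R F (case_prod x) ?p'"
      using add.hyps u b i generator_closed by (simp add: Pi_iff del: free_module_simps)
    finally show ?thesis .
  qed
  then show ?case by blast
qed

lemma partial_sum_eventually_zero:
  assumes "p \<in> a_kernel (free_module R basis) F (lin_ext R F (case_prod x))"
  shows "\<exists>N. \<forall>n\<ge>N. partial_sum p n = (\<lambda>i. \<zero>)"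
proof -
  have p: "p \<in> carrier (free_module R basis)" "lin_ext R F (case_prod x) p = \<zero>\<^bsub>F\<^esub>"
    using assms unfolding a_kernel_def' by simp_all
  obtain N1 where N1: "\<And>n. n \<ge> N1 \<Longrightarrow> lin_ext R F (x n) (partial_sum p n) = \<zero>\<^bsub>F\<^esub>"
    using lin_ext_partial_sum_eventually[OF p(1)] p(2) by auto
  obtain N2 where "fst ` {b. p b \<noteq> \<zero>} \<subseteq> {..<N2}"
    using finite_nat_bounded[of "fst ` {b. p b \<noteq> \<zero>}"] free_moduleD(2)[OF p(1)] by blast
  then have component: "component n p = (\<lambda>i. \<zero>)" if "n \<ge> N2" for n
    using that by (force simp: component_def)
  define N where "N = max N1 N2"
  have sum_Suc: "partial_sum p (Suc n) = step n (partial_sum p n)" if "n \<ge> N" for n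
    using that component[of "Suc n"] free_moduleD(1)[OF step_closed[OF partial_sum_closed[OF p(1)]]]
    by (simp add: N_def)
  have "partial_sum p (N + d) = transition N d (partial_sum p N)" for d
  proof (induction d)
    case (Suc d)
    then show ?case using sum_Suc[of "N + d"] by simp
  qed simp
  moreover obtain d where "transition N d (partial_sum p N) = (\<lambda>i. \<zero>)"
    using kernel_eventually_zero[OF partial_sum_closed[OF p(1)] N1[of N]] unfolding N_def by auto
  ultimately have base: "partial_sum p (N + d) = (\<lambda>i. \<zero>)" by simp
  have "partial_sum p n = (\<lambda>i. \<zero>)" if "n \<ge> N + d" for n
    using that
  proof (induction n rule: dec_induct)
    case (step n)
    then show ?case using sum_Suc[of n] linear_map.zero[OF step_linear_map, of n] by simp
  qed (rule base)
  then show ?thesis by blast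
qed

abbreviation relations :: "('a, nat \<times> 'i \<Rightarrow> 'a) module" where
  "relations \<equiv> syzygies R F (case_prod x) basis"

definition partial_sums :: "(nat \<times> 'i \<Rightarrow> 'a) \<Rightarrow> nat \<times> 'i \<Rightarrow> 'a" where
  "partial_sums p = (\<lambda>(n, i). partial_sum p n i)"

lemma component_partial_sums: "component n (partial_sums p) = partial_sum p n"
  by (simp add: component_def partial_sums_def)

lemma component_eqI: "(\<And>n. component n p = component n q) \<Longrightarrow> p = q"
  by (auto simp: component_def fun_eq_iff)

lemma generators_Pi: "case_prod x \<in> basis \<rightarrow> carrier F"
  using generator_closed by auto

lemma generators_linear_map: "linear_map R (free_module R basis) F (lin_ext R F (case_prod x))"
  by (rule F.lin_ext_linear_map[OF generators_Pi])

lemma generators_span: "carrier F \<subseteq> lin_ext R F (case_prod x) ` carrier (free_module R basis)"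
proof
  fix z assume "z \<in> carrier F"
  then obtain n v where v: "v \<in> carrier (level n)" "lin_ext R F (x n) v = z"
    using jointly_surjective by blast
  have "lin_ext R F (case_prod x) (embed n v) = z"
    using lin_ext_embed[OF F.module_axioms generators_Pi v(1)] v(2) by simp
  then show "z \<in> lin_ext R F (case_prod x) ` carrier (free_module R basis)"
    using embed_closed[OF v(1)] by blast
qed

lemma relations_iff:
  "p \<in> carrier relations \<longleftrightarrow>
     p \<in> carrier (free_module R basis) \<and> lin_ext R F (case_prod x) p = \<zero>\<^bsub>F\<^esub>"
  by (simp add: syzygies_def a_kernel_def')

lemma partial_sums_closed:
  assumes p: "p \<in> carrier relations"
  shows "partial_sums p \<in> carrier (free_module R basis)"
proof (rule free_moduleI)
  have p': "p \<in> carrier (free_module R basis)" using p by (simp add: relations_iff)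
  note sum = free_moduleD[OF partial_sum_closed[OF p']]
  obtain N where N: "\<And>n. n \<ge> N \<Longrightarrow> partial_sum p n = (\<lambda>i. \<zero>)"
    using partial_sum_eventually_zero p by (auto simp: syzygies_def)
  have "b \<in> (SIGMA n:{..<N}. I n)" if "partial_sums p b \<noteq> \<zero>" for b
  proof -
    obtain n i where b: "b = (n, i)" by (cases b)
    have "partial_sum p n i \<noteq> \<zero>" using that by (simp add: b partial_sums_def)
    then show ?thesis using N[of n] sum(3)[of i n] by (auto simp: b not_le[symmetric])
  qed
  then have "{b. partial_sums p b \<noteq> \<zero>} \<subseteq> (SIGMA n:{..<N}. I n)" by blast
  then show "finite {b. partial_sums p b \<noteq> \<zero>}" by (rule finite_subset) simp
  show "partial_sums p b \<in> carrier R" for b using sum(1) by (cases b) (simp add: partial_sums_def)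
  show "partial_sums p b = \<zero>" if "b \<notin> basis" for b
    using sum(3) that by (cases b) (simp add: partial_sums_def)
qed

lemma shift_diff_partial_sums:
  assumes p: "p \<in> carrier relations"
  shows "shift_diff (partial_sums p) = p"
proof (rule component_eqI)
  fix n
  interpret L: module R "level n" by (rule free_module)
  have p': "p \<in> carrier (free_module R basis)" using p by (simp add: relations_iff)
  show "component n (shift_diff (partial_sums p)) = component n p"
  proof (cases n)
    case 0
    then show ?thesis
      using L.M.diff_zero[of "component n p"] p'
      by (simp add: component_shift_diff[OF partial_sums_closed[OF p]] component_partial_sums)
  next
    case (Suc m)
    have "(component n p \<oplus>\<^bsub>level n\<^esub> step m (partial_sum p m)) \<ominus>\<^bsub>level n\<^esub> step m (partial_sum p m)
        = component n p"
      by (rule L.M.add_diff_cancel) (use p' Suc in simp_all)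
    then show ?thesis
      unfolding component_shift_diff[OF partial_sums_closed[OF p]] component_partial_sums
      by (simp only: Suc nat.case partial_sum.simps)
  qed
qed

lemma partial_sums_shift_diff:
  "q \<in> carrier (free_module R basis) \<Longrightarrow> partial_sums (shift_diff q) = q"
  by (rule component_eqI) (simp only: component_partial_sums partial_sum_shift_diff)

lemma shift_diff_relations:
  assumes q: "q \<in> carrier (free_module R basis)"
  shows "shift_diff q \<in> carrier relations"
proof -
  interpret x: linear_map R "free_module R basis" F "lin_ext R F (case_prod x)"
    by (rule generators_linear_map)
  have "lin_ext R F (case_prod x) (shift_diff q) = (\<lambda>q. \<zero>\<^bsub>F\<^esub>) q"
  proof (rule F.free_module_hom_eqI[OF _ _ _ q])
    show "(\<lambda>q. lin_ext R F (case_prod x) (shift_diff q)) \<in> lin_hom R (free_module R basis) F"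
      by (rule lin_hom_compose[OF linear_map.lin_hom[OF shift_diff_linear_map] x.lin_hom])
    show "(\<lambda>q. \<zero>\<^bsub>F\<^esub>) \<in> lin_hom R (free_module R basis) F" by (rule lin_homI) simp_all
    fix b assume "b \<in> basis"
    then obtain n i where b: "b = (n, i)" and i: "i \<in> I n" by auto
    have "lin_ext R F (case_prod x) (shift_diff (unit_vec R b))
        = x n i \<ominus>\<^bsub>F\<^esub> lin_ext R F (case_prod x) (embed (Suc n) (A n i))"
      unfolding b shift_diff_unit_vec[OF i]
      using i matrix_closed generator_closed by (subst x.diff) (auto simp: Pi_iff)
    also have "lin_ext R F (case_prod x) (embed (Suc n) (A n i)) = x n i"
      using lin_ext_embed[OF F.module_axioms generators_Pi matrix_closed[OF i]] compatible[OF i] by simp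
    finally show "lin_ext R F (case_prod x) (shift_diff (unit_vec R b)) = \<zero>\<^bsub>F\<^esub>"
      using i generator_closed by (auto simp: Pi_iff F.M.diff_eq_zero_iff)
  qed
  then show ?thesis
    using linear_map.closed[OF shift_diff_linear_map q] by (simp add: relations_iff)
qed

lemma shift_diff_hom: "shift_diff \<in> lin_hom R (free_module R basis) relations"
  using linear_map.lin_hom[OF shift_diff_linear_map] shift_diff_relations
  by (auto simp: lin_hom_def syzygies_def)

lemma partial_sums_hom: "partial_sums \<in> lin_hom R relations (free_module R basis)"
proof (rule lin_homI)
  fix p assume p: "p \<in> carrier relations"
  show "partial_sums p \<in> carrier (free_module R basis)" by (rule partial_sums_closed[OF p])
  have p': "p \<in> carrier (free_module R basis)" using p by (simp add: relations_iff)
  show "partial_sums (p \<oplus>\<^bsub>relations\<^esub> q) = partial_sums p \<oplus>\<^bsub>free_module R basis\<^esub> partial_sums q"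
    if q: "q \<in> carrier relations" for q
  proof (rule component_eqI)
    fix n
    have "q \<in> carrier (free_module R basis)" using q by (simp add: relations_iff)
    then have "partial_sum (p \<oplus>\<^bsub>free_module R basis\<^esub> q) n = partial_sum p n \<oplus>\<^bsub>level n\<^esub> partial_sum q n"
      by (rule linear_map.add[OF partial_sum_linear_map p'])
    then show "component n (partial_sums (p \<oplus>\<^bsub>relations\<^esub> q))
        = component n (partial_sums p \<oplus>\<^bsub>free_module R basis\<^esub> partial_sums q)"
      by (simp add: syzygies_def component_partial_sums)
        (simp add: component_def partial_sums_def)
  qed
  show "partial_sums (a \<odot>\<^bsub>relations\<^esub> p) = a \<odot>\<^bsub>free_module R basis\<^esub> partial_sums p"
    if a: "a \<in> carrier R" for a
  proof (rule component_eqI)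
    fix n
    have "partial_sum (a \<odot>\<^bsub>free_module R basis\<^esub> p) n = a \<odot>\<^bsub>level n\<^esub> partial_sum p n"
      by (rule linear_map.smult[OF partial_sum_linear_map a p'])
    then show "component n (partial_sums (a \<odot>\<^bsub>relations\<^esub> p))
        = component n (a \<odot>\<^bsub>free_module R basis\<^esub> partial_sums p)"
      by (simp add: syzygies_def component_partial_sums)
        (simp add: component_def partial_sums_def)
  qed
qed

lemma lin_ext_relation:
  assumes C: "module R C" and y: "y \<in> cochains I C" and i: "i \<in> I n"
  shows "lin_ext R C (case_prod y) (shift_diff (unit_vec R (n, i))) = coboundary R A C y n i"
proof -
  interpret C: module R C by (rule C)
  have y_Pi: "case_prod y \<in> basis \<rightarrow> carrier C" using cochain_closed[OF y] by auto
  interpret y: linear_map R "free_module R basis" C "lin_ext R C (case_prod y)"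
    by (rule C.lin_ext_linear_map[OF y_Pi])
  have "lin_ext R C (case_prod y) (shift_diff (unit_vec R (n, i)))
      = y n i \<ominus>\<^bsub>C\<^esub> lin_ext R C (case_prod y) (embed (Suc n) (A n i))"
    unfolding shift_diff_unit_vec[OF i]
    using i matrix_closed cochain_closed[OF y] by (subst y.diff) auto
  then show ?thesis
    using lin_ext_embed[OF C y_Pi matrix_closed[OF i]] by (simp add: coboundary_def)
qed

lemma lim1_vanishes_if_ext1_vanishes_via:
  assumes C: "module R C" and ext: "ext1_vanishes_via R F (case_prod x) basis C"
    and c: "c \<in> cochains I C"
  shows "\<exists>y\<in>cochains I C. \<forall>n. \<forall>i\<in>I n. c n i = coboundary R A C y n i"
proof -
  interpret C: module R C by (rule C)
  have c_Pi: "case_prod c \<in> basis \<rightarrow> carrier C" using cochain_closed[OF c] by auto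
  define \<phi> where "\<phi> p = lin_ext R C (case_prod c) (partial_sums p)" for p
  have "\<phi> \<in> lin_hom R relations C"
    unfolding \<phi>_def by (rule lin_hom_compose[OF partial_sums_hom C.lin_ext_hom[OF c_Pi]])
  then obtain \<psi> where \<psi>: "\<psi> \<in> lin_hom R (free_module R basis) C"
    and \<psi>\<phi>: "\<And>p. p \<in> carrier relations \<Longrightarrow> \<psi> p = \<phi> p"
    using ext unfolding ext1_vanishes_via_def by blast
  define y where "y n i = \<psi> (unit_vec R (n, i))" for n i
  have y: "y \<in> cochains I C" using \<psi> by (auto simp: cochains_def y_def lin_hom_def)
  have \<psi>_eq: "\<psi> p = lin_ext R C (case_prod y) p" if "p \<in> carrier (free_module R basis)" for p
    using C.lin_hom_eq_lin_ext[OF \<psi> that] by (simp add: y_def case_prod_unfold)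
  have "c n i = coboundary R A C y n i" if i: "i \<in> I n" for n i
  proof -
    have u: "unit_vec R (n, i) \<in> carrier (free_module R basis)" using i by simp
    have "coboundary R A C y n i = \<psi> (shift_diff (unit_vec R (n, i)))"
      using \<psi>_eq linear_map.closed[OF shift_diff_linear_map u] lin_ext_relation[OF C y i] by simp
    also have "\<dots> = lin_ext R C (case_prod c) (unit_vec R (n, i))"
      using \<psi>\<phi>[OF shift_diff_relations[OF u]] by (simp add: \<phi>_def partial_sums_shift_diff[OF u])
    also have "\<dots> = c n i" using cochain_closed[OF c i] by simp
    finally show ?thesis by simp
  qed
  with y show ?thesis by blast
qed

lemma ext1_vanishes_via_if_lim1_vanishes:
  assumes C: "module R C"
    and lim1: "\<And>c. c \<in> cochains I C \<Longrightarrow>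
      \<exists>y\<in>cochains I C. \<forall>n. \<forall>i\<in>I n. c n i = coboundary R A C y n i"
  shows "ext1_vanishes_via R F (case_prod x) basis C"
  unfolding ext1_vanishes_via_def
proof
  interpret C: module R C by (rule C)
  fix \<phi> assume \<phi>: "\<phi> \<in> lin_hom R relations C"
  define c where "c n i = \<phi> (shift_diff (unit_vec R (n, i)))" for n i
  have "c \<in> cochains I C"
    using \<phi> shift_diff_relations by (auto simp: cochains_def c_def lin_hom_def)
  then obtain y where y: "y \<in> cochains I C"
    and cy: "\<And>n i. i \<in> I n \<Longrightarrow> c n i = coboundary R A C y n i"
    using lim1 by blast
  have y_Pi: "case_prod y \<in> basis \<rightarrow> carrier C" using cochain_closed[OF y] by auto
  have "lin_ext R C (case_prod y) (shift_diff q) = \<phi> (shift_diff q)"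
    if q: "q \<in> carrier (free_module R basis)" for q
  proof (rule C.free_module_hom_eqI[OF _ _ _ q])
    show "(\<lambda>q. lin_ext R C (case_prod y) (shift_diff q)) \<in> lin_hom R (free_module R basis) C"
      by (rule lin_hom_compose[OF linear_map.lin_hom[OF shift_diff_linear_map] C.lin_ext_hom[OF y_Pi]])
    show "(\<lambda>q. \<phi> (shift_diff q)) \<in> lin_hom R (free_module R basis) C"
      by (rule lin_hom_compose[OF shift_diff_hom \<phi>])
    show "lin_ext R C (case_prod y) (shift_diff (unit_vec R b)) = \<phi> (shift_diff (unit_vec R b))"
      if "b \<in> basis" for b
      using that lin_ext_relation[OF C y] cy by (auto simp: c_def)
  qed
  then have "lin_ext R C (case_prod y) p = \<phi> p" if "p \<in> carrier relations" for p
    using partial_sums_closed[OF that] shift_diff_partial_sums[OF that] by metis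
  then show "\<exists>\<psi>\<in>lin_hom R (free_module R basis) C. \<forall>p\<in>carrier relations. \<psi> p = \<phi> p"
    using C.lin_ext_hom[OF y_Pi] by blast
qed

theorem ext1_vanishes_iff_lim1_vanishes:
  assumes C: "module R C"
  shows "ext1_vanishes R F C \<longleftrightarrow> lim1_vanishes_mod R I A C {\<zero>\<^bsub>C\<^esub>}"
proof -
  interpret C: telescope_module R I A C
    by (intro telescope_module.intro telescope_axioms C)
  have "ext1_vanishes R F C \<longleftrightarrow> ext1_vanishes_via R F (case_prod x) basis C"
    by (rule F.ext1_vanishes_iff_via[OF C generators_Pi generators_span])
  then show ?thesis
    unfolding C.lim1_vanishes_mod_zero_iff
    using lim1_vanishes_if_ext1_vanishes_via[OF C] ext1_vanishes_via_if_lim1_vanishes[OF C] by blast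
qed

end

section \<open>Localisation at a countable multiplicative subset\<close>

locale multiplicative_subset = cring + fixes S assumes S: "mult_subset R S"
begin

lemma S_carrier [simp]: "s \<in> S \<Longrightarrow> s \<in> carrier R"
  and S_one [simp]: "\<one> \<in> S"
  and S_mult [simp]: "s \<in> S \<Longrightarrow> t \<in> S \<Longrightarrow> s \<otimes> t \<in> S"
  using S unfolding mult_subset_def by auto

lemma loc_rel_iff:
  "((r, s), (r', s')) \<in> loc_rel R S \<longleftrightarrow>
     r \<in> carrier R \<and> s \<in> S \<and> r' \<in> carrier R \<and> s' \<in> S \<and>
     (\<exists>t\<in>S. t \<otimes> (r \<otimes> s') = t \<otimes> (r' \<otimes> s))"
proof -
  have "t \<otimes> (a \<ominus> b) = \<zero> \<longleftrightarrow> t \<otimes> a = t \<otimes> b"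
    if "t \<in> carrier R" "a \<in> carrier R" "b \<in> carrier R" for t a b
    using that module.smult_diff[OF regular_module, of t a b] by (simp add: diff_eq_zero_iff)
  then show ?thesis unfolding loc_rel_def by auto
qed

lemma loc_rel_equiv: "equiv (carrier R \<times> S) (loc_rel R S)"
proof (rule equivI)
  show "loc_rel R S \<subseteq> (carrier R \<times> S) \<times> carrier R \<times> S" by (auto simp: loc_rel_def)
  show "refl_on (carrier R \<times> S) (loc_rel R S)"
    by (rule refl_onI) (auto simp: loc_rel_iff intro: S_one)
  show "sym (loc_rel R S)"
    by (rule symI) (auto simp: loc_rel_iff; metis)
  show "trans (loc_rel R S)"
  proof (rule transI)
    fix p q w assume "(p, q) \<in> loc_rel R S" "(q, w) \<in> loc_rel R S"
    moreover obtain r s where p: "p = (r, s)" by (cases p)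
    moreover obtain r' s' where q: "q = (r', s')" by (cases q)
    moreover obtain r'' s'' where w: "w = (r'', s'')" by (cases w)
    ultimately obtain t t' where closed: "r \<in> carrier R" "s \<in> S" "r' \<in> carrier R" "s' \<in> S"
        "r'' \<in> carrier R" "s'' \<in> S" "t \<in> S" "t' \<in> S"
      and eqs: "t \<otimes> (r \<otimes> s') = t \<otimes> (r' \<otimes> s)" "t' \<otimes> (r' \<otimes> s'') = t' \<otimes> (r'' \<otimes> s')"
      by (auto simp: loc_rel_iff)
    have "(t \<otimes> t' \<otimes> s') \<otimes> (r \<otimes> s'') = (t \<otimes> (r \<otimes> s')) \<otimes> (t' \<otimes> s'')" using closed by (simp add: m_ac)
    also have "\<dots> = (t' \<otimes> (r' \<otimes> s'')) \<otimes> (t \<otimes> s)" unfolding eqs(1) using closed by (simp add: m_ac)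
    also have "\<dots> = (t \<otimes> t' \<otimes> s') \<otimes> (r'' \<otimes> s)" unfolding eqs(2) using closed by (simp add: m_ac)
    finally show "(p, w) \<in> loc_rel R S"
      unfolding p w loc_rel_iff using closed by (auto intro!: bexI[of _ "t \<otimes> t' \<otimes> s'"])
  qed
qed

lemma loc_class_eq_iff:
  assumes "r \<in> carrier R" "s \<in> S" "r' \<in> carrier R" "s' \<in> S"
  shows "loc_class R S (r, s) = loc_class R S (r', s') \<longleftrightarrow> (\<exists>t\<in>S. t \<otimes> (r \<otimes> s') = t \<otimes> (r' \<otimes> s))"
  unfolding loc_class_def
  using eq_equiv_class_iff[OF loc_rel_equiv, of "(r, s)" "(r', s')"] assms by (simp add: loc_rel_iff)

lemma loc_class_eqI:
  assumes "r \<in> carrier R" "s \<in> S" "r' \<in> carrier R" "s' \<in> S" "r \<otimes> s' = r' \<otimes> s"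
  shows "loc_class R S (r, s) = loc_class R S (r', s')"
  using assms by (subst loc_class_eq_iff) (auto intro: S_one)

lemma loc_class_closed [simp]: "r \<in> carrier R \<Longrightarrow> s \<in> S \<Longrightarrow> loc_class R S (r, s) \<in> carrier (loc R S)"
  by (auto simp: loc_def loc_class_def quotient_def)

lemma loc_carrierE:
  assumes "U \<in> carrier (loc R S)"
  obtains r s where "r \<in> carrier R" "s \<in> S" "U = loc_class R S (r, s)"
  using assms by (auto simp: loc_def loc_class_def quotient_def)

lemma loc_zero: "\<zero>\<^bsub>loc R S\<^esub> = loc_class R S (\<zero>, \<one>)"
  by (simp add: loc_def)

lemma loc_rep_class:
  assumes "r \<in> carrier R" "s \<in> S"
  obtains p q t where "loc_rep (loc_class R S (r, s)) = (p, q)" "p \<in> carrier R" "q \<in> S" "t \<in> S"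
    "t \<otimes> (r \<otimes> q) = t \<otimes> (p \<otimes> s)"
proof -
  have "(r, s) \<in> loc_class R S (r, s)"
    unfolding loc_class_def using equiv_class_self[OF loc_rel_equiv] assms by auto
  then have "loc_rep (loc_class R S (r, s)) \<in> loc_class R S (r, s)"
    unfolding loc_rep_def by (rule someI)
  then have "((r, s), loc_rep (loc_class R S (r, s))) \<in> loc_rel R S" by (simp add: loc_class_def)
  then show thesis
    using that by (cases "loc_rep (loc_class R S (r, s))") (auto simp: loc_rel_iff)
qed

lemma loc_add:
  assumes rs: "r \<in> carrier R" "s \<in> S" and rs': "r' \<in> carrier R" "s' \<in> S"
  shows "loc_class R S (r, s) \<oplus>\<^bsub>loc R S\<^esub> loc_class R S (r', s') =
    loc_class R S (r \<otimes> s' \<oplus> r' \<otimes> s, s \<otimes> s')"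
proof -
  obtain p q t where pq: "loc_rep (loc_class R S (r, s)) = (p, q)"
    and closed: "p \<in> carrier R" "q \<in> S" "t \<in> S" and eq: "t \<otimes> (r \<otimes> q) = t \<otimes> (p \<otimes> s)"
    using loc_rep_class[OF rs] .
  obtain p' q' t' where pq': "loc_rep (loc_class R S (r', s')) = (p', q')"
    and closed': "p' \<in> carrier R" "q' \<in> S" "t' \<in> S" and eq': "t' \<otimes> (r' \<otimes> q') = t' \<otimes> (p' \<otimes> s')"
    using loc_rep_class[OF rs'] .
  have "(t \<otimes> t') \<otimes> ((r \<otimes> s' \<oplus> r' \<otimes> s) \<otimes> (q \<otimes> q'))
     = (t \<otimes> (r \<otimes> q)) \<otimes> (t' \<otimes> (s' \<otimes> q')) \<oplus> (t' \<otimes> (r' \<otimes> q')) \<otimes> (t \<otimes> (s \<otimes> q))"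
    using rs rs' closed closed' by (simp add: r_distr l_distr m_ac)
  also have "\<dots> = (t \<otimes> t') \<otimes> ((p \<otimes> q' \<oplus> p' \<otimes> q) \<otimes> (s \<otimes> s'))"
    unfolding eq eq' using rs rs' closed closed' by (simp add: r_distr l_distr m_ac)
  finally have "loc_class R S (r \<otimes> s' \<oplus> r' \<otimes> s, s \<otimes> s') = loc_class R S (p \<otimes> q' \<oplus> p' \<otimes> q, q \<otimes> q')"
    using rs rs' closed closed' by (subst loc_class_eq_iff) (auto intro!: bexI[of _ "t \<otimes> t'"])
  then show ?thesis using pq pq' by (simp add: loc_def)
qed

lemma loc_smult:
  assumes a: "a \<in> carrier R" and rs: "r \<in> carrier R" "s \<in> S"
  shows "a \<odot>\<^bsub>loc R S\<^esub> loc_class R S (r, s) = loc_class R S (a \<otimes> r, s)"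
proof -
  obtain p q t where pq: "loc_rep (loc_class R S (r, s)) = (p, q)"
    and closed: "p \<in> carrier R" "q \<in> S" "t \<in> S" and eq: "t \<otimes> (r \<otimes> q) = t \<otimes> (p \<otimes> s)"
    using loc_rep_class[OF rs] .
  have "t \<otimes> ((a \<otimes> r) \<otimes> q) = a \<otimes> (t \<otimes> (r \<otimes> q))" using a rs closed by (simp add: m_ac)
  also have "\<dots> = t \<otimes> ((a \<otimes> p) \<otimes> s)" unfolding eq using a rs closed by (simp add: m_ac)
  finally have "loc_class R S (a \<otimes> r, s) = loc_class R S (a \<otimes> p, q)"
    using a rs closed by (subst loc_class_eq_iff) auto
  then show ?thesis using pq by (simp add: loc_def)
qed

lemma loc_add_same:
  assumes "r \<in> carrier R" "r' \<in> carrier R" "s \<in> S"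
  shows "loc_class R S (r, s) \<oplus>\<^bsub>loc R S\<^esub> loc_class R S (r', s) = loc_class R S (r \<oplus> r', s)"
  using assms by (simp add: loc_add) (rule loc_class_eqI, auto simp: l_distr r_distr m_ac)

lemma loc_class_zero: "s \<in> S \<Longrightarrow> loc_class R S (\<zero>, s) = \<zero>\<^bsub>loc R S\<^esub>"
  unfolding loc_zero by (rule loc_class_eqI) auto

lemma loc_abelian_group: "abelian_group (loc R S)"
proof (rule abelian_groupI)
  fix U assume U: "U \<in> carrier (loc R S)"
  show "\<zero>\<^bsub>loc R S\<^esub> \<oplus>\<^bsub>loc R S\<^esub> U = U"
    using U by (elim loc_carrierE) (simp add: loc_zero loc_add)
  show "\<exists>V\<in>carrier (loc R S). V \<oplus>\<^bsub>loc R S\<^esub> U = \<zero>\<^bsub>loc R S\<^esub>"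
  proof -
    obtain r s where "r \<in> carrier R" "s \<in> S" "U = loc_class R S (r, s)" using U by (rule loc_carrierE)
    then show ?thesis
      by (intro bexI[of _ "loc_class R S (\<ominus> r, s)"]) (simp_all add: loc_add_same l_neg loc_class_zero)
  qed
  fix V assume V: "V \<in> carrier (loc R S)"
  show "U \<oplus>\<^bsub>loc R S\<^esub> V \<in> carrier (loc R S)"
    using U V by (elim loc_carrierE) (simp add: loc_add)
  show "U \<oplus>\<^bsub>loc R S\<^esub> V = V \<oplus>\<^bsub>loc R S\<^esub> U"
    using U V by (elim loc_carrierE) (simp add: loc_add m_comm a_comm)
  fix W assume W: "W \<in> carrier (loc R S)"
  show "U \<oplus>\<^bsub>loc R S\<^esub> V \<oplus>\<^bsub>loc R S\<^esub> W = U \<oplus>\<^bsub>loc R S\<^esub> (V \<oplus>\<^bsub>loc R S\<^esub> W)"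
    using U V W by (elim loc_carrierE) (simp add: loc_add l_distr r_distr m_ac a_ac)
qed (simp add: loc_zero)

lemma loc_module: "module R (loc R S)"
proof (rule moduleI[OF is_cring loc_abelian_group])
  fix a U assume a: "a \<in> carrier R" and U: "U \<in> carrier (loc R S)"
  show "a \<odot>\<^bsub>loc R S\<^esub> U \<in> carrier (loc R S)"
    using a U by (elim loc_carrierE) (simp add: loc_smult)
  show "(a \<oplus> b) \<odot>\<^bsub>loc R S\<^esub> U = a \<odot>\<^bsub>loc R S\<^esub> U \<oplus>\<^bsub>loc R S\<^esub> b \<odot>\<^bsub>loc R S\<^esub> U"
    "(a \<otimes> b) \<odot>\<^bsub>loc R S\<^esub> U = a \<odot>\<^bsub>loc R S\<^esub> (b \<odot>\<^bsub>loc R S\<^esub> U)" if "b \<in> carrier R" for b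
    using a that U by (elim loc_carrierE; simp add: loc_smult loc_add_same l_distr m_assoc)+
  show "a \<odot>\<^bsub>loc R S\<^esub> (U \<oplus>\<^bsub>loc R S\<^esub> V) = a \<odot>\<^bsub>loc R S\<^esub> U \<oplus>\<^bsub>loc R S\<^esub> a \<odot>\<^bsub>loc R S\<^esub> V"
    if "V \<in> carrier (loc R S)" for V
    using a U that by (elim loc_carrierE) (simp add: loc_add loc_smult r_distr m_assoc)
qed (elim loc_carrierE, simp add: loc_smult)

end

lemma (in comm_monoid) finprod_mem_submonoid:
  assumes "S \<subseteq> carrier G" "\<one> \<in> S" "\<And>a b. \<lbrakk>a \<in> S; b \<in> S\<rbrakk> \<Longrightarrow> a \<otimes> b \<in> S"
    and f: "\<And>i. i \<in> A \<Longrightarrow> f i \<in> S"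
  shows "(\<Otimes>i\<in>A. f i) \<in> S"
proof (cases "finite A")
  case True
  then show ?thesis using f
  proof (induction A rule: finite_induct)
    case (insert i A)
    then show ?case using assms(1-3) by (subst finprod_insert) auto
  qed (simp add: assms(2))
qed (simp add: assms(2))

lemma (in monoid) multlist_append:
  assumes "set xs \<subseteq> carrier G" "set ys \<subseteq> carrier G"
  shows "foldr (\<otimes>) (xs @ ys) \<one> = foldr (\<otimes>) xs \<one> \<otimes> foldr (\<otimes>) ys \<one>"
  using assms by (induction xs) (simp_all add: m_assoc)

lemma (in primeideal) complement_mult_subset: "mult_subset R (carrier R - I)"
  using I_notcarr one_imp_carrier I_prime by (auto simp: mult_subset_def)

lemma (in cring) countable_subset_of_mult_subset:
  assumes S: "mult_subset R S" and G: "G \<subseteq> S" "countable G"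
  obtains g :: "nat \<Rightarrow> 'a" where "mult_subset R (range g)" "range g \<subseteq> S" "G \<subseteq> range g"
proof -
  let ?prod = "\<lambda>gs. foldr (\<otimes>) gs \<one>"
  let ?T = "?prod ` lists G"
  have S_carrier: "S \<subseteq> carrier R" and one: "\<one> \<in> S" and mult: "\<And>s t. \<lbrakk>s \<in> S; t \<in> S\<rbrakk> \<Longrightarrow> s \<otimes> t \<in> S"
    using S by (auto simp: mult_subset_def)
  have prod_S: "?prod gs \<in> S" if "gs \<in> lists G" for gs
    using that by induction (use one mult G(1) in auto)
  have append: "?prod (gs @ hs) = ?prod gs \<otimes> ?prod hs" if "gs \<in> lists G" "hs \<in> lists G" for gs hs
    by (rule multlist_append) (use that G(1) S_carrier in auto)
  have "countable ?T" using G(2) by simp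
  moreover have "?T \<noteq> {}" by (metis empty_iff image_eqI lists.Nil)
  ultimately have range: "range (from_nat_into ?T) = ?T" by (intro range_from_nat_into)
  have TS: "?T \<subseteq> S" using prod_S by blast
  have GT: "G \<subseteq> ?T"
  proof
    fix s assume s: "s \<in> G"
    then have "s = ?prod [s]" using G(1) S_carrier by auto
    moreover have "[s] \<in> lists G" using s by simp
    ultimately show "s \<in> ?T" by blast
  qed
  have "\<one> \<in> ?T" by (rule image_eqI[of _ _ "[]"]) simp_all
  moreover have "s \<otimes> t \<in> ?T" if s: "s \<in> ?T" and t: "t \<in> ?T" for s t
  proof -
    obtain gs hs where "gs \<in> lists G" "s = ?prod gs" "hs \<in> lists G" "t = ?prod hs"
      using s t by (elim imageE)
    then show ?thesis using append[of gs hs] by (intro image_eqI[of _ _ "gs @ hs"]) simp_all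
  qed
  moreover have "?T \<subseteq> carrier R" using TS S_carrier by (rule order_trans)
  ultimately have "mult_subset R ?T" unfolding mult_subset_def by (intro conjI ballI)
  then show thesis using TS GT by (intro that[of "from_nat_into ?T"]) (simp_all only: range)
qed

locale enumerated_multiplicative_subset = cring + fixes g :: "nat \<Rightarrow> 'a"
  assumes range_mult_subset: "mult_subset R (range g)"
begin

sublocale multiplicative_subset R "range g"
  by (intro multiplicative_subset.intro multiplicative_subset_axioms.intro is_cring range_mult_subset)

definition prefix_prod :: "nat \<Rightarrow> 'a" where
  "prefix_prod n = (\<Otimes>i\<in>{..n}. g i)"

definition denominator :: "nat \<Rightarrow> 'a" where
  "denominator n = (\<Otimes>i\<in>{..<n}. prefix_prod i)"

lemma prefix_prod_mem [simp]: "prefix_prod n \<in> range g"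
  unfolding prefix_prod_def by (rule finprod_mem_submonoid) auto

lemma denominator_mem [simp]: "denominator n \<in> range g"
  unfolding denominator_def by (rule finprod_mem_submonoid) auto

lemma prefix_prod_closed [simp]: "prefix_prod n \<in> carrier R"
  using S_carrier[OF prefix_prod_mem] .

lemma denominator_closed [simp]: "denominator n \<in> carrier R"
  using S_carrier[OF denominator_mem] .

lemma g_closed [simp]: "g i \<in> carrier R"
  by simp

lemma denominator_Suc: "denominator (Suc n) = denominator n \<otimes> prefix_prod n"
  unfolding denominator_def lessThan_Suc by (subst finprod_insert) (auto simp: m_comm)

lemma prefix_prod_divisible:
  assumes "i \<le> n"
  shows "\<exists>h\<in>carrier R. prefix_prod n = g i \<otimes> h"
proof -
  have "{..n} = insert i ({..n} - {i})" using assms by auto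
  then have "prefix_prod n = g i \<otimes> (\<Otimes>j\<in>{..n} - {i}. g j)"
    unfolding prefix_prod_def
    by (metis DiffD2 Pi_I finite_Diff finite_atMost finprod_insert g_closed singletonI)
  then show ?thesis by auto
qed

abbreviation index :: "nat \<Rightarrow> unit set" where
  "index n \<equiv> {()}"

abbreviation matrix :: "nat \<Rightarrow> unit \<Rightarrow> unit \<Rightarrow> 'a" where
  "matrix n i \<equiv> (\<lambda>_. prefix_prod n)"

lemma rank_one_lin_ext:
  assumes "module R M" "c \<in> carrier (free_module R {()})" "e () \<in> carrier M"
  shows "lin_ext R M e c = c () \<odot>\<^bsub>M\<^esub> e ()"
proof -
  interpret M: module R M by (rule assms(1))
  show ?thesis
    using M.lin_ext_eq_finsum[OF assms(2), of e "{()}"] free_moduleD(1)[OF assms(2)] assms(3) by auto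
qed

lemma matrix_free: "matrix n i \<in> carrier (free_module R {()})"
  by (rule finite_free_moduleI) auto

sublocale tele: telescope R index matrix
  by (intro telescope.intro telescope_axioms.intro is_cring) (simp_all add: matrix_free)

lemma step_eq:
  "v \<in> carrier (free_module R {()}) \<Longrightarrow> tele.step n v = (\<lambda>_. v () \<otimes> prefix_prod n)"
  unfolding tele.step_def by (subst rank_one_lin_ext[OF free_module]) (simp_all add: matrix_free)

lemma carrier_locE_denominator:
  assumes "z \<in> carrier (loc R (range g))"
  obtains r n where "r \<in> carrier R" "z = loc_class R (range g) (r, denominator n)"
proof -
  obtain r i where r: "r \<in> carrier R" and z: "z = loc_class R (range g) (r, g i)"
    using loc_carrierE[OF assms] by blast
  obtain h where h: "h \<in> carrier R" "prefix_prod i = g i \<otimes> h"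
    using prefix_prod_divisible[OF order_refl] by blast
  have "r \<otimes> (denominator i \<otimes> prefix_prod i) = r \<otimes> h \<otimes> denominator i \<otimes> g i"
    using r h(1) by (simp add: h(2) m_ac)
  then have "z = loc_class R (range g) (r \<otimes> h \<otimes> denominator i, denominator (Suc i))"
    unfolding z denominator_Suc by (intro loc_class_eqI) (use r h(1) in simp_all)
  then show thesis using r h(1) by (intro that[of "r \<otimes> h \<otimes> denominator i"]) simp_all
qed

lemma transition_annihilated:
  assumes v: "v \<in> carrier (free_module R {()})" and m: "g m \<otimes> v () = \<zero>"
  shows "tele.transition n (Suc m) v = (\<lambda>i. \<zero>)"
proof -
  obtain h where h: "h \<in> carrier R" "prefix_prod (n + m) = g m \<otimes> h"
    using prefix_prod_divisible[of m "n + m"] by auto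
  define w where "w = tele.transition n m v"
  have w: "w \<in> carrier (free_module R {()})" unfolding w_def using tele.transition_closed[OF v] .
  have "g m \<odot>\<^bsub>tele.level n\<^esub> v = \<zero>\<^bsub>tele.level n\<^esub>" using m by (simp add: fun_eq_iff)
  then have "g m \<odot>\<^bsub>tele.level (n + m)\<^esub> w = \<zero>\<^bsub>tele.level (n + m)\<^esub>"
    unfolding w_def
    using linear_map.smult[OF tele.transition_linear_map _ v, of "g m"]
      linear_map.zero[OF tele.transition_linear_map] by (metis g_closed)
  then have "g m \<otimes> w () = \<zero>" by (simp add: fun_eq_iff)
  then have "w () \<otimes> prefix_prod (n + m) = \<zero>"
    using h free_moduleD(1)[OF w, of "()"] by (simp add: m_lcomm m_assoc[symmetric] m_comm)
  then show ?thesis using step_eq[OF w] by (simp add: w_def)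
qed

lemma localisation_colimit:
  "telescope_colimit R index matrix (loc R (range g)) (\<lambda>n _. loc_class R (range g) (\<one>, denominator n))"
proof (intro telescope_colimit.intro telescope_colimit_axioms.intro tele.telescope_axioms loc_module)
  let ?x = "\<lambda>n (i::unit). loc_class R (range g) (\<one>, denominator n)"
  show "?x n \<in> index n \<rightarrow> carrier (loc R (range g))" for n by simp
  have lin_ext_x: "lin_ext R (loc R (range g)) (?x n) v = loc_class R (range g) (v (), denominator n)"
    if "v \<in> carrier (free_module R {()})" for v n
    using free_moduleD(1)[OF that] by (simp add: rank_one_lin_ext[OF loc_module that] loc_smult)
  show "?x n i = lin_ext R (loc R (range g)) (?x (Suc n)) (matrix n i)" for n i
    unfolding lin_ext_x[OF matrix_free] unfolding denominator_Suc
    by (rule loc_class_eqI) (auto simp: m_comm)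
  show "\<exists>n. \<exists>v\<in>carrier (tele.level n). lin_ext R (loc R (range g)) (?x n) v = z"
    if "z \<in> carrier (loc R (range g))" for z
  proof -
    obtain r n where r: "r \<in> carrier R" and z: "z = loc_class R (range g) (r, denominator n)"
      using carrier_locE_denominator[OF \<open>z \<in> _\<close>] .
    have "(\<lambda>_. r) \<in> carrier (free_module R {()})" by (rule finite_free_moduleI) (use r in auto)
    then show ?thesis using lin_ext_x z by blast
  qed
  show "\<exists>d. tele.transition n d v = (\<lambda>i. \<zero>)"
    if v: "v \<in> carrier (tele.level n)"
      and "lin_ext R (loc R (range g)) (?x n) v = \<zero>\<^bsub>loc R (range g)\<^esub>" for n v
  proof -
    have "loc_class R (range g) (v (), denominator n) = loc_class R (range g) (\<zero>, \<one>)"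
      using that(2) unfolding lin_ext_x[OF v] loc_zero .
    then obtain m where "g m \<otimes> v () = \<zero>"
      using free_moduleD(1)[OF v, of "()"] by (auto simp: loc_class_eq_iff)
    then show ?thesis using transition_annihilated[OF v] by blast
  qed
qed

end

lemma (in module) almost_cotorsion_telescope:
  assumes "almost_cotorsion R M" and g: "mult_subset R (range g)" and x: "\<And>n. x n \<in> carrier M"
  shows "\<exists>y. (\<forall>n. y n \<in> carrier M) \<and>
    (\<forall>n. x n = y n \<ominus>\<^bsub>M\<^esub> (\<Otimes>i\<in>{..n::nat}. g i) \<odot>\<^bsub>M\<^esub> y (Suc n))"
proof -
  interpret g: enumerated_multiplicative_subset R g
    by (intro enumerated_multiplicative_subset.intro enumerated_multiplicative_subset_axioms.intro
        R.is_cring g)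
  interpret L: telescope_colimit R g.index g.matrix "loc R (range g)"
    "\<lambda>n _. loc_class R (range g) (\<one>, g.denominator n)"
    by (rule g.localisation_colimit)
  interpret T: telescope_module R g.index g.matrix M
    by (intro telescope_module.intro g.tele.telescope_axioms module_axioms)
  have "ext1_vanishes R (loc R (range g)) M"
    using assms(1) g unfolding almost_cotorsion_def by blast
  then have lim1: "lim1_vanishes_mod R g.index g.matrix M {\<zero>\<^bsub>M\<^esub>}"
    unfolding L.ext1_vanishes_iff_lim1_vanishes[OF module_axioms] .
  have "(\<lambda>n _. x n) \<in> cochains g.index M" using x by (simp add: cochains_def)
  from bspec[OF lim1[unfolded T.lim1_vanishes_mod_zero_iff] this] obtain y
    where y: "y \<in> cochains g.index M"
    and "\<And>n. x n = coboundary R g.matrix M y n ()"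
    by auto
  then have "x n = y n () \<ominus>\<^bsub>M\<^esub> g.prefix_prod n \<odot>\<^bsub>M\<^esub> y (Suc n) ()" for n
    using g.rank_one_lin_ext[OF module_axioms g.matrix_free, of "y (Suc n)" n]
      cochain_closed[OF y, of "()" "Suc n"]
    by (simp add: coboundary_def)
  then show ?thesis
    using cochain_closed[OF y, of "()"] unfolding g.prefix_prod_def
    by (intro exI[of _ "\<lambda>n. y n ()"]) simp
qed

section \<open>Mittag-Leffler systems\<close>

primrec descend :: "(nat \<Rightarrow> 'h \<Rightarrow> 'h) \<Rightarrow> nat \<Rightarrow> nat \<Rightarrow> 'h \<Rightarrow> 'h" where
  "descend f n 0 h = h"
| "descend f n (Suc d) h = descend f n d (f (n + d) h)"

lemma descend_add: "descend f n (d + e) h = descend f n d (descend f (n + d) e h)"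
  by (induction e arbitrary: h) (simp_all add: add.assoc)

lemma descend_Suc: "descend f n (Suc d) h = f n (descend f (Suc n) d h)"
  using descend_add[of f n 1 d h] by simp

lemma descend_closed:
  "(\<And>n h. h \<in> H (Suc n) \<Longrightarrow> f n h \<in> H n) \<Longrightarrow> h \<in> H (n + d) \<Longrightarrow> descend f n d h \<in> H n"
  by (induction d arbitrary: h) auto

lemma mittag_leffler:
  fixes H :: "nat \<Rightarrow> 'h set" and f :: "nat \<Rightarrow> 'h \<Rightarrow> 'h" and E :: "nat \<Rightarrow> 'h \<Rightarrow> 'h \<Rightarrow> bool"
  assumes closed: "\<And>n h. h \<in> H (Suc n) \<Longrightarrow> f n h \<in> H n"
    and refl: "\<And>n h. h \<in> H n \<Longrightarrow> E n h h"
    and nonempty: "\<And>n. H n \<noteq> {}"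
    and stable: "\<And>n. \<exists>d. \<forall>e. \<forall>h\<in>H (n + d). \<exists>h'\<in>H (n + (d + e)).
      E n (descend f n d h) (descend f n (d + e) h')"
  shows "\<exists>y. \<forall>n. y n \<in> H n \<and> E n (y n) (f n (y (Suc n)))"
proof -
  note closed = descend_closed[of H f, OF closed]
  from stable obtain d where d: "\<And>n e h. h \<in> H (n + d n) \<Longrightarrow>
     \<exists>h'\<in>H (n + (d n + e)). E n (descend f n (d n) h) (descend f n (d n + e) h')" by metis
  define stable_image where
    "stable_image n = {y \<in> H n. \<forall>e. \<exists>h\<in>H (n + e). E n y (descend f n e h)}" for n
  have descend_stable: "descend f n (d n) h \<in> stable_image n" if h: "h \<in> H (n + d n)" for n h
  proof -
    have "\<exists>h'\<in>H (n + e). E n (descend f n (d n) h) (descend f n e h')" for e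
    proof (cases "e \<le> d n")
      case True
      then obtain c where c: "d n = e + c" using le_Suc_ex by blast
      have "descend f (n + e) c h \<in> H (n + e)" using closed h c by (metis add.assoc)
      moreover have "E n (descend f n (d n) h) (descend f n (d n) h)" using refl closed h by metis
      ultimately show ?thesis unfolding c descend_add by blast
    next
      case False
      then obtain c where "e = d n + c" using le_Suc_ex nle_le by metis
      then show ?thesis using d[OF h, of c] by simp
    qed
    then show ?thesis using closed h by (auto simp: stable_image_def)
  qed
  have lift: "\<exists>y'. y' \<in> stable_image (Suc n) \<and> E n y (f n y')" if y: "y \<in> stable_image n" for n y
  proof -
    obtain h where h: "h \<in> H (n + Suc (d (Suc n)))" "E n y (descend f n (Suc (d (Suc n))) h)"
      using y unfolding stable_image_def by blast
    have "descend f (Suc n) (d (Suc n)) h \<in> stable_image (Suc n)" using descend_stable h(1) by simp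
    with h(2) show ?thesis unfolding descend_Suc by blast
  qed
  have "\<exists>y. y \<in> stable_image 0" using descend_stable nonempty by blast
  from dependent_nat_choice[of "\<lambda>n y. y \<in> stable_image n" "\<lambda>n y y'. E n y (f n y')", OF this lift]
  show ?thesis unfolding stable_image_def by blast
qed

lemma (in cring) submodule_ideal_coordinates:
  assumes "ideal J R"
  shows "submodule {v \<in> carrier (free_module R K). \<forall>i. v i \<in> J} R (free_module R K)"
proof -
  interpret J: ideal J R by (rule assms)
  interpret Free: module R "free_module R K" by (rule free_module)
  show ?thesis
  proof (rule Free.submoduleI)
    show "\<ominus>\<^bsub>free_module R K\<^esub> v \<in> {v \<in> carrier (free_module R K). \<forall>i. v i \<in> J}"
      if "v \<in> {v \<in> carrier (free_module R K). \<forall>i. v i \<in> J}" for v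
      using that linear_map.minus[OF coordinate_linear_map, of v K] by (simp del: free_module_simps)
  qed (use Free.zero_closed Free.a_closed Free.smult_closed in \<open>simp_all add: J.I_l_closed\<close>)
qed

context telescope
begin

text \<open>If all coordinates satisfy such relations with \<open>s \<in> G\<close>, the dual of the telescope becomes a
  Mittag-Leffler system modulo \<open>p\<close> once \<open>G\<close> is inverted.\<close>

definition coordinate_relation :: "'a set \<Rightarrow> nat \<Rightarrow> nat \<Rightarrow> nat \<Rightarrow> 'i \<Rightarrow> 'a \<Rightarrow> ('i \<Rightarrow> 'a) \<Rightarrow> bool" where
  "coordinate_relation p n d e i s u \<longleftrightarrow> (\<forall>v\<in>carrier (level n).
     s \<otimes> transition n d v i \<ominus> (\<Oplus>j\<in>I (n + (d + e)). u j \<otimes> transition n (d + e) v j) \<in> p)"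

definition mittag_leffler_mod :: "'a set \<Rightarrow> 'a set \<Rightarrow> bool" where
  "mittag_leffler_mod p G \<longleftrightarrow> (\<forall>n. \<exists>d. \<forall>e. \<forall>i\<in>I (n + d).
     \<exists>s\<in>G. \<exists>u\<in>I (n + (d + e)) \<rightarrow> carrier R. coordinate_relation p n d e i s u)"

lemma step_ideal_coordinates:
  assumes J: "ideal J R" and v: "v \<in> carrier (level n)" and vJ: "\<And>i. v i \<in> J"
  shows "step n v j \<in> J"
proof -
  interpret J: ideal J R by (rule J)
  interpret L: module R "level (Suc n)" by (rule free_module)
  have "step n v \<in> {w \<in> carrier (level (Suc n)). \<forall>j. w j \<in> J}"
    unfolding step_def
  proof (rule L.lin_ext_mem_submodule[OF submodule_ideal_coordinates[OF J]])
    fix i assume "v i \<noteq> \<zero>"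
    then have "i \<in> I n" using free_moduleD(3)[OF v] by blast
    then have A: "A n i \<in> carrier (level (Suc n))" by (rule matrix_closed)
    then show "v i \<odot>\<^bsub>level (Suc n)\<^esub> A n i \<in> {w \<in> carrier (level (Suc n)). \<forall>j. w j \<in> J}"
      using L.smult_closed[OF J.a_Hcarr[OF vJ] A] free_moduleD(1)[OF A] vJ by (simp add: J.I_r_closed)
  qed
  then show ?thesis by simp
qed

lemma mittag_leffler_mod_prime:
  assumes noeth: "noetherian_ring R" and p: "primeideal p R"
  shows "mittag_leffler_mod p (carrier R - p)"
  unfolding mittag_leffler_mod_def
proof
  fix n
  interpret p: primeideal p R by (rule p)
  let ?pL = "\<lambda>m. {v \<in> carrier (level m). \<forall>j. v j \<in> p}"
  define V where "V d = {v \<in> carrier (level n). transition n d v \<in> ?pL (n + d)}" for d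
  have "submodule (V d) R (level n)" for d
    unfolding V_def
    by (rule linear_map.submodule_vimage[OF transition_linear_map
          submodule_ideal_coordinates[OF p.is_ideal]])
  moreover have "V d \<subseteq> V (Suc d)" for d
    using step_ideal_coordinates[OF p.is_ideal] by (auto simp: V_def)
  ultimately obtain d where d: "\<And>e. V (d + e) = V d"
    using noetherian_module_chain_stabilises[OF noetherian_free_module[OF noeth finite_index]] by blast
  have coordinate_hom: "(\<lambda>v. transition n m v j) \<in> lin_hom R (level n) (regular_module R)" for m j
    by (rule lin_hom_compose[OF linear_map.lin_hom[OF transition_linear_map]
          linear_map.lin_hom[OF coordinate_linear_map]])
  have "\<exists>s\<in>carrier R - p. \<exists>u\<in>I (n + (d + e)) \<rightarrow> carrier R. coordinate_relation p n d e i s u" for e i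
    unfolding coordinate_relation_def
  proof (rule functional_combination_mod_prime[OF p free_module finite_index coordinate_hom
        coordinate_hom])
    fix v assume v: "v \<in> carrier (level n)" and "\<forall>j\<in>I (n + (d + e)). transition n (d + e) v j \<in> p"
    then have "transition n (d + e) v j \<in> p" for j
      using free_moduleD(3)[OF transition_closed[OF v], of j "d + e"]
      by (cases "j \<in> I (n + (d + e))") (auto simp: p.zero_closed)
    then have "v \<in> V (d + e)" using v by (simp add: V_def)
    then show "transition n d v i \<in> p" unfolding d by (simp add: V_def)
  qed
  then show "\<exists>d. \<forall>e. \<forall>i\<in>I (n + d). \<exists>s\<in>carrier R - p. \<exists>u\<in>I (n + (d + e)) \<rightarrow> carrier R.
      coordinate_relation p n d e i s u"
    by blast
qed

lemma mittag_leffler_mod_countable_subset: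
  assumes "mittag_leffler_mod p G"
  shows "\<exists>H\<subseteq>G. countable H \<and> mittag_leffler_mod p H"
proof -
  let ?related = "\<lambda>n d e i s. \<exists>u\<in>I (n + (d + e)) \<rightarrow> carrier R. coordinate_relation p n d e i s u"
  obtain d where d: "\<And>n e i. i \<in> I (n + d n) \<Longrightarrow> \<exists>s\<in>G. ?related n (d n) e i s"
    using assms unfolding mittag_leffler_mod_def by metis
  define s where "s n e i = (SOME s. s \<in> G \<and> ?related n (d n) e i s)" for n e i
  have s: "s n e i \<in> G \<and> ?related n (d n) e i (s n e i)" if "i \<in> I (n + d n)" for n e i
    unfolding s_def by (rule someI_ex) (use d[OF that] in blast)
  define H where "H = (\<Union>n e. s n e ` I (n + d n))"
  have "H \<subseteq> G" using s by (auto simp: H_def)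
  moreover have "countable H"
    unfolding H_def
    by (intro countable_UN countableI_type countable_image countable_finite[OF finite_index])
  moreover have "\<exists>s'\<in>H. ?related n (d n) e i s'" if i: "i \<in> I (n + d n)" for n e i
  proof
    show "?related n (d n) e i (s n e i)" using s[OF i] by blast
    show "s n e i \<in> H" using i by (auto simp: H_def)
  qed
  then have "mittag_leffler_mod p H" unfolding mittag_leffler_mod_def by blast
  ultimately show ?thesis by blast
qed

end

locale telescope_cong = telescope_module R I A M + module_submodule R M N
  for R (structure) and I :: "nat \<Rightarrow> 'i set" and A
    and M :: "('a, 'm, 'e) module_scheme" (structure) and N
begin

definition pullback :: "nat \<Rightarrow> ('i \<Rightarrow> 'm) \<Rightarrow> 'i \<Rightarrow> 'm" where
  "pullback n h i = lin_ext R M h (A n i)"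

lemma pullback_closed: "h \<in> I (Suc n) \<rightarrow> carrier M \<Longrightarrow> pullback n h \<in> I n \<rightarrow> carrier M"
  unfolding pullback_def using lin_ext_closed[OF matrix_closed] by blast

definition affine :: "(nat \<Rightarrow> 'i \<Rightarrow> 'm) \<Rightarrow> nat \<Rightarrow> ('i \<Rightarrow> 'm) \<Rightarrow> 'i \<Rightarrow> 'm" where
  "affine c n h i = c n i \<oplus>\<^bsub>M\<^esub> pullback n h i"

lemma affine_closed:
  "c \<in> cochains I M \<Longrightarrow> h \<in> I (Suc n) \<rightarrow> carrier M \<Longrightarrow> affine c n h \<in> I n \<rightarrow> carrier M"
  unfolding affine_def using cochain_closed[of c I M] pullback_closed[of h n] by (auto simp: Pi_iff)

lemma descend_affine_closed:
  assumes "c \<in> cochains I M" "h \<in> I (n + d) \<rightarrow> carrier M"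
  shows "descend (affine c) n d h \<in> I n \<rightarrow> carrier M"
  by (rule descend_closed[of "\<lambda>n. I n \<rightarrow> carrier M" "affine c"])
    (fact affine_closed[OF assms(1)], fact assms(2))

lemma descend_affine_diff:
  assumes c: "c \<in> cochains I M" and i: "i \<in> I n"
    and "h \<in> I (n + d) \<rightarrow> carrier M" "h' \<in> I (n + d) \<rightarrow> carrier M"
  shows "descend (affine c) n d h i \<ominus>\<^bsub>M\<^esub> descend (affine c) n d h' i
    = lin_ext R M (\<lambda>j. h j \<ominus>\<^bsub>M\<^esub> h' j) (transition n d (unit_vec R i))"
  using assms(3,4)
proof (induction d arbitrary: h h')
  case 0
  then show ?case using i by (auto simp: Pi_iff)
next
  case (Suc d)
  let ?v = "transition n d (unit_vec R i)"
  have h: "h \<in> I (Suc (n + d)) \<rightarrow> carrier M" "h' \<in> I (Suc (n + d)) \<rightarrow> carrier M"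
    using Suc.prems by simp_all
  then have diff_Pi: "(\<lambda>j. h j \<ominus>\<^bsub>M\<^esub> h' j) \<in> I (Suc (n + d)) \<rightarrow> carrier M" by auto
  have v: "?v \<in> carrier (level (n + d))" using i by simp
  have aff: "affine c (n + d) h j \<ominus>\<^bsub>M\<^esub> affine c (n + d) h' j
      = lin_ext R M (\<lambda>j. h j \<ominus>\<^bsub>M\<^esub> h' j) (A (n + d) j)" if j: "j \<in> I (n + d)" for j
  proof -
    note closed = cochain_closed[OF c j] lin_ext_closed[OF matrix_closed[OF j] h(1)]
      lin_ext_closed[OF matrix_closed[OF j] h(2)]
    then show ?thesis
      using lin_ext_diff[OF matrix_closed[OF j] h]
      by (simp add: affine_def pullback_def M.add_diff_add M.diff_eq_zero_iff[THEN iffD2])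
  qed
  have "descend (affine c) n (Suc d) h i \<ominus>\<^bsub>M\<^esub> descend (affine c) n (Suc d) h' i
      = lin_ext R M (\<lambda>j. affine c (n + d) h j \<ominus>\<^bsub>M\<^esub> affine c (n + d) h' j) ?v"
    unfolding descend.simps by (rule Suc.IH[OF affine_closed[OF c h(1)] affine_closed[OF c h(2)]])
  also have "\<dots> = lin_ext R M (\<lambda>j. lin_ext R M (\<lambda>j. h j \<ominus>\<^bsub>M\<^esub> h' j) (A (n + d) j)) ?v"
    by (rule lin_ext_cong[OF v]) (use aff lin_ext_closed[OF matrix_closed diff_Pi] in auto)
  also have "\<dots> = lin_ext R M (\<lambda>j. h j \<ominus>\<^bsub>M\<^esub> h' j) (transition n (Suc d) (unit_vec R i))"
    using lin_ext_step[OF v diff_Pi] by simp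
  finally show ?case .
qed

context
  fixes p G
  assumes pN: "\<And>a m. \<lbrakk>a \<in> p; m \<in> carrier M\<rbrakk> \<Longrightarrow> a \<odot>\<^bsub>M\<^esub> m \<in> N"
    and G: "G \<subseteq> carrier R"
    and divisible: "\<And>s z. \<lbrakk>s \<in> G; z \<in> carrier M\<rbrakk> \<Longrightarrow> \<exists>w\<in>carrier M. z \<asymp> s \<odot>\<^bsub>M\<^esub> w"
begin

lemma lin_ext_coordinate_relations:
  assumes s: "\<And>i. s i \<in> carrier R"
    and u: "\<And>i. i \<in> I (n + d) \<Longrightarrow> u i \<in> I (n + (d + e)) \<rightarrow> carrier R"
    and rel: "\<And>i. i \<in> I (n + d) \<Longrightarrow> coordinate_relation p n d e i (s i) (u i)"
    and w: "w \<in> I (n + d) \<rightarrow> carrier M"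
  shows "\<exists>h\<in>I (n + (d + e)) \<rightarrow> carrier M. \<forall>v\<in>carrier (level n).
    lin_ext R M (\<lambda>i. s i \<odot>\<^bsub>M\<^esub> w i) (transition n d v) \<asymp> lin_ext R M h (transition n (d + e) v)"
proof
  let ?J = "I (n + d)" and ?K = "I (n + (d + e))"
  define U where "U j = (\<lambda>i. if i \<in> ?J \<and> j \<in> ?K then u i j else \<zero>)" for j
  have U: "U j \<in> carrier (level (n + d))" for j
    by (rule finite_free_moduleI) (use u in \<open>auto simp: U_def Pi_iff\<close>)
  interpret L: module R "level (n + d)" by (rule free_module)
  let ?h = "\<lambda>j. lin_ext R M w (U j)"
  show "?h \<in> ?K \<rightarrow> carrier M" using lin_ext_closed[OF U w] by blast
  show "\<forall>v\<in>carrier (level n).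
    lin_ext R M (\<lambda>i. s i \<odot>\<^bsub>M\<^esub> w i) (transition n d v) \<asymp> lin_ext R M ?h (transition n (d + e) v)"
  proof
    fix v assume v: "v \<in> carrier (level n)"
    let ?v = "transition n d v" and ?v' = "transition n (d + e) v"
    let ?Uv' = "lin_ext R (level (n + d)) U ?v'"
    have v_closed: "?v \<in> carrier (level (n + d))" "?v' \<in> carrier (level (n + (d + e)))"
      using v by simp_all
    have Uv': "?Uv' \<in> carrier (level (n + d))"
      using U by (intro L.lin_ext_closed[OF v_closed(2)]) auto
    have sv: "(\<lambda>i. s i \<otimes> ?v i) \<in> carrier (level (n + d))"
      by (rule finite_free_moduleI) (use s free_moduleD[OF v_closed(1)] in auto)
    have Uv'_apply: "?Uv' i = (\<Oplus>j\<in>?K. u i j \<otimes> ?v' j)" if i: "i \<in> ?J" for i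
      unfolding lin_ext_free_module_apply[OF v_closed(2) U finite_index]
      using u[OF i] free_moduleD(1)[OF v_closed(2)] i
      by (intro R.finsum_cong') (auto simp: U_def m_comm Pi_iff)
    have "lin_ext R M (\<lambda>i. s i \<odot>\<^bsub>M\<^esub> w i) ?v = lin_ext R M w (\<lambda>i. s i \<otimes> ?v i)"
      by (rule lin_ext_scale[OF v_closed(1) s w])
    also have "\<dots> \<asymp> lin_ext R M w ?Uv'"
    proof (rule cong_lin_ext_coeffs[OF sv Uv' w])
      fix i m assume "i \<in> ?J" "m \<in> carrier M"
      then show "(s i \<otimes> ?v i \<ominus> ?Uv' i) \<odot>\<^bsub>M\<^esub> m \<in> N"
        using pN[OF bspec[OF rel[unfolded coordinate_relation_def] v]] by (simp add: Uv'_apply)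
    qed
    also have "\<dots> = lin_ext R M ?h ?v'"
      by (rule linear_map.lin_ext_image[OF lin_ext_linear_map[OF w] v_closed(2)]) (use U in auto)
    finally show "lin_ext R M (\<lambda>i. s i \<odot>\<^bsub>M\<^esub> w i) ?v \<asymp> lin_ext R M ?h ?v'" .
  qed
qed

lemma pullback_stable:
  assumes rel: "\<And>i. i \<in> I (n + d) \<Longrightarrow>
      \<exists>s\<in>G. \<exists>u\<in>I (n + (d + e)) \<rightarrow> carrier R. coordinate_relation p n d e i s u"
    and h: "h \<in> I (n + d) \<rightarrow> carrier M"
  shows "\<exists>h'\<in>I (n + (d + e)) \<rightarrow> carrier M. \<forall>v\<in>carrier (level n).
    lin_ext R M h (transition n d v) \<asymp> lin_ext R M h' (transition n (d + e) v)"
proof -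
  let ?J = "I (n + d)" and ?K = "I (n + (d + e))"
  obtain s' u where s': "\<And>i. i \<in> ?J \<Longrightarrow> s' i \<in> G" and u: "\<And>i. i \<in> ?J \<Longrightarrow> u i \<in> ?K \<rightarrow> carrier R"
    and s'u: "\<And>i. i \<in> ?J \<Longrightarrow> coordinate_relation p n d e i (s' i) (u i)"
    using rel by metis
  define s where "s i = (if i \<in> ?J then s' i else \<zero>)" for i
  have s: "s i \<in> carrier R" for i using s' G by (auto simp: s_def)
  have su: "coordinate_relation p n d e i (s i) (u i)" if "i \<in> ?J" for i
    using s'u[OF that] that by (simp add: s_def)
  have "\<exists>w\<in>carrier M. h i \<asymp> s i \<odot>\<^bsub>M\<^esub> w" if "i \<in> ?J" for i
    using divisible[OF s'[OF that] funcset_mem[OF h that]] that by (simp add: s_def)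
  then obtain w where w: "w \<in> ?J \<rightarrow> carrier M" and hw: "\<And>i. i \<in> ?J \<Longrightarrow> h i \<asymp> s i \<odot>\<^bsub>M\<^esub> w i"
    unfolding Pi_iff by metis
  obtain h' where "h' \<in> ?K \<rightarrow> carrier M" and h': "\<And>v. v \<in> carrier (level n) \<Longrightarrow>
      lin_ext R M (\<lambda>i. s i \<odot>\<^bsub>M\<^esub> w i) (transition n d v) \<asymp> lin_ext R M h' (transition n (d + e) v)"
    using lin_ext_coordinate_relations[OF s u su w] by blast
  moreover have "lin_ext R M h (transition n d v) \<asymp> lin_ext R M h' (transition n (d + e) v)"
    if "v \<in> carrier (level n)" for v
    by (rule cong_trans[OF cong_lin_ext[OF transition_closed[OF that] hw] h'[OF that]])
  ultimately show ?thesis by blast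
qed

lemma descend_affine_stable:
  assumes c: "c \<in> cochains I M"
    and rel: "\<And>i. i \<in> I (n + d) \<Longrightarrow>
      \<exists>s\<in>G. \<exists>u\<in>I (n + (d + e)) \<rightarrow> carrier R. coordinate_relation p n d e i s u"
    and h: "h \<in> I (n + d) \<rightarrow> carrier M"
  shows "\<exists>h'\<in>I (n + (d + e)) \<rightarrow> carrier M. \<forall>i\<in>I n.
    descend (affine c) n d h i \<asymp> descend (affine c) n (d + e) h' i"
proof -
  let ?zero = "\<lambda>i. \<zero>\<^bsub>M\<^esub>"
  define q where "q = descend (affine c) (n + d) e ?zero"
  have q: "q \<in> I (n + d) \<rightarrow> carrier M" unfolding q_def by (rule descend_affine_closed[OF c]) simp
  then have hq: "(\<lambda>i. h i \<ominus>\<^bsub>M\<^esub> q i) \<in> I (n + d) \<rightarrow> carrier M" using h by auto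
  obtain h' where h': "h' \<in> I (n + (d + e)) \<rightarrow> carrier M"
    and stable: "\<And>v. v \<in> carrier (level n) \<Longrightarrow>
      lin_ext R M (\<lambda>i. h i \<ominus>\<^bsub>M\<^esub> q i) (transition n d v) \<asymp> lin_ext R M h' (transition n (d + e) v)"
    using pullback_stable[OF rel hq] by blast
  have "descend (affine c) n d h i \<asymp> descend (affine c) n (d + e) h' i" if i: "i \<in> I n" for i
  proof -
    let ?b = "descend (affine c) n d q i"
    have closed: "?b \<in> carrier M" "descend (affine c) n d h i \<in> carrier M"
      "descend (affine c) n (d + e) h' i \<in> carrier M"
      using descend_affine_closed[OF c q] descend_affine_closed[OF c h]
        descend_affine_closed[OF c h'] i by auto
    have b: "?b = descend (affine c) n (d + e) ?zero i" by (simp add: q_def descend_add)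
    have "descend (affine c) n d h i \<ominus>\<^bsub>M\<^esub> ?b
        = lin_ext R M (\<lambda>i. h i \<ominus>\<^bsub>M\<^esub> q i) (transition n d (unit_vec R i))"
      by (rule descend_affine_diff[OF c i h q])
    also have "\<dots> \<asymp> lin_ext R M h' (transition n (d + e) (unit_vec R i))"
      using i by (intro stable) simp
    also have "\<dots> = lin_ext R M (\<lambda>j. h' j \<ominus>\<^bsub>M\<^esub> ?zero j) (transition n (d + e) (unit_vec R i))"
      using h' i by (intro lin_ext_cong[where I = "I (n + (d + e))"]) (auto simp: M.diff_zero Pi_iff)
    also have "\<dots> = descend (affine c) n (d + e) h' i \<ominus>\<^bsub>M\<^esub> ?b"
      unfolding b by (rule descend_affine_diff[OF c i h', symmetric]) simp
    finally have "(descend (affine c) n d h i \<ominus>\<^bsub>M\<^esub> ?b) \<oplus>\<^bsub>M\<^esub> ?b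
        \<asymp> (descend (affine c) n (d + e) h' i \<ominus>\<^bsub>M\<^esub> ?b) \<oplus>\<^bsub>M\<^esub> ?b"
      using closed by (intro cong_add) auto
    then show ?thesis using closed by (simp add: M.diff_add_cancel)
  qed
  with h' show ?thesis by blast
qed

lemma lim1_vanishes_mod_if_divisible:
  assumes ml: "mittag_leffler_mod p G"
  shows "lim1_vanishes_mod R I A M N"
  unfolding lim1_vanishes_mod_def
proof
  fix c assume c: "c \<in> cochains I M"
  let ?H = "\<lambda>n. I n \<rightarrow> carrier M" and ?E = "\<lambda>n h h'. \<forall>i\<in>I n. h i \<asymp> h' i"
  have "\<exists>y. \<forall>n. y n \<in> ?H n \<and> ?E n (y n) (affine c n (y (Suc n)))"
  proof (rule mittag_leffler)
    show "affine c n h \<in> ?H n" if "h \<in> ?H (Suc n)" for n h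
      by (rule affine_closed[OF c that])
    show "?E n h h" if "h \<in> ?H n" for n h using that by (auto simp: Pi_iff)
    show "?H n \<noteq> {}" for n by (metis M.zero_closed Pi_I empty_iff)
    fix n
    obtain d where "\<And>e i. i \<in> I (n + d) \<Longrightarrow>
        \<exists>s\<in>G. \<exists>u\<in>I (n + (d + e)) \<rightarrow> carrier R. coordinate_relation p n d e i s u"
      using ml unfolding mittag_leffler_mod_def by metis
    from descend_affine_stable[OF c this]
    show "\<exists>d. \<forall>e. \<forall>h\<in>?H (n + d). \<exists>h'\<in>?H (n + (d + e)).
        ?E n (descend (affine c) n d h) (descend (affine c) n (d + e) h')"
      by blast
  qed
  then obtain y where y: "y \<in> cochains I M" and yc: "\<And>n i. i \<in> I n \<Longrightarrow> y n i \<asymp> affine c n (y (Suc n)) i"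
    by (auto simp: cochains_def)
  have "c n i \<ominus>\<^bsub>M\<^esub> coboundary R A M y n i \<in> N" if i: "i \<in> I n" for n i
  proof -
    let ?b = "pullback n (y (Suc n)) i"
    have b: "?b \<in> carrier M" using pullback_closed[OF cochainsD[OF y]] i by auto
    have "coboundary R A M y n i \<asymp> (c n i \<oplus>\<^bsub>M\<^esub> ?b) \<ominus>\<^bsub>M\<^esub> ?b"
      using cong_diff[OF yc[OF i] cong_refl[OF b]] by (simp add: affine_def pullback_def coboundary_def)
    also have "\<dots> = c n i" by (rule M.add_diff_cancel[OF cochain_closed[OF c i] b])
    finally have "c n i \<asymp> coboundary R A M y n i" by (rule cong_sym)
    then show ?thesis by (simp add: cong_def)
  qed
  with y show "\<exists>x\<in>cochains I M. \<forall>n. \<forall>i\<in>I n. c n i \<ominus>\<^bsub>M\<^esub> coboundary R A M x n i \<in> N" by blast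
qed

end

end

section \<open>Modules of functions and towers\<close>

definition power_module :: "('r, 'm, 'e) module_scheme \<Rightarrow> ('r, 'j \<Rightarrow> 'm) module" where
  "power_module M =
     \<lparr>carrier = {z. \<forall>j. z j \<in> carrier M}, monoid.mult = (\<lambda>_ _. undefined), one = undefined,
      ring.zero = (\<lambda>_. \<zero>\<^bsub>M\<^esub>), ring.add = (\<lambda>z w j. z j \<oplus>\<^bsub>M\<^esub> w j),
      module.smult = (\<lambda>a z j. a \<odot>\<^bsub>M\<^esub> z j)\<rparr>"

lemma power_module_simps [simp]:
  "carrier (power_module M) = {z. \<forall>j. z j \<in> carrier M}"
  "\<zero>\<^bsub>power_module M\<^esub> = (\<lambda>j. \<zero>\<^bsub>M\<^esub>)"
  "z \<oplus>\<^bsub>power_module M\<^esub> w = (\<lambda>j. z j \<oplus>\<^bsub>M\<^esub> w j)"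
  "a \<odot>\<^bsub>power_module M\<^esub> z = (\<lambda>j. a \<odot>\<^bsub>M\<^esub> z j)"
  by (simp_all add: power_module_def)

context module
begin

lemma power_module: "module R (power_module M)"
proof (rule moduleI)
  show "abelian_group (power_module M)"
  proof (rule abelian_groupI)
    show "\<exists>w\<in>carrier (power_module M). w \<oplus>\<^bsub>power_module M\<^esub> z = \<zero>\<^bsub>power_module M\<^esub>"
      if "z \<in> carrier (power_module M)" for z
      using that by (intro bexI[of _ "\<lambda>j. \<ominus>\<^bsub>M\<^esub> z j"]) (simp_all add: M.l_neg)
  qed (simp_all add: M.a_ac)
qed (simp_all add: R.is_cring smult_l_distr smult_r_distr smult_assoc1)

lemma evaluation_linear_map: "linear_map R (power_module M) M (\<lambda>z. z j)"
  by (intro linear_mapI power_module module_axioms lin_homI) simp_all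

end

context module_submodule
begin

definition towers :: "(nat \<Rightarrow> 'a) \<Rightarrow> (nat \<Rightarrow> 'c) set" where
  "towers t = {z. \<forall>j. z j \<in> carrier M \<and> z j \<asymp> t j \<odot>\<^bsub>M\<^esub> z (Suc j)}"

abbreviation tower_module :: "(nat \<Rightarrow> 'a) \<Rightarrow> ('a, nat \<Rightarrow> 'c) module" where
  "tower_module t \<equiv> (power_module M)\<lparr>carrier := towers t\<rparr>"

definition null_towers :: "(nat \<Rightarrow> 'a) \<Rightarrow> (nat \<Rightarrow> 'c) set" where
  "null_towers t = {z \<in> towers t. \<forall>j. z j \<in> N}"

lemma towersD: "z \<in> towers t \<Longrightarrow> z j \<in> carrier M" "z \<in> towers t \<Longrightarrow> z j \<asymp> t j \<odot>\<^bsub>M\<^esub> z (Suc j)"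
  by (simp_all add: towers_def)

lemma submodule_towers:
  assumes t: "\<And>j. t j \<in> carrier R"
  shows "submodule (towers t) R (power_module M)"
proof -
  interpret P: module R "power_module M :: ('a, nat \<Rightarrow> 'c) module" by (rule power_module)
  have smult: "a \<odot>\<^bsub>power_module M\<^esub> z \<in> towers t" if "a \<in> carrier R" "z \<in> towers t" for a z
    using that cong_smult[OF that(1) towersD(2)[OF that(2)]] towersD(1)[OF that(2)] t
    by (simp add: towers_def smult_lcomm[of a])
  show ?thesis
  proof (rule P.submoduleI)
    show "\<ominus>\<^bsub>power_module M\<^esub> z \<in> towers t" if z: "z \<in> towers t" for z
    proof -
      have "z \<in> carrier (power_module M)" using towersD(1)[OF z] by simp
      then have "\<ominus>\<^bsub>power_module M\<^esub> z = (\<ominus> \<one>) \<odot>\<^bsub>power_module M\<^esub> z"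
        using P.smult_l_minus[of \<one> z] P.smult_one[of z] by (metis R.one_closed)
      then show ?thesis using smult[OF _ z, of "\<ominus> \<one>"] by simp
    qed
    show "z \<oplus>\<^bsub>power_module M\<^esub> w \<in> towers t" if "z \<in> towers t" "w \<in> towers t" for z w
      using cong_add[OF towersD(2)[OF that(1)] towersD(2)[OF that(2)]] t
        towersD(1)[OF that(1)] towersD(1)[OF that(2)]
      by (simp add: towers_def smult_r_distr)
  qed (use smult t in \<open>auto simp: towers_def\<close>)
qed

lemma tower_evaluation_linear_map:
  "(\<And>j. t j \<in> carrier R) \<Longrightarrow> linear_map R (tower_module t) M (\<lambda>z. z j)"
  by (intro linear_map.restrict[OF evaluation_linear_map] submodule_towers)

lemma submodule_null_towers:
  assumes t: "\<And>j. t j \<in> carrier R"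
  shows "submodule (null_towers t) R (tower_module t)"
proof -
  note eval = tower_evaluation_linear_map[OF t]
  interpret T: module R "tower_module t" by (rule linear_map.axioms(1)[OF eval])
  show ?thesis
  proof (rule T.submoduleI)
    show "\<ominus>\<^bsub>tower_module t\<^esub> z \<in> null_towers t" if "z \<in> null_towers t" for z
      using that T.M.a_inv_closed[of z] linear_map.minus[OF eval, of z]
      by (simp add: null_towers_def submoduleE(3)[OF submodule])
    show "z \<oplus>\<^bsub>tower_module t\<^esub> w \<in> null_towers t" if "z \<in> null_towers t" "w \<in> null_towers t" for z w
      using that T.M.a_closed[of z w]
      by (simp add: null_towers_def submoduleE(5)[OF submodule])
    show "a \<odot>\<^bsub>tower_module t\<^esub> z \<in> null_towers t" if "a \<in> carrier R" "z \<in> null_towers t" for a z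
      using that T.smult_closed[of a z]
      by (simp add: null_towers_def submoduleE(4)[OF submodule])
  qed (use T.M.zero_closed in \<open>auto simp: null_towers_def submodule_zero[OF submodule]\<close>)
qed

lemma tower_cong_iff:
  assumes t: "\<And>j. t j \<in> carrier R" and "z \<in> towers t" "w \<in> towers t"
  shows "z \<ominus>\<^bsub>tower_module t\<^esub> w \<in> null_towers t \<longleftrightarrow> (\<forall>j. z j \<asymp> w j)"
proof -
  note eval = tower_evaluation_linear_map[OF t]
  interpret T: module R "tower_module t" by (rule linear_map.axioms(1)[OF eval])
  have "z \<ominus>\<^bsub>tower_module t\<^esub> w \<in> towers t" using T.M.minus_closed[of z w] assms(2,3) by simp
  moreover have "(z \<ominus>\<^bsub>tower_module t\<^esub> w) j = z j \<ominus>\<^bsub>M\<^esub> w j" for j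
    by (rule linear_map.diff[OF eval]) (use assms(2,3) in simp_all)
  ultimately show ?thesis
    using assms(2,3) by (simp add: null_towers_def cong_def towersD(1))
qed

lemma tower_divisible_if_eventually:
  assumes t: "\<And>j. t j \<in> carrier R" and g: "g \<in> carrier R" and z: "z \<in> towers t"
    and "\<And>j. w j \<in> carrier M" "\<And>j. j \<ge> l \<Longrightarrow> w j \<asymp> t j \<odot>\<^bsub>M\<^esub> w (Suc j) \<and> z j \<asymp> g \<odot>\<^bsub>M\<^esub> w j"
  shows "\<exists>w\<in>towers t. \<forall>j. z j \<asymp> g \<odot>\<^bsub>M\<^esub> w j"
  using assms(4,5)
proof (induction l arbitrary: w)
  case 0
  then show ?case unfolding towers_def by blast
next
  case (Suc l)
  define w' where "w' = w(l := t l \<odot>\<^bsub>M\<^esub> w (Suc l))"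
  have w': "w' j \<in> carrier M" for j using Suc.prems(1) t by (simp add: w'_def)
  have "z l \<asymp> t l \<odot>\<^bsub>M\<^esub> z (Suc l)" by (rule towersD(2)[OF z])
  also have "t l \<odot>\<^bsub>M\<^esub> z (Suc l) \<asymp> t l \<odot>\<^bsub>M\<^esub> (g \<odot>\<^bsub>M\<^esub> w (Suc l))"
    using Suc.prems(2) t by (intro cong_smult) auto
  also have "t l \<odot>\<^bsub>M\<^esub> (g \<odot>\<^bsub>M\<^esub> w (Suc l)) = g \<odot>\<^bsub>M\<^esub> w' l"
    using t g Suc.prems(1) by (simp add: w'_def smult_lcomm)
  finally have zl: "z l \<asymp> g \<odot>\<^bsub>M\<^esub> w' l" .
  have wl: "w' l \<asymp> t l \<odot>\<^bsub>M\<^esub> w' (Suc l)"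
    using Suc.prems(1) t by (simp add: w'_def)
  have "w' j \<asymp> t j \<odot>\<^bsub>M\<^esub> w' (Suc j) \<and> z j \<asymp> g \<odot>\<^bsub>M\<^esub> w' j" if "j \<ge> l" for j
  proof (cases "j = l")
    case False
    then have "j \<ge> Suc l" using that by simp
    then show ?thesis using Suc.prems(2) by (auto simp: w'_def)
  qed (use zl wl in auto)
  then show ?case by (rule Suc.IH[OF w'])
qed

lemma tower_divisible:
  assumes t: "\<And>j. t j \<in> carrier R" and g: "g \<in> carrier R"
    and "\<And>j. j \<ge> l \<Longrightarrow> \<exists>h\<in>carrier R. t j = g \<otimes> h" and z: "z \<in> towers t"
  shows "\<exists>w\<in>towers t. \<forall>j. z j \<asymp> g \<odot>\<^bsub>M\<^esub> w j"
proof -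
  have "\<exists>h. \<forall>j. h j \<in> carrier R \<and> (j \<ge> l \<longrightarrow> t j = g \<otimes> h j)"
    by (intro choice) (metis assms(3) R.one_closed)
  then obtain h where h: "\<And>j. h j \<in> carrier R" "\<And>j. j \<ge> l \<Longrightarrow> t j = g \<otimes> h j" by blast
  define w where "w j = h j \<odot>\<^bsub>M\<^esub> z (Suc j)" for j
  have w: "w j \<in> carrier M" for j using h(1) towersD(1)[OF z] by (simp add: w_def)
  have "w j \<asymp> t j \<odot>\<^bsub>M\<^esub> w (Suc j) \<and> z j \<asymp> g \<odot>\<^bsub>M\<^esub> w j" if j: "j \<ge> l" for j
  proof
    have "h j \<odot>\<^bsub>M\<^esub> z (Suc j) \<asymp> h j \<odot>\<^bsub>M\<^esub> (t (Suc j) \<odot>\<^bsub>M\<^esub> z (Suc (Suc j)))"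
      using h(1) towersD(2)[OF z] by (intro cong_smult) auto
    also have "h j \<odot>\<^bsub>M\<^esub> (t (Suc j) \<odot>\<^bsub>M\<^esub> z (Suc (Suc j))) = t j \<odot>\<^bsub>M\<^esub> (h (Suc j) \<odot>\<^bsub>M\<^esub> z (Suc (Suc j)))"
      using h(1) g towersD(1)[OF z] h(2)[of j] h(2)[of "Suc j"] j
      by (simp flip: smult_assoc1 add: R.m_ac)
    finally show "w j \<asymp> t j \<odot>\<^bsub>M\<^esub> w (Suc j)" by (simp add: w_def)
    show "z j \<asymp> g \<odot>\<^bsub>M\<^esub> w j"
      using towersD(2)[OF z, of j] h g j towersD(1)[OF z] by (simp add: w_def smult_assoc1)
  qed
  then show ?thesis by (intro tower_divisible_if_eventually[OF t g z w])
qed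

end

context telescope_cong
begin

lemma lim1_vanishes_mod_iff_cong:
  "lim1_vanishes_mod R I A M N \<longleftrightarrow>
     (\<forall>c\<in>cochains I M. \<exists>x\<in>cochains I M. \<forall>n. \<forall>i\<in>I n. c n i \<asymp> coboundary R A M x n i)"
  unfolding lim1_vanishes_mod_def cong_def
  by (intro ball_cong bex_cong all_cong1) (simp_all add: cochain_closed coboundary_closed)

context
  fixes p G and t :: "nat \<Rightarrow> 'a"
  assumes p: "p \<subseteq> carrier R" and pN: "\<And>a m. \<lbrakk>a \<in> p; m \<in> carrier M\<rbrakk> \<Longrightarrow> a \<odot>\<^bsub>M\<^esub> m \<in> N"
    and G: "G \<subseteq> carrier R" and t: "\<And>j. t j \<in> carrier R"
    and divides: "\<And>g. g \<in> G \<Longrightarrow> \<exists>l. \<forall>j\<ge>l. \<exists>h\<in>carrier R. t j = g \<otimes> h"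
begin

lemma tower_telescope_cong: "telescope_cong R I A (tower_module t) (null_towers t)"
  by (intro telescope_cong.intro telescope_module.intro telescope_axioms module_submodule.intro
      module_submodule_axioms.intro submodule_null_towers t
      linear_map.axioms(1)[OF tower_evaluation_linear_map[OF t]])

lemma lim1_vanishes_mod_null_towers:
  assumes ml: "mittag_leffler_mod p G"
  shows "lim1_vanishes_mod R I A (tower_module t) (null_towers t)"
proof -
  interpret T: telescope_cong R I A "tower_module t" "null_towers t" by (rule tower_telescope_cong)
  show ?thesis
  proof (rule T.lim1_vanishes_mod_if_divisible[OF _ G _ ml])
    fix a z assume a: "a \<in> p" and z: "z \<in> carrier (tower_module t)"
    show "a \<odot>\<^bsub>tower_module t\<^esub> z \<in> null_towers t"
      using T.smult_closed[OF subsetD[OF p a] z] pN[OF a] towersD(1)[of z t] z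
      by (simp add: null_towers_def)
  next
    fix g z assume g: "g \<in> G" and "z \<in> carrier (tower_module t)"
    then have z: "z \<in> towers t" by simp
    obtain l where l: "\<And>j. j \<ge> l \<Longrightarrow> \<exists>h\<in>carrier R. t j = g \<otimes> h" using divides[OF g] by blast
    obtain w where w: "w \<in> towers t" "\<And>j. z j \<asymp> g \<odot>\<^bsub>M\<^esub> w j"
      using tower_divisible[OF t subsetD[OF G g] l z] by blast
    have "g \<odot>\<^bsub>tower_module t\<^esub> w \<in> towers t" using T.smult_closed[OF subsetD[OF G g], of w] w(1) by simp
    then have "T.cong z (g \<odot>\<^bsub>tower_module t\<^esub> w)"
      using z w(2) tower_cong_iff[OF t z] by (simp add: T.cong_def)
    then show "\<exists>w\<in>carrier (tower_module t). T.cong z (g \<odot>\<^bsub>tower_module t\<^esub> w)" using w(1) by auto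
  qed
qed

lemma tower_is_coboundary:
  assumes ml: "mittag_leffler_mod p G" and z: "\<And>n i. i \<in> I n \<Longrightarrow> z n i \<in> towers t"
  shows "\<exists>w\<in>cochains I M. \<forall>n. \<forall>i\<in>I n. z n i 0 \<asymp> coboundary R A M w n i"
proof -
  interpret T: telescope_cong R I A "tower_module t" "null_towers t" by (rule tower_telescope_cong)
  have "z \<in> cochains I (tower_module t)" using z by (simp add: cochains_def)
  then obtain w where w: "w \<in> cochains I (tower_module t)"
    and zw: "\<And>n i. i \<in> I n \<Longrightarrow> T.cong (z n i) (coboundary R A (tower_module t) w n i)"
    using lim1_vanishes_mod_null_towers[OF ml] unfolding T.lim1_vanishes_mod_iff_cong by blast
  have "z n i 0 \<asymp> coboundary R A M (\<lambda>n i. w n i 0) n i" if i: "i \<in> I n" for n i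
  proof -
    have "z n i 0 \<asymp> coboundary R A (tower_module t) w n i 0"
      using zw[OF i] by (auto simp: T.cong_def tower_cong_iff[OF t])
    then show ?thesis
      unfolding linear_map.coboundary_image[OF tower_evaluation_linear_map[OF t] telescope_axioms w i] .
  qed
  moreover have "(\<lambda>n i. w n i 0) \<in> cochains I M"
    using w by (auto simp: cochains_def Pi_iff intro: towersD(1))
  ultimately show ?thesis by blast
qed

end

definition lim1_vanishes_up_to :: "'a \<Rightarrow> bool" where
  "lim1_vanishes_up_to a \<longleftrightarrow> (\<forall>c\<in>cochains I M. \<exists>x\<in>cochains I M. \<exists>d\<in>cochains I M.
     \<forall>n. \<forall>i\<in>I n. c n i \<asymp> coboundary R A M x n i \<oplus>\<^bsub>M\<^esub> a \<odot>\<^bsub>M\<^esub> d n i)"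

lemma successive_approximation:
  assumes up_to: "\<And>j. lim1_vanishes_up_to (t j)" and "c \<in> cochains I M"
  obtains r x where "r 0 = c" "\<And>j. r j \<in> cochains I M" "\<And>j. x j \<in> cochains I M"
    "\<And>j n i. i \<in> I n \<Longrightarrow> r j n i \<asymp> coboundary R A M (x j) n i \<oplus>\<^bsub>M\<^esub> t j \<odot>\<^bsub>M\<^esub> r (Suc j) n i"
proof -
  let ?approx = "\<lambda>j r r' x. x \<in> cochains I M \<and>
    (\<forall>n. \<forall>i\<in>I n. r n i \<asymp> coboundary R A M x n i \<oplus>\<^bsub>M\<^esub> t j \<odot>\<^bsub>M\<^esub> r' n i)"
  have "\<exists>r. \<forall>j. (r j \<in> cochains I M \<and> (j = 0 \<longrightarrow> r j = c)) \<and> (\<exists>x. ?approx j (r j) (r (Suc j)) x)"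
  proof (rule dependent_nat_choice)
    show "\<exists>r. r \<in> cochains I M \<and> ((0::nat) = 0 \<longrightarrow> r = c)" using assms(2) by blast
    show "\<exists>r'. (r' \<in> cochains I M \<and> (Suc j = 0 \<longrightarrow> r' = c)) \<and> (\<exists>x. ?approx j r r' x)"
      if "r \<in> cochains I M \<and> (j = 0 \<longrightarrow> r = c)" for r and j :: nat
      using up_to[of j] that unfolding lim1_vanishes_up_to_def by blast
  qed
  then obtain r where r: "r 0 = c" "\<And>j. r j \<in> cochains I M"
    and "\<And>j. \<exists>x. ?approx j (r j) (r (Suc j)) x" by blast
  then obtain x where "\<And>j. ?approx j (r j) (r (Suc j)) (x j)" by metis
  with r show thesis using that[of r x] by blast
qed

lemma remainder_tower:
  assumes t: "\<And>j. t j \<in> carrier R" and r: "\<And>j. r j \<in> cochains I M" and x: "\<And>j. x j \<in> cochains I M"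
    and rx: "\<And>j n i. i \<in> I n \<Longrightarrow> r j n i \<asymp> coboundary R A M (x j) n i \<oplus>\<^bsub>M\<^esub> t j \<odot>\<^bsub>M\<^esub> r (Suc j) n i"
    and y: "\<And>j. y j \<in> cochains I M"
    and yx: "\<And>j n i. i \<in> I n \<Longrightarrow> y j n i = x j n i \<oplus>\<^bsub>M\<^esub> t j \<odot>\<^bsub>M\<^esub> y (Suc j) n i" and i: "i \<in> I n"
  shows "(\<lambda>j. r j n i \<ominus>\<^bsub>M\<^esub> coboundary R A M (y j) n i) \<in> towers t"
proof -
  let ?B = "\<lambda>j. coboundary R A M (y j) n i" and ?X = "\<lambda>j. coboundary R A M (x j) n i"
  note closed = coboundary_closed[OF y i] coboundary_closed[OF x i] cochain_closed[OF r i]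
  have "r j n i \<ominus>\<^bsub>M\<^esub> ?B j \<asymp> t j \<odot>\<^bsub>M\<^esub> (r (Suc j) n i \<ominus>\<^bsub>M\<^esub> ?B (Suc j))" for j
  proof -
    have ty: "(\<lambda>n i. t j \<odot>\<^bsub>M\<^esub> y (Suc j) n i) \<in> cochains I M"
      using t y[of "Suc j"] by (auto simp: cochains_def Pi_iff)
    have "?B j = coboundary R A M (\<lambda>n i. x j n i \<oplus>\<^bsub>M\<^esub> t j \<odot>\<^bsub>M\<^esub> y (Suc j) n i) n i"
      by (rule coboundary_cong[OF _ yx i])
        (use t x[of j] y[of "Suc j"] in \<open>auto simp: cochains_def Pi_iff\<close>)
    then have B: "?B j = ?X j \<oplus>\<^bsub>M\<^esub> t j \<odot>\<^bsub>M\<^esub> ?B (Suc j)"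
      by (simp add: coboundary_add[OF x ty i] coboundary_smult[OF t y i])
    have "r j n i \<ominus>\<^bsub>M\<^esub> ?B j \<asymp> (?X j \<oplus>\<^bsub>M\<^esub> t j \<odot>\<^bsub>M\<^esub> r (Suc j) n i) \<ominus>\<^bsub>M\<^esub> ?B j"
      by (intro cong_diff rx i cong_refl closed)
    also have "\<dots> = t j \<odot>\<^bsub>M\<^esub> (r (Suc j) n i \<ominus>\<^bsub>M\<^esub> ?B (Suc j))"
      unfolding B by (simp add: closed t M.add_diff_add M.diff_eq_zero_iff[THEN iffD2] smult_diff)
    finally show ?thesis .
  qed
  then show ?thesis by (simp add: towers_def closed)
qed

lemma almost_cotorsion_telescope_cochains:
  assumes almost: "almost_cotorsion R M" and g: "mult_subset R (range g)"
    and x: "\<And>j. x j \<in> cochains I M"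
  obtains y where "\<And>j. y j \<in> cochains I M"
    "\<And>j n i. i \<in> I n \<Longrightarrow> y j n i = x j n i \<oplus>\<^bsub>M\<^esub> (\<Otimes>i\<in>{..j::nat}. g i) \<odot>\<^bsub>M\<^esub> y (Suc j) n i"
proof -
  let ?t = "\<lambda>j. \<Otimes>i\<in>{..j::nat}. g i"
  have "range g \<subseteq> carrier R" using g by (simp add: mult_subset_def)
  then have t: "?t j \<in> carrier R" for j by (intro R.finprod_closed) auto
  have "\<exists>z\<in>carrier (power_module M). \<forall>j. z j = x j n i \<oplus>\<^bsub>M\<^esub> ?t j \<odot>\<^bsub>M\<^esub> z (Suc j)"
    if i: "i \<in> I n" for n i
  proof -
    obtain z where z: "\<And>j. z j \<in> carrier M" "\<And>j. x j n i = z j \<ominus>\<^bsub>M\<^esub> ?t j \<odot>\<^bsub>M\<^esub> z (Suc j)"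
      using almost_cotorsion_telescope[OF almost g, of "\<lambda>j. x j n i"] cochain_closed[OF x i] by blast
    then show ?thesis using t by (intro bexI[of _ z]) (simp_all add: M.diff_add_cancel)
  qed
  from cochain_choice[OF this] obtain z where z: "z \<in> cochains I (power_module M)"
    and zx: "\<forall>n. \<forall>i\<in>I n. \<forall>j. z n i j = x j n i \<oplus>\<^bsub>M\<^esub> ?t j \<odot>\<^bsub>M\<^esub> z n i (Suc j)"
    by (rule bexE)
  show thesis
  proof (rule that[of "\<lambda>j n i. z n i j"])
    show "(\<lambda>n i. z n i j) \<in> cochains I M" for j
      using cochain_closed[OF z] by (simp add: cochains_def)
  qed (rule zx[rule_format])
qed

lemma cong_coboundary_add:
  assumes c: "c \<in> cochains I M" and w: "w \<in> cochains I M" and y: "y \<in> cochains I M" and i: "i \<in> I n"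
    and cw: "c n i \<ominus>\<^bsub>M\<^esub> coboundary R A M y n i \<asymp> coboundary R A M w n i"
  shows "c n i \<asymp> coboundary R A M (\<lambda>n i. w n i \<oplus>\<^bsub>M\<^esub> y n i) n i"
  using cong_add[OF cw cong_refl[OF coboundary_closed[OF y i]]]
  by (simp add: coboundary_add[OF w y i] M.diff_add_cancel cochain_closed[OF c i]
    coboundary_closed[OF y i])

lemma lim1_vanishes_mod_if_up_to:
  fixes g :: "nat \<Rightarrow> 'a"
  assumes p: "p \<subseteq> carrier R" and pN: "\<And>a m. \<lbrakk>a \<in> p; m \<in> carrier M\<rbrakk> \<Longrightarrow> a \<odot>\<^bsub>M\<^esub> m \<in> N"
    and g: "mult_subset R (range g)" and G: "G \<subseteq> range g" and ml: "mittag_leffler_mod p G"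
    and up_to: "\<And>a. a \<in> range g \<Longrightarrow> lim1_vanishes_up_to a" and almost: "almost_cotorsion R M"
  shows "lim1_vanishes_mod R I A M N"
  unfolding lim1_vanishes_mod_iff_cong
proof
  interpret g: enumerated_multiplicative_subset R g
    by (intro enumerated_multiplicative_subset.intro enumerated_multiplicative_subset_axioms.intro
        R.is_cring g)
  let ?t = g.prefix_prod
  fix c assume c: "c \<in> cochains I M"
  obtain r x where r: "r 0 = c" "\<And>j. r j \<in> cochains I M" and x: "\<And>j. x j \<in> cochains I M"
    and rx: "\<And>j n i. i \<in> I n \<Longrightarrow>
      r j n i \<asymp> coboundary R A M (x j) n i \<oplus>\<^bsub>M\<^esub> ?t j \<odot>\<^bsub>M\<^esub> r (Suc j) n i"
    by (rule successive_approximation[of ?t, OF up_to[OF g.prefix_prod_mem] c]) (rule that)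
  obtain y where y: "\<And>j. y j \<in> cochains I M"
    and yx: "\<And>j n i. i \<in> I n \<Longrightarrow> y j n i = x j n i \<oplus>\<^bsub>M\<^esub> ?t j \<odot>\<^bsub>M\<^esub> y (Suc j) n i"
    by (rule almost_cotorsion_telescope_cochains[of g x, OF almost g x, folded g.prefix_prod_def])
      (rule that)
  let ?z = "\<lambda>n i j. r j n i \<ominus>\<^bsub>M\<^esub> coboundary R A M (y j) n i"
  have towers: "?z n i \<in> towers ?t" if "i \<in> I n" for n i
    by (rule remainder_tower[of ?t r x y, OF g.prefix_prod_closed r(2) x rx y yx that])
  have divides: "\<exists>l. \<forall>j\<ge>l. \<exists>h\<in>carrier R. ?t j = s \<otimes> h" if "s \<in> G" for s
    using G that g.prefix_prod_divisible by blast
  have "G \<subseteq> carrier R" using G by auto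
  have "\<exists>w\<in>cochains I M. \<forall>n. \<forall>i\<in>I n. ?z n i 0 \<asymp> coboundary R A M w n i"
    by (rule tower_is_coboundary[of p G ?t ?z])
      (fact p pN \<open>G \<subseteq> carrier R\<close> g.prefix_prod_closed divides ml towers)+
  then obtain w where w: "w \<in> cochains I M"
    and zw: "\<And>n i. i \<in> I n \<Longrightarrow> ?z n i 0 \<asymp> coboundary R A M w n i"
    by blast
  have "c n i \<asymp> coboundary R A M (\<lambda>n i. w n i \<oplus>\<^bsub>M\<^esub> y 0 n i) n i" if "i \<in> I n" for n i
    using cong_coboundary_add[OF c w y that] zw[OF that] by (simp add: r(1))
  moreover have "(\<lambda>n i. w n i \<oplus>\<^bsub>M\<^esub> y 0 n i) \<in> cochains I M"
    using w y[of 0] by (auto simp: cochains_def Pi_iff)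
  ultimately show "\<exists>x\<in>cochains I M. \<forall>n. \<forall>i\<in>I n. c n i \<asymp> coboundary R A M x n i" by blast
qed

theorem lim1_vanishes_mod_prime:
  assumes noeth: "noetherian_ring R" and p: "primeideal p R"
    and pN: "\<And>a m. \<lbrakk>a \<in> p; m \<in> carrier M\<rbrakk> \<Longrightarrow> a \<odot>\<^bsub>M\<^esub> m \<in> N"
    and up_to: "\<And>a. a \<in> carrier R - p \<Longrightarrow> lim1_vanishes_up_to a"
    and almost: "almost_cotorsion R M"
  shows "lim1_vanishes_mod R I A M N"
proof -
  interpret p: primeideal p R by (rule p)
  obtain G where G: "G \<subseteq> carrier R - p" "countable G" and ml: "mittag_leffler_mod p G"
    using mittag_leffler_mod_countable_subset[OF mittag_leffler_mod_prime[OF noeth p]] by blast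
  obtain g :: "nat \<Rightarrow> 'a"
    where g: "mult_subset R (range g)" "range g \<subseteq> carrier R - p" "G \<subseteq> range g"
    using R.countable_subset_of_mult_subset[OF p.complement_mult_subset G] .
  show ?thesis
    by (rule lim1_vanishes_mod_if_up_to[OF p.a_subset pN g(1,3) ml _ almost]) (use up_to g(2) in blast)+
qed

definition plus_multiples :: "'a \<Rightarrow> 'm set" where
  "plus_multiples a = {x \<in> carrier M. \<exists>m\<in>carrier M. x \<asymp> a \<odot>\<^bsub>M\<^esub> m}"

lemma submodule_plus_multiples:
  assumes a: "a \<in> carrier R"
  shows "submodule (plus_multiples a) R M"
proof -
  have zero: "\<zero>\<^bsub>M\<^esub> \<in> plus_multiples a"
    using a cong_refl[OF M.zero_closed] unfolding plus_multiples_def by (auto intro: bexI[of _ "\<zero>\<^bsub>M\<^esub>"])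
  have smult: "r \<odot>\<^bsub>M\<^esub> x \<in> plus_multiples a" if r: "r \<in> carrier R" and x: "x \<in> plus_multiples a" for r x
  proof -
    obtain m where "x \<in> carrier M" "m \<in> carrier M" "x \<asymp> a \<odot>\<^bsub>M\<^esub> m"
      using x by (auto simp: plus_multiples_def)
    then show ?thesis
      using r a cong_smult[OF r, of x "a \<odot>\<^bsub>M\<^esub> m"]
      by (auto simp: plus_multiples_def smult_lcomm[of r] intro!: bexI[of _ "r \<odot>\<^bsub>M\<^esub> m"])
  qed
  have add: "x \<oplus>\<^bsub>M\<^esub> y \<in> plus_multiples a" if xy: "x \<in> plus_multiples a" "y \<in> plus_multiples a" for x y
  proof -
    obtain m k where "x \<in> carrier M" "m \<in> carrier M" "x \<asymp> a \<odot>\<^bsub>M\<^esub> m"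
      "y \<in> carrier M" "k \<in> carrier M" "y \<asymp> a \<odot>\<^bsub>M\<^esub> k"
      using xy by (auto simp: plus_multiples_def)
    then show ?thesis
      using a cong_add[of x "a \<odot>\<^bsub>M\<^esub> m" y "a \<odot>\<^bsub>M\<^esub> k"]
      by (auto simp: plus_multiples_def smult_r_distr intro!: bexI[of _ "m \<oplus>\<^bsub>M\<^esub> k"])
  qed
  show ?thesis
  proof (rule submoduleI)
    show "\<ominus>\<^bsub>M\<^esub> x \<in> plus_multiples a" if "x \<in> plus_multiples a" for x
      using smult[of "\<ominus> \<one>" x] that by (simp add: plus_multiples_def smult_l_minus)
  qed (use zero smult add in \<open>auto simp: plus_multiples_def\<close>)
qed

lemma lim1_vanishes_up_to_if_mod_plus_multiples:
  assumes a: "a \<in> carrier R" and lim1: "lim1_vanishes_mod R I A M (plus_multiples a)"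
  shows "lim1_vanishes_up_to a"
  unfolding lim1_vanishes_up_to_def
proof
  fix c assume c: "c \<in> cochains I M"
  obtain x where x: "x \<in> cochains I M"
    and "\<And>n i. i \<in> I n \<Longrightarrow> c n i \<ominus>\<^bsub>M\<^esub> coboundary R A M x n i \<in> plus_multiples a"
    using lim1 c unfolding lim1_vanishes_mod_def by blast
  then have "\<exists>m\<in>carrier M. c n i \<ominus>\<^bsub>M\<^esub> coboundary R A M x n i \<asymp> a \<odot>\<^bsub>M\<^esub> m" if "i \<in> I n" for n i
    using that by (simp add: plus_multiples_def)
  from cochain_choice[OF this] obtain d where d: "d \<in> cochains I M"
    and cd: "\<forall>n. \<forall>i\<in>I n. c n i \<ominus>\<^bsub>M\<^esub> coboundary R A M x n i \<asymp> a \<odot>\<^bsub>M\<^esub> d n i"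
    by (rule bexE)
  have "c n i \<asymp> coboundary R A M x n i \<oplus>\<^bsub>M\<^esub> a \<odot>\<^bsub>M\<^esub> d n i" if i: "i \<in> I n" for n i
    using cong_add[OF cd[rule_format, OF i] cong_refl[OF coboundary_closed[OF x i]]] a
      coboundary_closed[OF x i] cochain_closed[OF c i] cochain_closed[OF d i]
    by (simp add: M.diff_add_cancel M.a_comm[of "a \<odot>\<^bsub>M\<^esub> d n i"])
  with x d show "\<exists>x\<in>cochains I M. \<exists>d\<in>cochains I M. \<forall>n. \<forall>i\<in>I n.
      c n i \<asymp> coboundary R A M x n i \<oplus>\<^bsub>M\<^esub> a \<odot>\<^bsub>M\<^esub> d n i"
    by blast
qed

lemma lim1_vanishes_mod_if_product:
  assumes a: "a \<in> carrier R" "lim1_vanishes_up_to a" and b: "b \<in> carrier R" "lim1_vanishes_up_to b"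
    and ab: "\<And>m. m \<in> carrier M \<Longrightarrow> (a \<otimes> b) \<odot>\<^bsub>M\<^esub> m \<in> N"
  shows "lim1_vanishes_mod R I A M N"
  unfolding lim1_vanishes_mod_iff_cong
proof
  fix c assume "c \<in> cochains I M"
  then obtain x d where x: "x \<in> cochains I M" and d: "d \<in> cochains I M"
    and cx: "\<And>n i. i \<in> I n \<Longrightarrow> c n i \<asymp> coboundary R A M x n i \<oplus>\<^bsub>M\<^esub> a \<odot>\<^bsub>M\<^esub> d n i"
    using a(2) unfolding lim1_vanishes_up_to_def by blast
  obtain y e where y: "y \<in> cochains I M" and e: "e \<in> cochains I M"
    and dy: "\<And>n i. i \<in> I n \<Longrightarrow> d n i \<asymp> coboundary R A M y n i \<oplus>\<^bsub>M\<^esub> b \<odot>\<^bsub>M\<^esub> e n i"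
    using b(2) d unfolding lim1_vanishes_up_to_def by blast
  have ay: "(\<lambda>n i. a \<odot>\<^bsub>M\<^esub> y n i) \<in> cochains I M" using y a(1) by (auto simp: cochains_def Pi_iff)
  let ?z = "\<lambda>n i. x n i \<oplus>\<^bsub>M\<^esub> a \<odot>\<^bsub>M\<^esub> y n i"
  have z: "?z \<in> cochains I M" using x ay by (auto simp: cochains_def Pi_iff)
  have "c n i \<asymp> coboundary R A M ?z n i" if i: "i \<in> I n" for n i
  proof -
    note closed = coboundary_closed[OF x i] coboundary_closed[OF y i] coboundary_closed[OF z i]
      cochain_closed[OF e i] a(1) b(1)
    have "c n i \<asymp> coboundary R A M x n i \<oplus>\<^bsub>M\<^esub> a \<odot>\<^bsub>M\<^esub> d n i" by (rule cx[OF i])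
    also have "\<dots> \<asymp> coboundary R A M x n i \<oplus>\<^bsub>M\<^esub> a \<odot>\<^bsub>M\<^esub> (coboundary R A M y n i \<oplus>\<^bsub>M\<^esub> b \<odot>\<^bsub>M\<^esub> e n i)"
      by (intro cong_add cong_smult dy i a(1) cong_refl closed)
    also have "\<dots> = coboundary R A M ?z n i \<oplus>\<^bsub>M\<^esub> (a \<otimes> b) \<odot>\<^bsub>M\<^esub> e n i"
      by (simp add: closed coboundary_add[OF x ay i] coboundary_smult[OF a(1) y i] smult_r_distr
          smult_assoc1 M.a_assoc)
    also have "\<dots> \<asymp> coboundary R A M ?z n i \<oplus>\<^bsub>M\<^esub> \<zero>\<^bsub>M\<^esub>"
      by (intro cong_add cong_refl closed) (simp add: cong_zero_iff ab closed)
    finally show ?thesis using closed by simp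
  qed
  with z show "\<exists>x\<in>cochains I M. \<forall>n. \<forall>i\<in>I n. c n i \<asymp> coboundary R A M x n i" by blast
qed

end

definition quotient_annihilator :: "('r, 'x) ring_scheme \<Rightarrow> ('r, 'm, 'e) module_scheme \<Rightarrow> 'm set \<Rightarrow>
    'r set" where
  "quotient_annihilator R M N = {a \<in> carrier R. \<forall>m\<in>carrier M. a \<odot>\<^bsub>M\<^esub> m \<in> N}"

lemma (in module) ideal_quotient_annihilator:
  assumes N: "submodule N R M"
  shows "ideal (quotient_annihilator R M N) R"
proof -
  interpret Reg: module R "regular_module R" by (rule R.regular_module)
  note sub = submodule_zero[OF N] submoduleE(3-5)[OF N]
  have "submodule (quotient_annihilator R M N) R (regular_module R)"
    by (rule Reg.submoduleI)
      (auto simp: quotient_annihilator_def sub smult_l_minus smult_l_distr smult_assoc1)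
  then show ?thesis unfolding R.submodule_regular_module_iff .
qed

lemma (in telescope_cong) quotient_annihilator_plus_multiples:
  assumes "a \<in> carrier R - quotient_annihilator R M N"
  shows "quotient_annihilator R M N \<subset> quotient_annihilator R M (plus_multiples a)"
proof -
  have a: "a \<in> carrier R" using assms by simp
  have "N \<subseteq> plus_multiples a"
  proof
    fix x assume "x \<in> N"
    then have "x \<asymp> a \<odot>\<^bsub>M\<^esub> \<zero>\<^bsub>M\<^esub>" using a by (simp add: cong_zero_iff)
    then show "x \<in> plus_multiples a" using cong_closed(1) by (auto simp: plus_multiples_def)
  qed
  moreover have "a \<odot>\<^bsub>M\<^esub> m \<in> plus_multiples a" if "m \<in> carrier M" for m
    using a that by (auto simp: plus_multiples_def intro!: bexI[of _ m])
  ultimately show ?thesis using assms by (auto simp: quotient_annihilator_def)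
qed

lemma (in telescope_cong) lim1_vanishes_mod_cases:
  assumes noeth: "noetherian_ring R" and almost: "almost_cotorsion R M"
    and up_to: "\<And>a. a \<in> carrier R - quotient_annihilator R M N \<Longrightarrow> lim1_vanishes_up_to a"
  shows "lim1_vanishes_mod R I A M N"
proof -
  let ?J = "quotient_annihilator R M N"
  have JN: "a \<odot>\<^bsub>M\<^esub> m \<in> N" if "a \<in> ?J" "m \<in> carrier M" for a m
    using that by (simp add: quotient_annihilator_def)
  consider "?J = carrier R" | "primeideal ?J R"
    | a b where "a \<in> carrier R - ?J" "b \<in> carrier R - ?J" "a \<otimes> b \<in> ?J"
    using primeidealI[OF ideal_quotient_annihilator[OF submodule] R.is_cring] by blast
  then show ?thesis
  proof cases
    case 1
    then have "x \<in> N" if "x \<in> carrier M" for x using JN[of \<one> x] that by simp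
    then show ?thesis
      unfolding lim1_vanishes_mod_def by (meson M.minus_closed cochain_closed coboundary_closed)
  next
    case 2
    then show ?thesis using JN up_to by (rule lim1_vanishes_mod_prime[OF noeth _ _ _ almost])
  next
    case 3
    then show ?thesis using up_to JN by (intro lim1_vanishes_mod_if_product[of a b]) auto
  qed
qed

theorem (in telescope_module) lim1_vanishes_mod_submodule:
  assumes noeth: "noetherian_ring R" and almost: "almost_cotorsion R M" and "submodule N R M"
  shows "lim1_vanishes_mod R I A M N"
proof -
  have "wf {(K, J). ideal J R \<and> ideal K R \<and> J \<subset> K}"
    using R.noetherian_regular_module[OF noeth]
    by (simp add: noetherian_module_def R.submodule_regular_module_iff)
  then show ?thesis using assms(3)
  proof (induction "quotient_annihilator R M N" arbitrary: N rule: wf_induct_rule)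
    case less
    let ?J = "quotient_annihilator R M N"
    interpret telescope_cong R I A M N
      by (intro telescope_cong.intro telescope_module_axioms module_submodule.intro module_axioms
          module_submodule_axioms.intro less.prems)
    show ?case
    proof (rule lim1_vanishes_mod_cases[OF noeth almost lim1_vanishes_up_to_if_mod_plus_multiples])
      fix a assume a: "a \<in> carrier R - ?J"
      then show "a \<in> carrier R" by simp
      then show "lim1_vanishes_mod R I A M (plus_multiples a)"
        using quotient_annihilator_plus_multiples[OF a] less.prems
        by (intro less.hyps submodule_plus_multiples)
          (simp_all add: ideal_quotient_annihilator submodule_plus_multiples)
    qed
  qed
qed

section \<open>The equational criterion for flatness\<close>

definition int_module :: "('m, 'e) ring_scheme \<Rightarrow> (int, 'm) module" where
  "int_module G = \<lparr>carrier = carrier G, monoid.mult = (\<lambda>_ _. undefined), one = undefined,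
     ring.zero = ring.zero G, ring.add = ring.add G, module.smult = add_pow G\<rparr>"

lemma int_module_simps [simp]:
  "carrier (int_module G) = carrier G"
  "\<zero>\<^bsub>int_module G\<^esub> = \<zero>\<^bsub>G\<^esub>"
  "(\<oplus>\<^bsub>int_module G\<^esub>) = (\<oplus>\<^bsub>G\<^esub>)"
  "(\<odot>\<^bsub>int_module G\<^esub>) = add_pow G"
  "a_inv (int_module G) = a_inv G"
  "a_minus (int_module G) = a_minus G"
  "finsum (int_module G) = finsum G"
  by (auto simp: int_module_def a_inv_def m_inv_def a_minus_def finsum_def finprod_def fun_eq_iff)

lemma (in abelian_group) int_module: "module \<Z> (int_module G)"
proof (rule moduleI[OF int_is_cring])
  show "abelian_group (int_module G)"
  proof (rule abelian_groupI)
    show "\<exists>y\<in>carrier (int_module G). y \<oplus>\<^bsub>int_module G\<^esub> x = \<zero>\<^bsub>int_module G\<^esub>"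
      if "x \<in> carrier (int_module G)" for x
      using that l_neg[of x] by (intro bexI[of _ "\<ominus> x"]) auto
  qed (simp_all add: a_ac)
qed (simp_all add: add.int_pow_mult add.int_pow_distrib add.int_pow_pow mult.commute)

lemma (in module) submodule_int_module:
  assumes "submodule N R M"
  shows "submodule N \<Z> (int_module M)"
proof -
  interpret Z: module \<Z> "int_module M" by (rule M.int_module)
  have "subgroup N (add_monoid M)" using assms by (rule submodule.axioms(1))
  then show ?thesis
    by (intro Z.submoduleI)
      (simp_all add: submoduleE(1,3,5)[OF assms] submodule_zero[OF assms] M.add.subgroup_int_pow_closed)
qed

lemma tdelta_eq_unit_vec: "tdelta p = unit_vec \<Z> p"
  by (simp add: tdelta_def unit_vec_def fun_eq_iff)

lemma tformal_eq_free_module: "tformal R I F = carrier (free_module \<Z> (I \<times> carrier F))"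
  by (simp add: tformal_def free_module_def)

lemma free_module_int_diff:
  assumes "t \<in> carrier (free_module \<Z> K)" "u \<in> carrier (free_module \<Z> K)"
  shows "(\<lambda>q. t q - u q) = t \<ominus>\<^bsub>free_module \<Z> K\<^esub> u"
  using cring.free_module_diff[OF int_is_cring assms] by (simp add: int_a_minus_eq fun_eq_iff)

lemma tspan_subset_submodule:
  assumes V: "submodule V \<Z> (free_module \<Z> (I \<times> carrier F))" and gens: "tgens R I F \<subseteq> V"
  shows "tspan R I F \<subseteq> V"
proof
  interpret Free: module \<Z> "free_module \<Z> (I \<times> carrier F)" by (rule cring.free_module[OF int_is_cring])
  have V_closed: "v \<in> carrier (free_module \<Z> (I \<times> carrier F))" if "v \<in> V" for v
    using Free.submoduleE(1)[OF V] that by blast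
  fix t assume "t \<in> tspan R I F"
  then show "t \<in> V"
  proof induction
    case tspan_zero
    show ?case using Free.submodule_zero[OF V] by simp
  next
    case (tspan_add t g)
    then show ?case using Free.submoduleE(5)[OF V, of t g] gens by auto
  next
    case (tspan_diff t g)
    then show ?case
      using Free.submodule_diff[OF V, of t g]
        free_module_int_diff[OF V_closed V_closed, of t g] gens
      by auto
  qed
qed

lemma teval_eq_lin_ext: "teval R F = lin_ext \<Z> (int_module F) (\<lambda>p. fst p \<odot>\<^bsub>F\<^esub> snd p)"
  by (simp add: teval_def lin_ext_def fun_eq_iff)

context module
begin

definition factorisation :: "'i set \<Rightarrow> ('i \<Rightarrow> 'c) \<Rightarrow> nat \<Rightarrow> (nat \<Rightarrow> 'c) \<Rightarrow> ('i \<Rightarrow> nat \<Rightarrow> 'a) \<Rightarrow> bool" where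
  "factorisation J x q y \<rho> \<longleftrightarrow> y \<in> {..<q} \<rightarrow> carrier M \<and> \<rho> \<in> J \<rightarrow> carrier (free_module R {..<q}) \<and>
     (\<forall>i\<in>J. x i = lin_ext R M y (\<rho> i))"

end

locale linear_relation = module R M
  for R (structure) and M :: "('a, 'm, 'e) module_scheme" (structure) +
  fixes J :: "'i set" and c
  assumes finite_index [simp]: "finite J" and coefficients_closed: "c \<in> carrier (free_module R J)"
begin

definition pairing :: "('i \<Rightarrow> 'a) \<Rightarrow> 'a" where
  "pairing = lin_ext R (regular_module R) c"

definition coefficient_ideal :: "'a set" where
  "coefficient_ideal = pairing ` carrier (free_module R J)"

definition tensor :: "('i \<Rightarrow> 'a) \<Rightarrow> 'm \<Rightarrow> 'i \<Rightarrow> 'm" where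
  "tensor \<kappa> m = (\<lambda>j. \<kappa> j \<odot>\<^bsub>M\<^esub> m)"

definition null_tensors :: "('i \<Rightarrow> 'm) set" where
  "null_tensors = lin_ext R (power_module M) (case_prod tensor) `
     carrier (free_module R ({\<kappa> \<in> carrier (free_module R J). pairing \<kappa> = \<zero>} \<times> carrier M))"

definition preimage :: "'a \<Rightarrow> 'i \<Rightarrow> 'a" where
  "preimage a = (SOME \<kappa>. \<kappa> \<in> carrier (free_module R J) \<and> pairing \<kappa> = a)"

text \<open>Modulo null tensors this is the map from the tensor product of the coefficient ideal with \<open>M\<close>
  sending \<open>a \<otimes> m\<close> to \<open>\<kappa> \<otimes> m\<close>, for any \<open>\<kappa>\<close> with \<open>pairing \<kappa> = a\<close>.\<close>

definition tensor_map :: "('a \<times> 'm \<Rightarrow> int) \<Rightarrow> 'i \<Rightarrow> 'm" where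
  "tensor_map = lin_ext \<Z> (int_module (power_module M)) (\<lambda>(a, m). tensor (preimage a) m)"

lemma pairing_linear_map: "linear_map R (free_module R J) (regular_module R) pairing"
  unfolding pairing_def
  by (rule module.lin_ext_linear_map[OF R.regular_module])
    (simp add: free_moduleD(1)[OF coefficients_closed])

lemma pairing_unit_vec: "pairing (unit_vec R j) = c j"
  unfolding pairing_def
  by (rule module.lin_ext_unit_vec[OF R.regular_module])
    (simp add: free_moduleD(1)[OF coefficients_closed])

lemma ideal_coefficient_ideal: "ideal coefficient_ideal R"
proof -
  interpret pairing: linear_map R "free_module R J" "regular_module R" pairing
    by (rule pairing_linear_map)
  show ?thesis
    unfolding coefficient_ideal_def R.submodule_regular_module_iff[symmetric]
    by (rule pairing.submodule_image[OF pairing.M.carrier_is_submodule])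
qed

lemma coefficient_mem: "j \<in> J \<Longrightarrow> c j \<in> coefficient_ideal"
  unfolding coefficient_ideal_def by (metis pairing_unit_vec R.unit_vec_closed imageI)

lemma preimage:
  assumes "a \<in> coefficient_ideal"
  shows "preimage a \<in> carrier (free_module R J)" "pairing (preimage a) = a"
proof -
  have "\<exists>\<kappa>. \<kappa> \<in> carrier (free_module R J) \<and> pairing \<kappa> = a"
    using assms unfolding coefficient_ideal_def by blast
  from someI_ex[OF this] show "preimage a \<in> carrier (free_module R J)" "pairing (preimage a) = a"
    unfolding preimage_def by blast+
qed

lemma tensor_closed [simp]:
  "\<lbrakk>\<kappa> \<in> carrier (free_module R J); m \<in> carrier M\<rbrakk> \<Longrightarrow> tensor \<kappa> m \<in> carrier (power_module M)"
  using free_moduleD(1)[of \<kappa> R J] by (simp add: tensor_def)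

lemma tensor_add:
  assumes "\<kappa> \<in> carrier (free_module R J)" "\<kappa>' \<in> carrier (free_module R J)" "m \<in> carrier M"
  shows "tensor (\<kappa> \<oplus>\<^bsub>free_module R J\<^esub> \<kappa>') m = tensor \<kappa> m \<oplus>\<^bsub>power_module M\<^esub> tensor \<kappa>' m"
  using free_moduleD(1)[OF assms(1)] free_moduleD(1)[OF assms(2)] assms(3)
  by (simp add: tensor_def smult_l_distr)

lemma tensor_add_right:
  assumes "\<kappa> \<in> carrier (free_module R J)" "m \<in> carrier M" "m' \<in> carrier M"
  shows "tensor \<kappa> (m \<oplus>\<^bsub>M\<^esub> m') = tensor \<kappa> m \<oplus>\<^bsub>power_module M\<^esub> tensor \<kappa> m'"
  using free_moduleD(1)[OF assms(1)] assms(2,3) by (simp add: tensor_def smult_r_distr)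

lemma tensor_smult:
  assumes "\<kappa> \<in> carrier (free_module R J)" "m \<in> carrier M" "a \<in> carrier R"
  shows "tensor (a \<odot>\<^bsub>free_module R J\<^esub> \<kappa>) m = tensor \<kappa> (a \<odot>\<^bsub>M\<^esub> m)"
  using free_moduleD(1)[OF assms(1)] assms(2,3) by (simp add: tensor_def smult_assoc1 smult_lcomm)

lemma tensor_Pi:
  "case_prod tensor \<in> {\<kappa> \<in> carrier (free_module R J). pairing \<kappa> = \<zero>} \<times> carrier M
    \<rightarrow> carrier (power_module M)"
  by (auto simp del: power_module_simps)

lemma submodule_null_tensors: "submodule null_tensors R (power_module M)"
proof -
  interpret P: module R "power_module M :: ('a, 'i \<Rightarrow> 'm) module" by (rule power_module)
  show ?thesis
    unfolding null_tensors_def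
    by (intro linear_map.submodule_image[OF P.lin_ext_linear_map[OF tensor_Pi]]
        module.carrier_is_submodule R.free_module)
qed

lemma tensor_null:
  assumes "\<kappa> \<in> carrier (free_module R J)" "pairing \<kappa> = \<zero>" "m \<in> carrier M"
  shows "tensor \<kappa> m \<in> null_tensors"
proof -
  interpret P: module R "power_module M :: ('a, 'i \<Rightarrow> 'm) module" by (rule power_module)
  have "lin_ext R (power_module M) (case_prod tensor) (unit_vec R (\<kappa>, m)) = tensor \<kappa> m"
    using P.lin_ext_unit_vec[of "case_prod tensor" "(\<kappa>, m)"] tensor_closed[OF assms(1,3)] by simp
  then show ?thesis
    unfolding null_tensors_def by (intro image_eqI[of _ _ "unit_vec R (\<kappa>, m)"]) (simp_all add: assms)
qed

sublocale tensors: module_submodule R "power_module M" null_tensors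
  by (intro module_submodule.intro power_module module_submodule_axioms.intro submodule_null_tensors)

lemma tensor_cong:
  assumes \<kappa>: "\<kappa> \<in> carrier (free_module R J)" and \<mu>: "\<mu> \<in> carrier (free_module R J)"
    and "pairing \<kappa> = pairing \<mu>" and m: "m \<in> carrier M"
  shows "tensors.cong (tensor \<kappa> m) (tensor \<mu> m)"
proof -
  interpret pairing: linear_map R "free_module R J" "regular_module R" pairing
    by (rule pairing_linear_map)
  let ?d = "\<kappa> \<ominus>\<^bsub>free_module R J\<^esub> \<mu>"
  have d: "?d \<in> carrier (free_module R J)" using \<kappa> \<mu> by (rule pairing.M.M.minus_closed)
  have "pairing ?d = \<zero>"
    using pairing.diff[OF \<kappa> \<mu>] pairing.closed[OF \<mu>] assms(3) by (simp add: R.diff_eq_zero_iff)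
  then have "tensor ?d m \<in> null_tensors" by (rule tensor_null[OF d _ m])
  moreover have "tensor \<kappa> m = tensor ?d m \<oplus>\<^bsub>power_module M\<^esub> tensor \<mu> m"
    using tensor_add[OF d \<mu> m] pairing.M.M.diff_add_cancel[OF \<kappa> \<mu>] by simp
  then have "tensor \<kappa> m \<ominus>\<^bsub>power_module M\<^esub> tensor \<mu> m = tensor ?d m"
    using tensors.M.add_diff_cancel[OF tensor_closed[OF d m] tensor_closed[OF \<mu> m]] by simp
  ultimately show ?thesis
    using tensor_closed[OF \<kappa> m] tensor_closed[OF \<mu> m] by (simp add: tensors.cong_def)
qed

lemma tensor_preimage_closed [simp]:
  "\<lbrakk>a \<in> coefficient_ideal; m \<in> carrier M\<rbrakk> \<Longrightarrow> tensor (preimage a) m \<in> carrier (power_module M)"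
  by (rule tensor_closed[OF preimage(1)])

lemma tensor_preimage_add:
  assumes a: "a \<in> coefficient_ideal" and b: "b \<in> coefficient_ideal" and m: "m \<in> carrier M"
  shows "tensors.cong (tensor (preimage (a \<oplus> b)) m)
    (tensor (preimage a) m \<oplus>\<^bsub>power_module M\<^esub> tensor (preimage b) m)"
proof -
  interpret pairing: linear_map R "free_module R J" "regular_module R" pairing
    by (rule pairing_linear_map)
  interpret ideal coefficient_ideal R by (rule ideal_coefficient_ideal)
  note a' = preimage[OF a] and b' = preimage[OF b] and ab = preimage[OF a_closed[OF a b]]
  have "pairing (preimage a \<oplus>\<^bsub>free_module R J\<^esub> preimage b) = a \<oplus> b"
    using pairing.add[OF a'(1) b'(1)] a'(2) b'(2) by simp
  then have "tensors.cong (tensor (preimage (a \<oplus> b)) m)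
      (tensor (preimage a \<oplus>\<^bsub>free_module R J\<^esub> preimage b) m)"
    using ab(2) by (intro tensor_cong[OF ab(1) pairing.M.M.a_closed[OF a'(1) b'(1)] _ m]) simp
  then show ?thesis unfolding tensor_add[OF a'(1) b'(1) m] .
qed

lemma tensor_preimage_smult:
  assumes r: "r \<in> carrier R" and a: "a \<in> coefficient_ideal" and m: "m \<in> carrier M"
  shows "tensors.cong (tensor (preimage (r \<otimes> a)) m) (tensor (preimage a) (r \<odot>\<^bsub>M\<^esub> m))"
proof -
  interpret pairing: linear_map R "free_module R J" "regular_module R" pairing
    by (rule pairing_linear_map)
  interpret ideal coefficient_ideal R by (rule ideal_coefficient_ideal)
  note a' = preimage[OF a] and ra = preimage[OF I_l_closed[OF a r]]
  have "pairing (r \<odot>\<^bsub>free_module R J\<^esub> preimage a) = r \<otimes> a"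
    using pairing.smult[OF r a'(1)] a'(2) by simp
  then have "tensors.cong (tensor (preimage (r \<otimes> a)) m) (tensor (r \<odot>\<^bsub>free_module R J\<^esub> preimage a) m)"
    using ra(2) by (intro tensor_cong[OF ra(1) pairing.M.smult_closed[OF r a'(1)] _ m]) simp
  then show ?thesis unfolding tensor_smult[OF a'(1) m r] .
qed

abbreviation formal_sums :: "(int, 'a \<times> 'm \<Rightarrow> int) module" where
  "formal_sums \<equiv> free_module \<Z> (coefficient_ideal \<times> carrier M)"

lemma tensor_map_linear_map:
  "linear_map \<Z> formal_sums (int_module (power_module M)) tensor_map"
  unfolding tensor_map_def
  by (rule module.lin_ext_linear_map[OF tensors.M.int_module]) (auto simp del: power_module_simps)

lemma tdelta_closed: "\<lbrakk>a \<in> coefficient_ideal; m \<in> carrier M\<rbrakk> \<Longrightarrow> tdelta (a, m) \<in> carrier formal_sums"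
  unfolding tdelta_eq_unit_vec by (rule cring.unit_vec_closed[OF int_is_cring]) simp

lemma tensor_map_tdelta:
  assumes "a \<in> coefficient_ideal" "m \<in> carrier M"
  shows "tensor_map (tdelta (a, m)) = tensor (preimage a) m"
  using module.lin_ext_unit_vec[OF tensors.M.int_module, of "\<lambda>(a, m). tensor (preimage a) m" "(a, m)"]
    tensor_preimage_closed[OF assms]
  by (simp add: tensor_map_def tdelta_eq_unit_vec)

definition null_sums :: "('a \<times> 'm \<Rightarrow> int) set" where
  "null_sums = {t \<in> carrier formal_sums. tensor_map t \<in> null_tensors}"

lemma submodule_null_sums: "submodule null_sums \<Z> formal_sums"
  unfolding null_sums_def
  by (rule linear_map.submodule_vimage[OF tensor_map_linear_map])
    (rule tensors.submodule_int_module[OF submodule_null_tensors])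

lemma null_sums_diff:
  assumes t: "t \<in> carrier formal_sums" and u: "u \<in> carrier formal_sums"
    and "tensors.cong (tensor_map t) (tensor_map u)"
  shows "(\<lambda>q. t q - u q) \<in> null_sums"
proof -
  interpret tensor_map: linear_map \<Z> formal_sums "int_module (power_module M)" tensor_map
    by (rule tensor_map_linear_map)
  have "(\<lambda>q. t q - u q) = t \<ominus>\<^bsub>formal_sums\<^esub> u" by (rule free_module_int_diff[OF t u])
  then show ?thesis
    using assms(3) tensor_map.diff[OF t u] tensor_map.M.M.minus_closed[OF t u]
    by (simp add: null_sums_def tensors.cong_def)
qed

lemma tgens_null_sums: "tgens R coefficient_ideal M \<subseteq> null_sums"
proof -
  interpret tensor_map: linear_map \<Z> formal_sums "int_module (power_module M)" tensor_map
    by (rule tensor_map_linear_map)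
  interpret ideal coefficient_ideal R by (rule ideal_coefficient_ideal)
  have add: "(\<lambda>q. t q - u q - v q) \<in> null_sums"
    if t: "t \<in> carrier formal_sums" and u: "u \<in> carrier formal_sums" and v: "v \<in> carrier formal_sums"
      and cong: "tensors.cong (tensor_map t) (tensor_map u \<oplus>\<^bsub>power_module M\<^esub> tensor_map v)" for t u v
  proof -
    have "(\<lambda>q. t q - (u q + v q)) \<in> null_sums"
      using null_sums_diff[OF t tensor_map.M.M.a_closed[OF u v]] cong tensor_map.add[OF u v] by simp
    then show ?thesis by (simp add: diff_diff_eq)
  qed
  show ?thesis
    unfolding tgens_def
  proof (safe)
    fix a b m assume "a \<in> coefficient_ideal" "b \<in> coefficient_ideal" "m \<in> carrier M"
    then show "(\<lambda>q. tdelta (a \<oplus> b, m) q - tdelta (a, m) q - tdelta (b, m) q) \<in> null_sums"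
      by (intro add tdelta_closed a_closed)
        (simp_all add: tensor_map_tdelta tensor_preimage_add del: power_module_simps)
  next
    fix a m m' assume "a \<in> coefficient_ideal" "m \<in> carrier M" "m' \<in> carrier M"
    then show "(\<lambda>q. tdelta (a, m \<oplus>\<^bsub>M\<^esub> m') q - tdelta (a, m) q - tdelta (a, m') q) \<in> null_sums"
      by (intro add tdelta_closed M.a_closed)
        (simp_all add: tensor_map_tdelta tensor_add_right preimage(1) tensors.M.a_closed
            del: power_module_simps)
  next
    fix r a m assume "r \<in> carrier R" "a \<in> coefficient_ideal" "m \<in> carrier M"
    then show "(\<lambda>q. tdelta (r \<otimes> a, m) q - tdelta (a, r \<odot>\<^bsub>M\<^esub> m) q) \<in> null_sums"
      by (intro null_sums_diff tdelta_closed I_l_closed smult_closed)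
        (simp_all add: tensor_map_tdelta tensor_preimage_smult I_l_closed)
  qed
qed

lemma tdelta_family: "e \<in> J \<rightarrow> carrier M \<Longrightarrow> (\<lambda>j. tdelta (c j, e j)) \<in> J \<rightarrow> carrier formal_sums"
  using tdelta_closed coefficient_mem by auto

lemma relation_null_sum:
  assumes flat: "flat R M" and e: "e \<in> J \<rightarrow> carrier M" and zero: "lin_ext R M e c = \<zero>\<^bsub>M\<^esub>"
  shows "(\<Oplus>\<^bsub>formal_sums\<^esub>j\<in>J. tdelta (c j, e j)) \<in> null_sums"
proof -
  interpret ideal coefficient_ideal R by (rule ideal_coefficient_ideal)
  interpret teval: linear_map \<Z> formal_sums "int_module M" "teval R M"
    unfolding teval_eq_lin_ext by (rule module.lin_ext_linear_map[OF M.int_module]) (auto simp: Icarr)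
  let ?t = "\<Oplus>\<^bsub>formal_sums\<^esub>j\<in>J. tdelta (c j, e j)"
  have t: "?t \<in> carrier formal_sums" by (rule teval.M.M.finsum_closed[OF tdelta_family[OF e]])
  have "teval R M ?t = (\<Oplus>\<^bsub>M\<^esub>j\<in>J. teval R M (tdelta (c j, e j)))"
    using teval.finsum_image[OF finite_index tdelta_family[OF e]] by simp
  also have "\<dots> = (\<Oplus>\<^bsub>M\<^esub>j\<in>J. c j \<odot>\<^bsub>M\<^esub> e j)"
    using module.lin_ext_unit_vec[OF M.int_module, of "\<lambda>p. fst p \<odot>\<^bsub>M\<^esub> snd p"] coefficient_mem e
    by (intro M.finsum_cong') (auto simp: teval_eq_lin_ext tdelta_eq_unit_vec Icarr Pi_iff)
  also have "\<dots> = \<zero>\<^bsub>M\<^esub>"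
    using lin_ext_eq_finsum[OF coefficients_closed e finite_index order_refl
        free_moduleD(3)[OF coefficients_closed]]
      zero by simp
  finally have "?t \<in> tspan R coefficient_ideal M"
    using flat t is_ideal unfolding flat_def tformal_eq_free_module by blast
  then show ?thesis using tspan_subset_submodule[OF submodule_null_sums tgens_null_sums] by blast
qed

lemma relation_null_tensor:
  assumes "flat R M" and e: "e \<in> J \<rightarrow> carrier M" and "lin_ext R M e c = \<zero>\<^bsub>M\<^esub>"
  shows "(\<Oplus>\<^bsub>power_module M\<^esub>j\<in>J. tensor (unit_vec R j) (e j)) \<in> null_tensors"
proof -
  interpret tensor_map: linear_map \<Z> formal_sums "int_module (power_module M)" tensor_map
    by (rule tensor_map_linear_map)
  have "tensors.cong (\<Oplus>\<^bsub>power_module M\<^esub>j\<in>J. tensor (unit_vec R j) (e j))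
      (\<Oplus>\<^bsub>power_module M\<^esub>j\<in>J. tensor_map (tdelta (c j, e j)))"
  proof (rule tensors.cong_finsum[OF finite_index])
    fix j assume j: "j \<in> J"
    note cj = coefficient_mem[OF j] and ej = funcset_mem[OF e j]
    have "pairing (unit_vec R j) = pairing (preimage (c j))"
      by (simp add: pairing_unit_vec preimage(2)[OF cj])
    then show "tensors.cong (tensor (unit_vec R j) (e j)) (tensor_map (tdelta (c j, e j)))"
      unfolding tensor_map_tdelta[OF cj ej] by (intro tensor_cong preimage(1) cj ej R.unit_vec_closed j)
  qed
  also have "\<dots> = tensor_map (\<Oplus>\<^bsub>formal_sums\<^esub>j\<in>J. tdelta (c j, e j))"
    using tensor_map.finsum_image[OF finite_index tdelta_family[OF e]] by simp
  also have "tensors.cong \<dots> \<zero>\<^bsub>power_module M\<^esub>"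
    using relation_null_sum[OF assms] unfolding tensors.cong_zero_iff by (simp add: null_sums_def)
  finally show ?thesis unfolding tensors.cong_zero_iff .
qed

lemma tensor_unit_vec_sum:
  assumes e: "e \<in> J \<rightarrow> carrier M" and i: "i \<in> J"
  shows "(\<Oplus>\<^bsub>power_module M\<^esub>j\<in>J. tensor (unit_vec R j) (e j)) i = e i"
proof -
  have "(\<Oplus>\<^bsub>power_module M\<^esub>j\<in>J. tensor (unit_vec R j) (e j)) i
      = (\<Oplus>\<^bsub>M\<^esub>j\<in>J. tensor (unit_vec R j) (e j) i)"
    by (rule linear_map.finsum_image[OF evaluation_linear_map finite_index])
      (use e in \<open>auto simp: tensor_def\<close>)
  also have "\<dots> = (\<Oplus>\<^bsub>M\<^esub>j\<in>J. unit_vec R i j \<odot>\<^bsub>M\<^esub> e j)"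
    using e by (intro M.finsum_cong') (auto simp: tensor_def unit_vec_def)
  also have "\<dots> = lin_ext R M e (unit_vec R i)"
    using i by (intro lin_ext_eq_finsum[OF R.unit_vec_closed[OF i] e finite_index, symmetric])
      (auto simp: unit_vec_def)
  also have "\<dots> = e i" using e i by (intro lin_ext_unit_vec) auto
  finally show ?thesis .
qed

lemma null_tensor_finsum:
  assumes "w \<in> null_tensors"
  shows "\<exists>q \<kappa> y. (\<forall>l<q. \<kappa> l \<in> carrier (free_module R J) \<and> pairing (\<kappa> l) = \<zero>) \<and>
    y \<in> {..<q} \<rightarrow> carrier M \<and> (\<forall>j. w j = (\<Oplus>\<^bsub>M\<^esub>l\<in>{..<q::nat}. \<kappa> l j \<odot>\<^bsub>M\<^esub> y l))"
proof -
  interpret pairing: linear_map R "free_module R J" "regular_module R" pairing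
    by (rule pairing_linear_map)
  let ?T = "{\<kappa> \<in> carrier (free_module R J). pairing \<kappa> = \<zero>} \<times> carrier M"
  obtain a where a: "a \<in> carrier (free_module R ?T)"
    and w: "w = lin_ext R (power_module M) (case_prod tensor) a"
    using assms unfolding null_tensors_def by blast
  let ?S = "{p. a p \<noteq> \<zero>}"
  obtain h where h: "bij_betw h {..<card ?S} ?S"
    using ex_bij_betw_nat_finite[OF free_moduleD(2)[OF a]] by (auto simp: atLeast0LessThan)
  define \<kappa> where "\<kappa> l = a (h l) \<odot>\<^bsub>free_module R J\<^esub> fst (h l)" for l
  have S_T: "p \<in> ?T" if "a p \<noteq> \<zero>" for p using that free_moduleD(3)[OF a] by blast
  have "h l \<in> ?T" if "l < card ?S" for l using S_T bij_betwE[OF h] that by blast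
  then have hT: "fst (h l) \<in> carrier (free_module R J)" "pairing (fst (h l)) = \<zero>"
    "snd (h l) \<in> carrier M"
    if "l < card ?S" for l using that by (auto simp: mem_Times_iff)
  show ?thesis
  proof (intro exI[of _ "card ?S"] exI[of _ \<kappa>] exI[of _ "\<lambda>l. snd (h l)"] conjI allI impI)
    fix l assume l: "l < card ?S"
    show "\<kappa> l \<in> carrier (free_module R J)"
      unfolding \<kappa>_def by (rule pairing.M.smult_closed[OF free_moduleD(1)[OF a] hT(1)[OF l]])
    show "pairing (\<kappa> l) = \<zero>"
      unfolding \<kappa>_def using pairing.smult[OF free_moduleD(1)[OF a] hT(1)[OF l]] hT(2)[OF l]
        free_moduleD(1)[OF a]
      by simp
  next
    fix j
    have term_closed: "fst p j \<in> carrier R" "snd p \<in> carrier M" if "a p \<noteq> \<zero>" for p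
      using S_T[OF that] free_moduleD(1)[of "fst p" R J] by auto
    have "w j = lin_ext R M (\<lambda>p. case_prod tensor p j) a"
      unfolding w by (rule linear_map.lin_ext_image[OF evaluation_linear_map a tensor_Pi])
    also have "\<dots> = (\<Oplus>\<^bsub>M\<^esub>p\<in>h ` {..<card ?S}. a p \<odot>\<^bsub>M\<^esub> (fst p j \<odot>\<^bsub>M\<^esub> snd p))"
      unfolding lin_ext_def bij_betw_imp_surj_on[OF h] by (simp add: tensor_def case_prod_unfold)
    also have "\<dots> = (\<Oplus>\<^bsub>M\<^esub>l\<in>{..<card ?S}. a (h l) \<odot>\<^bsub>M\<^esub> (fst (h l) j \<odot>\<^bsub>M\<^esub> snd (h l)))"
      using term_closed free_moduleD(1)[OF a] bij_betw_imp_surj_on[OF h]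
      by (intro M.finsum_reindex bij_betw_imp_inj_on[OF h]) auto
    also have "\<dots> = (\<Oplus>\<^bsub>M\<^esub>l\<in>{..<card ?S}. \<kappa> l j \<odot>\<^bsub>M\<^esub> snd (h l))"
      using hT free_moduleD(1)[OF hT(1)] free_moduleD(1)[OF a]
      by (intro M.finsum_cong') (auto simp: \<kappa>_def smult_assoc1)
    finally show "w j = \<dots>" .
  qed (use hT(3) in auto)
qed

lemma null_tensor_factorisation:
  assumes "w \<in> null_tensors"
  obtains q y \<rho> where "factorisation J w q y \<rho>" "lin_ext R (free_module R {..<q}) \<rho> c = (\<lambda>l. \<zero>)"
proof -
  interpret Reg: module R "regular_module R" by (rule R.regular_module)
  obtain q :: nat and \<kappa> y where \<kappa>: "\<And>l. l < q \<Longrightarrow> \<kappa> l \<in> carrier (free_module R J)"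
    "\<And>l. l < q \<Longrightarrow> pairing (\<kappa> l) = \<zero>"
    and y: "y \<in> {..<q} \<rightarrow> carrier M" and w: "\<And>j. w j = (\<Oplus>\<^bsub>M\<^esub>l\<in>{..<q}. \<kappa> l j \<odot>\<^bsub>M\<^esub> y l)"
    using null_tensor_finsum[OF assms] by blast
  define \<rho> where "\<rho> j l = (if l < q then \<kappa> l j else \<zero>)" for j l
  have \<rho>: "\<rho> j \<in> carrier (free_module R {..<q})" for j
    by (rule finite_free_moduleI) (use free_moduleD(1)[OF \<kappa>(1)] in \<open>auto simp: \<rho>_def\<close>)
  have "w j = lin_ext R M y (\<rho> j)" for j
    unfolding w using y free_moduleD(1)[OF \<kappa>(1)]
    by (subst lin_ext_eq_finsum[OF \<rho> y, of "{..<q}"]) (auto simp: \<rho>_def Pi_iff intro!: M.finsum_cong')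
  then have "factorisation J w q y \<rho>" using y \<rho> by (simp add: factorisation_def)
  moreover have "lin_ext R (free_module R {..<q}) \<rho> c = (\<lambda>l. \<zero>)"
  proof
    fix l
    show "lin_ext R (free_module R {..<q}) \<rho> c l = \<zero>"
    proof (cases "l < q")
      case True
      have "lin_ext R (free_module R {..<q}) \<rho> c l = (\<Oplus>j\<in>J. \<kappa> l j \<otimes> c j)"
        unfolding R.lin_ext_free_module_apply[OF coefficients_closed \<rho> finite_index]
        using True free_moduleD(1)[OF \<kappa>(1)[OF True]] free_moduleD(1)[OF coefficients_closed]
        by (intro R.finsum_cong') (auto simp: \<rho>_def R.m_comm)
      also have "\<dots> = pairing (\<kappa> l)"
        unfolding pairing_def
        using Reg.lin_ext_eq_finsum[OF \<kappa>(1)[OF True] _ finite_index order_refl, of c]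
          free_moduleD(3)[OF \<kappa>(1)[OF True]] free_moduleD(1)[OF coefficients_closed] by simp
      finally show ?thesis using \<kappa>(2)[OF True] by simp
    next
      case False
      have "lin_ext R (free_module R {..<q}) \<rho> c \<in> carrier (free_module R {..<q})"
        using \<rho> by (intro module.lin_ext_closed[OF R.free_module coefficients_closed]) auto
      from free_moduleD(3)[OF this] show ?thesis using False by simp
    qed
  qed
  ultimately show thesis by (rule that)
qed

end

lemma (in module) equational_criterion:
  assumes flat: "flat R M" and "finite J" "c \<in> carrier (free_module R J)"
    and x: "x \<in> J \<rightarrow> carrier M" and zero: "lin_ext R M x c = \<zero>\<^bsub>M\<^esub>"
  shows "\<exists>q y \<rho>. factorisation J x q y \<rho> \<and> lin_ext R (free_module R {..<q}) \<rho> c = (\<lambda>l. \<zero>)"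
proof -
  interpret linear_relation R M J c
    by (intro linear_relation.intro linear_relation_axioms.intro module_axioms assms(2,3))
  obtain q y \<rho> where fac: "factorisation J (\<Oplus>\<^bsub>power_module M\<^esub>j\<in>J. tensor (unit_vec R j) (x j)) q y \<rho>"
    and kills: "lin_ext R (free_module R {..<q}) \<rho> c = (\<lambda>l. \<zero>)"
    using null_tensor_factorisation[OF relation_null_tensor[OF flat x zero]] .
  have "factorisation J x q y \<rho>"
    using fac tensor_unit_vec_sum[OF x] by (simp add: factorisation_def)
  then show ?thesis using kills by blast
qed

section \<open>Countably generated flat modules as telescopes\<close>

context module
begin

lemma factorisationD:
  assumes "factorisation J x q y \<rho>"
  shows "y \<in> {..<q} \<rightarrow> carrier M" "\<rho> \<in> J \<rightarrow> carrier (free_module R {..<q})"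
    "i \<in> J \<Longrightarrow> x i = lin_ext R M y (\<rho> i)"
  using assms by (auto simp: factorisation_def)

lemma factorisation_linear_map:
  "factorisation J x q y \<rho> \<Longrightarrow>
     linear_map R (free_module R J) (free_module R {..<q}) (lin_ext R (free_module R {..<q}) \<rho>)"
  by (rule module.lin_ext_linear_map[OF R.free_module factorisationD(2)])

lemma factorisation_lin_ext:
  assumes fac: "factorisation J x q y \<rho>" and v: "v \<in> carrier (free_module R J)"
  shows "lin_ext R M y (lin_ext R (free_module R {..<q}) \<rho> v) = lin_ext R M x v"
proof -
  note y = factorisationD(1)[OF fac] and \<rho> = factorisationD(2)[OF fac]
  have "lin_ext R M y (lin_ext R (free_module R {..<q}) \<rho> v) = lin_ext R M (\<lambda>i. lin_ext R M y (\<rho> i)) v"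
    by (rule linear_map.lin_ext_image[OF lin_ext_linear_map[OF y] v \<rho>])
  also have "\<dots> = lin_ext R M x v"
    using factorisationD(3)[OF fac] lin_ext_closed[OF funcset_mem[OF \<rho>] y]
    by (intro lin_ext_cong[OF v]) auto
  finally show ?thesis .
qed

lemma factorisation_trans:
  assumes fac: "factorisation J x q y \<rho>" and fac': "factorisation {..<q} y q' y' \<rho>'"
  shows "factorisation J x q' y' (\<lambda>i. lin_ext R (free_module R {..<q'}) \<rho>' (\<rho> i))"
proof -
  interpret \<rho>': linear_map R "free_module R {..<q}" "free_module R {..<q'}"
    "lin_ext R (free_module R {..<q'}) \<rho>'"
    by (rule factorisation_linear_map[OF fac'])
  show ?thesis
    using factorisationD[OF fac] factorisationD(1)[OF fac'] factorisation_lin_ext[OF fac']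
    by (auto simp: factorisation_def Pi_iff)
qed

definition relation_kernel :: "'i set \<Rightarrow> nat \<Rightarrow> ('i \<Rightarrow> nat \<Rightarrow> 'a) \<Rightarrow> ('i \<Rightarrow> 'a) set" where
  "relation_kernel J q \<rho> = a_kernel (free_module R J) (free_module R {..<q})
    (lin_ext R (free_module R {..<q}) \<rho>)"

lemma relation_kernel_iff:
  "v \<in> relation_kernel J q \<rho> \<longleftrightarrow>
     v \<in> carrier (free_module R J) \<and> lin_ext R (free_module R {..<q}) \<rho> v = (\<lambda>l. \<zero>)"
  by (simp add: relation_kernel_def a_kernel_def')

lemma submodule_relation_kernel:
  "factorisation J x q y \<rho> \<Longrightarrow> submodule (relation_kernel J q \<rho>) R (free_module R J)"
  unfolding relation_kernel_def by (rule linear_map.submodule_kernel[OF factorisation_linear_map])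

lemma relation_kernel_trans:
  assumes fac: "factorisation J x q y \<rho>" and fac': "factorisation {..<q} y q' y' \<rho>'"
    and v: "v \<in> carrier (free_module R J)"
    and "lin_ext R (free_module R {..<q}) \<rho> v \<in> relation_kernel {..<q} q' \<rho>'"
  shows "v \<in> relation_kernel J q' (\<lambda>i. lin_ext R (free_module R {..<q'}) \<rho>' (\<rho> i))"
  using linear_map.lin_ext_image[OF factorisation_linear_map[OF fac'] v factorisationD(2)[OF fac]]
    assms(3,4)
  by (simp add: relation_kernel_iff)

lemma relation_kernel_mono:
  assumes fac: "factorisation J x q y \<rho>" and fac': "factorisation {..<q} y q' y' \<rho>'"
  shows "relation_kernel J q \<rho> \<subseteq> relation_kernel J q' (\<lambda>i. lin_ext R (free_module R {..<q'}) \<rho>' (\<rho> i))"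
proof
  fix v assume v: "v \<in> relation_kernel J q \<rho>"
  have "(\<lambda>l. \<zero>) \<in> relation_kernel {..<q} q' \<rho>'"
    using module.submodule_zero[OF R.free_module submodule_relation_kernel[OF fac']] by simp
  then show "v \<in> relation_kernel J q' (\<lambda>i. lin_ext R (free_module R {..<q'}) \<rho>' (\<rho> i))"
    using v by (intro relation_kernel_trans[OF fac fac']) (simp_all add: relation_kernel_iff)
qed

definition effacing_factorisation :: "'i set \<Rightarrow> ('i \<Rightarrow> 'c) \<Rightarrow> nat \<Rightarrow> (nat \<Rightarrow> 'c) \<Rightarrow> ('i \<Rightarrow> nat \<Rightarrow> 'a) \<Rightarrow>
    bool" where
  "effacing_factorisation J x q y \<rho> \<longleftrightarrow> factorisation J x q y \<rho> \<and>
     (\<forall>v\<in>carrier (free_module R J). lin_ext R M x v = \<zero>\<^bsub>M\<^esub> \<longrightarrow>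
        lin_ext R (free_module R {..<q}) \<rho> v = (\<lambda>l. \<zero>))"

text \<open>A factorisation with maximal kernel kills all relations, since any further relation could be
  killed by the equational criterion.\<close>

lemma effacing_factorisation_exists:
  assumes noeth: "noetherian_ring R" and flat: "flat R M" and J: "finite J" and x: "x \<in> J \<rightarrow> carrier M"
  shows "\<exists>q y \<rho>. effacing_factorisation J x q y \<rho>"
proof -
  let ?L = "free_module R J"
  interpret x: linear_map R ?L M "lin_ext R M x" by (rule lin_ext_linear_map[OF x])
  define kernels where "kernels = {relation_kernel J q \<rho> | q y \<rho>. factorisation J x q y \<rho>}"
  obtain q\<^sub>0 y\<^sub>0 \<rho>\<^sub>0 where "factorisation J x q\<^sub>0 y\<^sub>0 \<rho>\<^sub>0"
    using equational_criterion[OF flat J x.M.zero_closed x x.zero] by blast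
  then have "kernels \<noteq> {}" unfolding kernels_def by blast
  moreover have "submodule V R ?L" if "V \<in> kernels" for V
    using that submodule_relation_kernel unfolding kernels_def by blast
  ultimately obtain V where "V \<in> kernels" and max: "\<And>W. \<lbrakk>W \<in> kernels; V \<subseteq> W\<rbrakk> \<Longrightarrow> W = V"
    using noetherian_module_maximal[OF R.noetherian_free_module[OF noeth J], of kernels] by blast
  then obtain q y \<rho> where fac: "factorisation J x q y \<rho>" and V: "V = relation_kernel J q \<rho>"
    unfolding kernels_def by blast
  have "v \<in> relation_kernel J q \<rho>" if v: "v \<in> carrier ?L" and zero: "lin_ext R M x v = \<zero>\<^bsub>M\<^esub>" for v
  proof -
    let ?u = "lin_ext R (free_module R {..<q}) \<rho> v"
    have u: "?u \<in> carrier (free_module R {..<q})"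
      by (rule linear_map.closed[OF factorisation_linear_map[OF fac] v])
    have "lin_ext R M y ?u = \<zero>\<^bsub>M\<^esub>" using factorisation_lin_ext[OF fac v] zero by simp
    with equational_criterion[OF flat finite_lessThan u factorisationD(1)[OF fac]]
    obtain q' y' \<rho>' where fac': "factorisation {..<q} y q' y' \<rho>'"
      and "lin_ext R (free_module R {..<q'}) \<rho>' ?u = (\<lambda>l. \<zero>)" by blast
    then have u_kernel: "?u \<in> relation_kernel {..<q} q' \<rho>'" using u by (simp add: relation_kernel_iff)
    let ?W = "relation_kernel J q' (\<lambda>i. lin_ext R (free_module R {..<q'}) \<rho>' (\<rho> i))"
    have "?W \<in> kernels" unfolding kernels_def using factorisation_trans[OF fac fac'] by blast
    then have "?W = V" using max[of ?W] relation_kernel_mono[OF fac fac'] by (simp add: V)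
    then show ?thesis using relation_kernel_trans[OF fac fac' v u_kernel] by (simp add: V)
  qed
  then have "effacing_factorisation J x q y \<rho>"
    using fac by (simp add: effacing_factorisation_def relation_kernel_iff)
  then show ?thesis by blast
qed

lemma flat_telescope_step:
  fixes k :: nat
  assumes noeth: "noetherian_ring R" and flat: "flat R M"
    and x: "x \<in> {..<k} \<rightarrow> carrier M" and u: "u \<in> carrier M"
  shows "\<exists>q y \<rho>. effacing_factorisation {..<k} x q y \<rho> \<and>
    u \<in> lin_ext R M y ` carrier (free_module R {..<q})"
proof -
  have "x(k := u) \<in> {..<Suc k} \<rightarrow> carrier M" using x u by (auto simp: Pi_iff less_Suc_eq)
  then obtain q y \<rho> where eff: "effacing_factorisation {..<Suc k} (x(k := u)) q y \<rho>"
    using effacing_factorisation_exists[OF noeth flat finite_lessThan] by blast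
  then have fac: "factorisation {..<Suc k} (x(k := u)) q y \<rho>" by (simp add: effacing_factorisation_def)
  have "lin_ext R (free_module R {..<q}) \<rho> v = (\<lambda>l. \<zero>)"
    if v: "v \<in> carrier (free_module R {..<k})" and zero: "lin_ext R M x v = \<zero>\<^bsub>M\<^esub>" for v
  proof -
    have "lin_ext R M (x(k := u)) v = lin_ext R M x v" by (rule lin_ext_cong[OF v x]) simp
    moreover have "v \<in> carrier (free_module R {..<Suc k})" by (rule R.free_module_mono[OF _ v]) auto
    ultimately show ?thesis using eff zero by (simp add: effacing_factorisation_def)
  qed
  moreover have "factorisation {..<k} x q y \<rho>"
    using fac unfolding factorisation_def by (auto simp: Pi_iff split: if_splits)
  ultimately have "effacing_factorisation {..<k} x q y \<rho>" by (simp add: effacing_factorisation_def)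
  moreover have "u = lin_ext R M y (\<rho> k)" using factorisationD(3)[OF fac, of k] by simp
  then have "u \<in> lin_ext R M y ` carrier (free_module R {..<q})"
    using factorisationD(2)[OF fac] by auto
  ultimately show ?thesis by blast
qed

lemma countably_generated_sequence:
  assumes "countably_generated R M"
  obtains u :: "nat \<Rightarrow> 'c"
  where "range u \<subseteq> carrier M" "\<forall>N. submodule N R M \<longrightarrow> range u \<subseteq> N \<longrightarrow> carrier M \<subseteq> N"
proof -
  obtain U where U: "U \<subseteq> carrier M" "countable U"
    and span: "carrier M = {lin_comb R M c |c. c \<in> coeffs R M \<and> {x. c x \<noteq> \<zero>} \<subseteq> U}"
    using assms unfolding countably_generated_def by blast
  define u where "u = from_nat_into (insert \<zero>\<^bsub>M\<^esub> U)"
  have u: "range u = insert \<zero>\<^bsub>M\<^esub> U" unfolding u_def using U(2) by (intro range_from_nat_into) auto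
  have "carrier M \<subseteq> N" if N: "submodule N R M" and "range u \<subseteq> N" for N
  proof
    have U_N: "U \<subseteq> N" using that(2) u by simp
    fix z assume "z \<in> carrier M"
    then obtain c where c: "c \<in> coeffs R M" "{x. c x \<noteq> \<zero>} \<subseteq> U" and z: "z = lin_comb R M c"
      unfolding span by blast
    have "c x \<odot>\<^bsub>M\<^esub> x \<in> N" if "c x \<noteq> \<zero>" for x
      using that c U_N by (intro submoduleE(4)[OF N]) (auto simp: coeffs_def)
    then show "z \<in> N" unfolding z lin_comb_eq_lin_ext by (rule lin_ext_mem_submodule[OF N])
  qed
  then show thesis using u U(1) by (intro that[of u]) simp_all
qed

lemma telescope_colimit_if_effacing:
  fixes k :: "nat \<Rightarrow> nat"
  assumes eff: "\<And>n. effacing_factorisation {..<k n} (x n) (k (Suc n)) (x (Suc n)) (A n)"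
    and closed: "\<And>n. x n \<in> {..<k n} \<rightarrow> carrier M"
    and u: "\<And>n. u n \<in> lin_ext R M (x (Suc n)) ` carrier (free_module R {..<k (Suc n)})"
    and span: "\<forall>N. submodule N R M \<longrightarrow> range u \<subseteq> N \<longrightarrow> carrier M \<subseteq> N"
  shows "telescope_colimit R (\<lambda>n. {..<k n}) A M x"
proof -
  have fac: "factorisation {..<k n} (x n) (k (Suc n)) (x (Suc n)) (A n)" for n
    using eff[of n] by (simp add: effacing_factorisation_def)
  have tele: "telescope R (\<lambda>n. {..<k n}) A"
    by (intro telescope.intro telescope_axioms.intro R.is_cring) (use factorisationD(2)[OF fac] in auto)
  then interpret tele: telescope R "\<lambda>n. {..<k n}" A .
  define V where "V n = lin_ext R M (x n) ` carrier (tele.level n)" for n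
  have V: "submodule (V n) R M" for n
    unfolding V_def
    by (rule linear_map.submodule_image[OF lin_ext_linear_map[OF closed]])
      (rule module.carrier_is_submodule[OF R.free_module])
  have "V n \<subseteq> V (Suc n)" for n
  proof
    fix z assume "z \<in> V n"
    then obtain v where v: "v \<in> carrier (tele.level n)" and z: "z = lin_ext R M (x n) v"
      unfolding V_def by blast
    have "z = lin_ext R M (x (Suc n)) (tele.step n v)"
      unfolding z tele.step_def by (rule factorisation_lin_ext[OF fac v, symmetric])
    then show "z \<in> V (Suc n)" unfolding V_def using tele.step_closed[OF v] by blast
  qed
  with V have "submodule (\<Union>n. V n) R M" by (rule submodule_Union_chain)
  moreover have "range u \<subseteq> (\<Union>n. V n)" using u unfolding V_def by blast
  ultimately have "carrier M \<subseteq> (\<Union>n. V n)" using span by simp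
  then have surjective: "\<exists>n. \<exists>v\<in>carrier (tele.level n). lin_ext R M (x n) v = z"
    if "z \<in> carrier M" for z
    using that unfolding V_def by blast
  have "tele.transition n (Suc 0) v = (\<lambda>i. \<zero>)"
    if "v \<in> carrier (tele.level n)" "lin_ext R M (x n) v = \<zero>\<^bsub>M\<^esub>" for n v
    using eff[of n] that by (simp add: effacing_factorisation_def tele.step_def)
  then show ?thesis
    using surjective factorisationD(3)[OF fac]
    by (intro telescope_colimit.intro telescope_colimit_axioms.intro tele module_axioms closed) blast+
qed

theorem flat_telescope_colimit:
  assumes noeth: "noetherian_ring R" and flat: "flat R M" and gen: "countably_generated R M"
  obtains k A x where "telescope_colimit R (\<lambda>n. {..<k n :: nat}) A M x"
proof -
  obtain u :: "nat \<Rightarrow> 'c" where "range u \<subseteq> carrier M"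
    and span: "\<forall>N. submodule N R M \<longrightarrow> range u \<subseteq> N \<longrightarrow> carrier M \<subseteq> N"
    using countably_generated_sequence[OF gen] .
  then have u: "u n \<in> carrier M" for n by blast
  define closed where "closed s \<longleftrightarrow> snd s \<in> {..<fst s} \<rightarrow> carrier M" for s :: "nat \<times> (nat \<Rightarrow> 'c)"
  define link where "link n s s' \<rho> \<longleftrightarrow> effacing_factorisation {..<fst s} (snd s) (fst s') (snd s') \<rho> \<and>
      u n \<in> lin_ext R M (snd s') ` carrier (free_module R {..<fst s'})"
    for n and s s' :: "nat \<times> (nat \<Rightarrow> 'c)" and \<rho>
  have step: "\<exists>s'. closed s' \<and> (\<exists>\<rho>. link n s s' \<rho>)" if s: "closed s" for n s
  proof -
    obtain q y \<rho> where "effacing_factorisation {..<fst s} (snd s) q y \<rho>"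
      and "u n \<in> lin_ext R M y ` carrier (free_module R {..<q})"
      using flat_telescope_step[OF noeth flat s[unfolded closed_def] u[of n]] by blast
    then have "link n s (q, y) \<rho>" "closed (q, y)"
      by (simp_all add: link_def closed_def effacing_factorisation_def factorisation_def)
    then show ?thesis by blast
  qed
  have "closed (0, \<lambda>i. \<zero>\<^bsub>M\<^esub>)" by (simp add: closed_def)
  then have "\<exists>f. \<forall>n. closed (f n) \<and> (\<exists>\<rho>. link n (f n) (f (Suc n)) \<rho>)"
    by (intro dependent_nat_choice step) blast+
  then obtain f where f: "\<And>n. closed (f n)" and "\<And>n. \<exists>\<rho>. link n (f n) (f (Suc n)) \<rho>" by blast
  then obtain A where A: "\<And>n. link n (f n) (f (Suc n)) (A n)" by metis
  have "telescope_colimit R (\<lambda>n. {..<fst (f n)}) A M (\<lambda>n. snd (f n))"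
    by (rule telescope_colimit_if_effacing[OF _ _ _ span])
      (use A f in \<open>auto simp: link_def closed_def\<close>)
  then show thesis by (rule that)
qed

end

theorem theorem2p4:
  fixes R :: "'r ring" and F :: "('r, 'm) module" and C :: "('r, 'c) module"
  assumes "noetherian_ring R"
    and "module R F"
    and "countably_generated R F"
    and "flat R F"
    and "module R C"
    and "almost_cotorsion R C"
  shows "ext1_vanishes R F C"
proof -
  interpret F: module R F by (rule assms(2))
  interpret C: module R C by (rule assms(5))
  obtain k A x where "telescope_colimit R (\<lambda>n. {..<k n :: nat}) A F x"
    using F.flat_telescope_colimit[OF assms(1,4,3)] .
  then interpret telescope_colimit R "\<lambda>n. {..<k n}" A F x .
  interpret C: telescope_module R "\<lambda>n. {..<k n}" A C ..
  have "submodule {\<zero>\<^bsub>C\<^esub>} R C" by (rule C.submoduleI) simp_all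
  then have "lim1_vanishes_mod R (\<lambda>n. {..<k n}) A C {\<zero>\<^bsub>C\<^esub>}"
    by (rule C.lim1_vanishes_mod_submodule[OF assms(1,6)])
  then show ?thesis by (simp only: ext1_vanishes_iff_lim1_vanishes[OF assms(5)])
qed

end
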